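(* The following existence problem is decidable in polynomial time. Given a Run-Constrained Sentence Instance $(\Sigma,\Pi,(k_1,\ldots,k_m),D,G)$, decide whether there exist an alternating sequence $t=((C_1,k_1),\ldots,(C_m,k_m))$ and a sentence $w\in D^*$ such that $w\in L(G)$ and $h(w)\in L_t$. Here polynomial time means polynomial in the size of the instance, where the length pattern $(k_1,\ldots,k_m)$ contributes its total length $K=\sum_{i=1}^m k_i$ to the size.
   Context: A Run-Constrained Sentence Instance consists of: a finite alphabet $\Sigma$ with a partition function $\Pi:\Sigma\to\{A,B\}$, dividing $\Sigma$ into two classes, also denoted $A=\Pi^{-1}(A)$ and $B=\Pi^{-1}(B)$; a length pattern $(k_1,\ldots,k_m)$ of positive integers; a finite dictionary $D\subseteq\Sigma^*$ of words; and a context-free grammar $G=(V,D,P,S)$ over $D$, i.e. a finite set $V$ of nonterminals, terminals being the words of $D$ (treated as atomic symbols), a finite set $P$ of productions $X\to\alpha$ with $X\in V$ and $\alpha\in(V\cup D)^*$, and a start symbol $S\in V$. The language $L(G)\subseteq D^*$ is the set of word sequences derivable from $S$, where $D^*$ is the set of finite sequences of words of $D$. Alternating sequence with length pattern $(k_1,\ldots,k_m)$: a sequence $t=((C_1,k_1),\ldots,(C_m,k_m))$ where each $C_i$ is a multi-set of symbols of $\Sigma$ with cardinality (with multiplicity) $|C_i|=k_i$, and, writing $\{C_i\}$ for the set of distinct symbols of $C_i$, either ($\{C_i\}\subseteq A$ for all odd $i$ and $\{C_i\}\subseteq B$ for all even $i$), or ($\{C_i\}\subseteq B$ for all odd $i$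 and $\{C_i\}\subseteq A$ for all even $i$). Block language: $L_t=\{C_1\}^{k_1}\{C_2\}^{k_2}\cdots\{C_m\}^{k_m}\subseteq\Sigma^*$, where $\{C_i\}^{k_i}$ is the set of all strings of length $k_i$ over the set $\{C_i\}$ and juxtaposition denotes concatenation of languages. Spelling homomorphism: $h:D^*\to\Sigma^*$ maps a sequence of words to the concatenation of their letters. *)

theory Defs
  imports Main "HOL-Library.Multiset" "HOL-Computational_Algebra.Polynomial"
begin

section \<open>Context-free grammars\<close>

datatype ('n, 't) sym = NT 'n | Tm 't

type_synonym ('n, 't) production = "'n \<times> ('n, 't) sym list"

inductive cfg_step ::
    "('n, 't) production set \<Rightarrow> ('n, 't) sym list \<Rightarrow> ('n, 't) sym list \<Rightarrow> bool"
  for P where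
  "(X, \<alpha>) \<in> P \<Longrightarrow> cfg_step P (u @ [NT X] @ v) (u @ \<alpha> @ v)"

definition cfg_lang :: "('n, 't) production set \<Rightarrow> 'n \<Rightarrow> 't list set" where
  "cfg_lang P S = {w. (cfg_step P)\<^sup>*\<^sup>* [NT S] (map Tm w)}"


section \<open>Alternating sequences and block languages\<close>

datatype letter_class = ClassA | ClassB

definition class_of :: "'a set \<Rightarrow> ('a \<Rightarrow> letter_class) \<Rightarrow> letter_class \<Rightarrow> 'a set" where
  "class_of \<Sigma> \<Pi> c = {a \<in> \<Sigma>. \<Pi> a = c}"

text \<open>Blocks are numbered from 1, so block \<open>i\<close> is \<open>t ! (i - 1)\<close>.\<close>

definition alternating ::
    "'a set \<Rightarrow> ('a \<Rightarrow> letter_class) \<Rightarrow> nat list \<Rightarrow> ('a multiset \<times> nat) list \<Rightarrow> bool" where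
  "alternating \<Sigma> \<Pi> ks t \<longleftrightarrow>
     map snd t = ks \<and>
     (\<forall>(C, k) \<in> set t. set_mset C \<subseteq> \<Sigma> \<and> size C = k) \<and>
     ((\<forall>i \<in> {1..length t}. set_mset (fst (t ! (i - 1)))
          \<subseteq> class_of \<Sigma> \<Pi> (if odd i then ClassA else ClassB)) \<or>
      (\<forall>i \<in> {1..length t}. set_mset (fst (t ! (i - 1)))
          \<subseteq> class_of \<Sigma> \<Pi> (if odd i then ClassB else ClassA)))"

fun block_lang :: "('a multiset \<times> nat) list \<Rightarrow> 'a list set" where
  "block_lang [] = {[]}"
| "block_lang ((C, k) # t) =
     {u @ v | u v. length u = k \<and> set u \<subseteq> set_mset C \<and> v \<in> block_lang t}"


section \<open>Run-constrained sentence instances\<close>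

text \<open>
  Instances are inputs to an algorithm, so they are given by finite data. The alphabet is
  \<open>\<Sigma> = {0, \<dots>, n - 1}\<close>, where \<open>n\<close> is the length of the list \<open>classes\<close>, which
  tabulates \<open>\<Pi>\<close>; the nonterminals are \<open>V = {0, \<dots>, nnonterms - 1}\<close>; the finite sets
  \<open>D\<close> and \<open>P\<close> are presented by duplicate-free enumerations. The terminals of the grammar
  are the dictionary words themselves, each one being a single grammar symbol.
\<close>

type_synonym word = "nat list"

record rcs_instance =
  classes :: "letter_class list"
  pattern :: "nat list"
  dict :: "word list"
  nnonterms :: nat
  prods :: "(nat, word) production list"
  start :: nat

definition alphabet :: "rcs_instance \<Rightarrow> nat set" where
  "alphabet I = {..<length (classes I)}"

definition partition_fun :: "rcs_instance \<Rightarrow> nat \<Rightarrow> letter_class" where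
  "partition_fun I a = classes I ! a"

definition nonterms :: "rcs_instance \<Rightarrow> nat set" where
  "nonterms I = {..<nnonterms I}"

definition wf_rcs :: "rcs_instance \<Rightarrow> bool" where
  "wf_rcs I \<longleftrightarrow>
     (\<forall>k \<in> set (pattern I). 0 < k) \<and>
     distinct (dict I) \<and>
     set (dict I) \<subseteq> lists (alphabet I) \<and>
     distinct (prods I) \<and>
     (\<forall>(X, \<alpha>) \<in> set (prods I).
        X \<in> nonterms I \<and> set \<alpha> \<subseteq> NT ` nonterms I \<union> Tm ` set (dict I)) \<and>
     start I \<in> nonterms I"

text \<open>The spelling homomorphism \<open>h\<close> is \<^const>\<open>concat\<close>.\<close>

definition rcs_solvable :: "rcs_instance \<Rightarrow> bool" where
  "rcs_solvable I \<longleftrightarrow>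
     (\<exists>t. \<exists>w \<in> lists (set (dict I)).
        alternating (alphabet I) (partition_fun I) (pattern I) t \<and>
        w \<in> cfg_lang (set (prods I)) (start I) \<and>
        concat w \<in> block_lang t)"

text \<open>
  \<open>|\<Sigma>| + K + |V|\<close> plus the lengths of the words and of the right-hand sides, with one
  extra unit per word and per production; a terminal in a right-hand side, being atomic,
  counts once. Each symbol name is thus charged one unit instead of its bit length, which makes this
  a lower bound (up to a constant factor) for the bit size of an instance, so that a time bound
  polynomial in \<open>rcs_size\<close> is also polynomial in the bit size.
\<close>

definition rcs_size :: "rcs_instance \<Rightarrow> nat" where
  "rcs_size I =
     length (classes I) + sum_list (pattern I)
     + (\<Sum>d \<leftarrow> dict I. length d + 1)
     + nnonterms I
     + (\<Sum>(X, \<alpha>) \<leftarrow> prods I. length \<alpha> + 1)"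


section \<open>Encoding of instances as sequences of numbers\<close>

definition enc_list :: "('a \<Rightarrow> nat list) \<Rightarrow> 'a list \<Rightarrow> nat list" where
  "enc_list f xs = length xs # concat (map f xs)"

definition enc_nat :: "nat \<Rightarrow> nat list" where
  "enc_nat n = [n]"

fun enc_class :: "letter_class \<Rightarrow> nat list" where
  "enc_class ClassA = [0]"
| "enc_class ClassB = [1]"

fun enc_sym :: "(nat, word) sym \<Rightarrow> nat list" where
  "enc_sym (NT X) = [0, X]"
| "enc_sym (Tm d) = 1 # enc_list enc_nat d"

fun enc_prod :: "(nat, word) production \<Rightarrow> nat list" where
  "enc_prod (X, \<alpha>) = X # enc_list enc_sym \<alpha>"

definition enc_rcs :: "rcs_instance \<Rightarrow> nat list" where
  "enc_rcs I =
     enc_list enc_class (classes I)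
     @ enc_list enc_nat (pattern I)
     @ enc_list (enc_list enc_nat) (dict I)
     @ enc_nat (nnonterms I)
     @ enc_list enc_prod (prods I)
     @ enc_nat (start I)"


section \<open>Polynomial time on random access machines\<close>

text \<open>
  The machine model is the RAM of Cook and Reckhow (Time bounded random access machines,
  JCSS 7, 1973), with registers \<open>X 0, X 1, \<dots>\<close> holding natural numbers, truncated
  subtraction, and the input on a read-only sequence consumed by \<open>Read\<close> (which delivers 0 past
  the end). Every instruction takes one step. There is no multiplication, so a run of \<open>T\<close> steps
  writes at most \<open>T\<close> registers and their contents have at most \<open>T\<close> bits more than the
  largest number in the program and the input; hence polynomial time on this machine coincides with
  polynomial time on Turing machines.
\<close>

datatype instr =
    Const nat nat
  | Add nat nat nat
  | Sub nat nat nat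
  | Load nat nat
  | Store nat nat
  | Jump nat nat
  | Read nat

type_synonym config = "nat \<times> (nat \<Rightarrow> nat) \<times> nat list"

fun exec :: "instr \<Rightarrow> config \<Rightarrow> config" where
  "exec (Const i c) (pc, X, inp) = (pc + 1, X(i := c), inp)"
| "exec (Add i j k) (pc, X, inp) = (pc + 1, X(i := X j + X k), inp)"
| "exec (Sub i j k) (pc, X, inp) = (pc + 1, X(i := X j - X k), inp)"
| "exec (Load i j) (pc, X, inp) = (pc + 1, X(i := X (X j)), inp)"
| "exec (Store i j) (pc, X, inp) = (pc + 1, X(X i := X j), inp)"
| "exec (Jump m j) (pc, X, inp) = (if X j > 0 then m else pc + 1, X, inp)"
| "exec (Read i) (pc, X, inp) =
     (pc + 1, X(i := (case inp of [] \<Rightarrow> 0 | x # _ \<Rightarrow> x)), tl inp)"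

text \<open>The machine halts when the program counter leaves the program.\<close>

fun ram_step :: "instr list \<Rightarrow> config \<Rightarrow> config" where
  "ram_step prog (pc, X, inp) =
     (if pc < length prog then exec (prog ! pc) (pc, X, inp) else (pc, X, inp))"

definition ram_computes_within :: "instr list \<Rightarrow> nat list \<Rightarrow> nat \<Rightarrow> nat \<Rightarrow> bool" where
  "ram_computes_within prog inp T out \<longleftrightarrow>
     (\<exists>s \<le> T. \<exists>pc X rest.
        (ram_step prog ^^ s) (0, \<lambda>_. 0, inp) = (pc, X, rest) \<and>
        length prog \<le> pc \<and> X 0 = out)"

definition poly_time_decidable ::
    "'i set \<Rightarrow> ('i \<Rightarrow> nat list) \<Rightarrow> ('i \<Rightarrow> nat) \<Rightarrow> ('i \<Rightarrow> bool) \<Rightarrow> bool" where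
  "poly_time_decidable Inst enc sz Q \<longleftrightarrow>
     (\<exists>prog. \<exists>p :: nat poly. \<forall>x \<in> Inst.
        ram_computes_within prog (enc x) (poly p (sz x)) (if Q x then 1 else 0))"

end

theory Submission
  imports Defs "HOL-Library.Nat_Bijection"
begin

text \<open>
  The sets \<open>C\<^sub>i\<close> only matter through the letters that a sentence actually uses, so an instance is
  solvable iff some \<open>w \<in> L(G)\<close> spells a string whose sequence of letter classes is one of the two
  class sequences prescribed by the length pattern. Writing these two sequences one after the
  other, with a separator between them, gives a single word \<open>c\<close> of length \<open>2 K + 1\<close>, and the question is
  whether the start symbol derives the factor of \<open>c\<close> between two given positions. This is answered as in the
  Cocke--Younger--Kasami algorithm: dotted right-hand sides turn the grammar into
  rules \<open>q \<rightarrow> a b\<close>, and the table of all triples \<open>(q, i, j)\<close> such that \<open>q\<close>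
  derives the factor from \<open>i\<close> to \<open>j\<close> is saturated.

  The algorithm is written in a small language whose loops are all bounded, so that its semantics
  (with a clock that counts machine steps) is a total function; a compiler into the
  random access machine preserves both the result and the clock.
\<close>

section \<open>A bounded-loop language and its compilation\<close>

text \<open>The multisets can be eliminated because a string whose letters have the right classes
  supplies them itself: its i-th block, read as a multiset, has size \<open>k_i\<close> and contains
  every letter that it must contain.

  The cost model shapes the rest. A terminal counts once in \<open>rcs_size\<close>, but its letters
  become separate rules; well-formedness makes it a dictionary word, so its length is at most the
  size n, and n symbols give at most n (n + 1) rules. Loops run up to values of variables and not
  only up to lengths, so numbers have to be bounded as well: names of nonterminals by |V|, entries
  of the pattern by K. There is no multiplication, so the cell of an entry \<open>(q, i, j)\<close>
  is found by Cantor pairing, computed by repeated addition. This address space is sparse, but it is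
  never scanned or cleared, since all registers start at zero. The time bounds are coarse on
  purpose: one number M bounds every quantity, and sums and products of polynomials are
  polynomials.\<close>

datatype com =
    Set nat nat
  | Plus nat nat nat
  | Minus nat nat nat
  | Get nat nat nat
  | Put nat nat nat
  | Inp nat
  | Skip
  | Seq com com (infixr ";;" 60)
  | Cond nat com com
  | For nat nat com

record st =
  vars :: "nat \<Rightarrow> nat"
  heap :: "nat \<Rightarrow> nat \<Rightarrow> nat"
  inp :: "nat list"
  clock :: nat

definition assign :: "nat \<Rightarrow> nat \<Rightarrow> nat \<Rightarrow> st \<Rightarrow> st" where
  "assign v x k s = s\<lparr>vars := (vars s)(v := x), clock := clock s + k\<rparr>"

definition tick :: "nat \<Rightarrow> st \<Rightarrow> st" where
  "tick k s = s\<lparr>clock := clock s + k\<rparr>"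

text \<open>The charges are the exact lengths of the compiled code. A heap access takes six steps
  for the address and one for the access. A loop takes 3 steps to set up, 3 per iteration to enter
  the body, 4 to advance and 3 to leave. The iteration count is fixed on entry, so the body may
  overwrite both the bound and the loop variable.\<close>

primrec sem :: "com \<Rightarrow> st \<Rightarrow> st" where
  "sem (Set v x) = assign v x 1"
| "sem (Plus v a b) = (\<lambda>s. assign v (vars s a + vars s b) 1 s)"
| "sem (Minus v a b) = (\<lambda>s. assign v (vars s a - vars s b) 1 s)"
| "sem (Get v t a) = (\<lambda>s. assign v (heap s t (vars s a)) 7 s)"
| "sem (Put t a v) = (\<lambda>s. s\<lparr>heap := (heap s)(t := (heap s t)(vars s a := vars s v)), clock := clock s + 7\<rparr>)"
| "sem (Inp v) = (\<lambda>s. assign v (case inp s of [] \<Rightarrow> 0 | x # _ \<Rightarrow> x) 1 (s\<lparr>inp := tl (inp s)\<rparr>))"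
| "sem Skip = (\<lambda>s. s)"
| "sem (c1 ;; c2) = (\<lambda>s. sem c2 (sem c1 s))"
| "sem (Cond v c1 c2) = (\<lambda>s. if 0 < vars s v then sem c1 (tick 1 s) else tick 2 (sem c2 (tick 1 s)))"
| "sem (For v n c) = (\<lambda>s. tick 3 (fold (\<lambda>i s. tick 4 (sem c (assign v i 3 s))) [0..<vars s n] (tick 3 s)))"

text \<open>Together with \<open>puts\<close> and \<open>reads\<close>, a syntactic
  over-approximation of the effects of a command. It turns frame properties into rewrite rules, so
  that invariants need not list what stays the same.\<close>

primrec mods :: "com \<Rightarrow> nat set" where
  "mods (Set v x) = {v}"
| "mods (Plus v a b) = {v}"
| "mods (Minus v a b) = {v}"
| "mods (Get v t a) = {v}"
| "mods (Put t a v) = {}"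
| "mods (Inp v) = {v}"
| "mods Skip = {}"
| "mods (c1 ;; c2) = mods c1 \<union> mods c2"
| "mods (Cond v c1 c2) = mods c1 \<union> mods c2"
| "mods (For v n c) = insert v (mods c)"

primrec puts :: "com \<Rightarrow> nat set" where
  "puts (Set v x) = {}"
| "puts (Plus v a b) = {}"
| "puts (Minus v a b) = {}"
| "puts (Get v t a) = {}"
| "puts (Put t a v) = {t}"
| "puts (Inp v) = {}"
| "puts Skip = {}"
| "puts (c1 ;; c2) = puts c1 \<union> puts c2"
| "puts (Cond v c1 c2) = puts c1 \<union> puts c2"
| "puts (For v n c) = puts c"

primrec reads :: "com \<Rightarrow> bool" where
  "reads (Set v x) = False"
| "reads (Plus v a b) = False"
| "reads (Minus v a b) = False"
| "reads (Get v t a) = False"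
| "reads (Put t a v) = False"
| "reads (Inp v) = True"
| "reads Skip = False"
| "reads (c1 ;; c2) = (reads c1 \<or> reads c2)"
| "reads (Cond v c1 c2) = (reads c1 \<or> reads c2)"
| "reads (For v n c) = reads c"

section \<open>Frame properties and the loop rule\<close>

lemma assign_simps [simp]:
  "vars (assign v x k s) = (vars s)(v := x)" "heap (assign v x k s) = heap s"
  "inp (assign v x k s) = inp s" "clock (assign v x k s) = clock s + k"
  by (simp_all add: assign_def)

lemma tick_simps [simp]:
  "vars (tick k s) = vars s" "heap (tick k s) = heap s"
  "inp (tick k s) = inp s" "clock (tick k s) = clock s + k"
  by (simp_all add: tick_def)

lemma fold_invariant_nat:
  assumes "P 0 s" "\<And>i s. i < n \<Longrightarrow> P i s \<Longrightarrow> P (Suc i) (f i s)"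
  shows "P n (fold f [0..<n] s)"
proof -
  have "m \<le> n \<Longrightarrow> P m (fold f [0..<m] s)" for m
    using assms by (induction m) auto
  then show ?thesis by simp
qed

lemma sem_vars [simp]: "v \<notin> mods c \<Longrightarrow> vars (sem c s) v = vars s v"
proof (induction c arbitrary: s)
  case (For w n c)
  have "vars (fold (\<lambda>i s. tick 4 (sem c (assign w i 3 s))) [0..<m] r) v = vars r v" for m r
    by (rule fold_invariant_nat[where P = "\<lambda>_ t. vars t v = vars r v"]) (use For in auto)
  then show ?case by simp
qed auto

lemma sem_heap [simp]: "t \<notin> puts c \<Longrightarrow> heap (sem c s) t = heap s t"
proof (induction c arbitrary: s)
  case (For w n c)
  have "heap (fold (\<lambda>i s. tick 4 (sem c (assign w i 3 s))) [0..<m] r) t = heap r t" for m r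
    by (rule fold_invariant_nat[where P = "\<lambda>_ u. heap u t = heap r t"]) (use For in auto)
  then show ?case by simp
qed auto

lemma sem_inp [simp]: "\<not> reads c \<Longrightarrow> inp (sem c s) = inp s"
proof (induction c arbitrary: s)
  case (For w n c)
  have "inp (fold (\<lambda>i s. tick 4 (sem c (assign w i 3 s))) [0..<m] r) = inp r" for m r
    by (rule fold_invariant_nat[where P = "\<lambda>_ u. inp u = inp r"]) (use For in auto)
  then show ?case by simp
qed auto

text \<open>The invariant does not see the clock: time is a bound \<open>T\<close> per iteration,
  multiplied out once. \<open>M\<close> may be any upper bound on the number of iterations, which
  lets all running times depend on a single size parameter.\<close>

lemma for_rule:
  fixes s0 :: st
  assumes "n = vars s0 r" "n \<le> M" "P 0 (vars s0) (heap s0) (inp s0)"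
    and "\<And>i (s :: st). i < n \<Longrightarrow> P i (vars s) (heap s) (inp s) \<Longrightarrow>
      (\<And>w. w \<noteq> v \<Longrightarrow> w \<notin> mods c \<Longrightarrow> vars s w = vars s0 w) \<Longrightarrow>
      (\<And>t. t \<notin> puts c \<Longrightarrow> heap s t = heap s0 t) \<Longrightarrow>
      P (Suc i) (vars (sem c (assign v i 3 s))) (heap (sem c (assign v i 3 s))) (inp (sem c (assign v i 3 s)))
      \<and> clock (sem c (assign v i 3 s)) \<le> clock s + T"
  shows "P n (vars (sem (For v r c) s0)) (heap (sem (For v r c) s0)) (inp (sem (For v r c) s0))
    \<and> clock (sem (For v r c) s0) \<le> clock s0 + M * (T + 4) + 6"
proof -
  let ?f = "fold (\<lambda>i s. tick 4 (sem c (assign v i 3 s))) [0..<n] (tick 3 s0)"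
  have "P n (vars ?f) (heap ?f) (inp ?f) \<and> clock ?f \<le> clock s0 + n * (T + 4) + 3
    \<and> (\<forall>w. w \<noteq> v \<and> w \<notin> mods c \<longrightarrow> vars ?f w = vars s0 w)
    \<and> (\<forall>t. t \<notin> puts c \<longrightarrow> heap ?f t = heap s0 t)"
  proof (rule fold_invariant_nat[where P = "\<lambda>i (s :: st). P i (vars s) (heap s) (inp s)
      \<and> clock s \<le> clock s0 + i * (T + 4) + 3
    \<and> (\<forall>w. w \<noteq> v \<and> w \<notin> mods c \<longrightarrow> vars s w = vars s0 w)
    \<and> (\<forall>t. t \<notin> puts c \<longrightarrow> heap s t = heap s0 t)"])
    fix i and s :: st
    assume "i < n" and *: "P i (vars s) (heap s) (inp s) \<and> clock s \<le> clock s0 + i * (T + 4) + 3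
      \<and> (\<forall>w. w \<noteq> v \<and> w \<notin> mods c \<longrightarrow> vars s w = vars s0 w)
      \<and> (\<forall>t. t \<notin> puts c \<longrightarrow> heap s t = heap s0 t)"
    with assms(4)[of i s]
    have "P (Suc i) (vars (sem c (assign v i 3 s))) (heap (sem c (assign v i 3 s))) (inp (sem c (assign v i 3 s)))
      \<and> clock (sem c (assign v i 3 s)) \<le> clock s + T" by blast
    with * show "P (Suc i) (vars (tick 4 (sem c (assign v i 3 s)))) (heap (tick 4 (sem c (assign v i 3 s))))
           (inp (tick 4 (sem c (assign v i 3 s))))
       \<and> clock (tick 4 (sem c (assign v i 3 s))) \<le> clock s0 + Suc i * (T + 4) + 3
      \<and> (\<forall>w. w \<noteq> v \<and> w \<notin> mods c \<longrightarrow> vars (tick 4 (sem c (assign v i 3 s))) w = vars s0 w)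
      \<and> (\<forall>t. t \<notin> puts c \<longrightarrow> heap (tick 4 (sem c (assign v i 3 s))) t = heap s0 t)"
      by auto
  qed (use assms(3) in auto)
  moreover from this have "clock ?f \<le> clock s0 + M * (T + 4) + 3"
    using mult_le_mono1[OF assms(2), of "T + 4"] by linarith
  ultimately show ?thesis using assms(1) by simp
qed

section \<open>Compilation into machine code and its correctness\<close>

primrec tags_ok :: "com \<Rightarrow> bool" where
  "tags_ok (Set v x) = True"
| "tags_ok (Plus v a b) = True"
| "tags_ok (Minus v a b) = True"
| "tags_ok (Get v t a) = (t < 8)"
| "tags_ok (Put t a v) = (t < 8)"
| "tags_ok (Inp v) = True"
| "tags_ok Skip = True"
| "tags_ok (c1 ;; c2) = (tags_ok c1 \<and> tags_ok c2)"
| "tags_ok (Cond v c1 c2) = (tags_ok c1 \<and> tags_ok c2)"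
| "tags_ok (For v n c) = tags_ok c"


text \<open>Variable \<open>v\<close> lives in register \<open>4 v\<close> and heap cell \<open>(t, a)\<close> in register \<open>16 a + 2 t + 1\<close>, where \<open>t < 8\<close>.
  The registers congruent to 2 modulo 4 hold temporaries; those numbered \<open>8 d + 10\<close> and \<open>8 d + 14\<close> are the
  counter and the index of the loop at nesting depth \<open>d\<close>.\<close>

definition addr_code :: "nat \<Rightarrow> nat \<Rightarrow> instr list" where
  "addr_code t a =
     [Add 2 (4 * a) (4 * a), Add 2 2 2, Add 2 2 2, Add 2 2 2, Const 6 (2 * t + 1), Add 2 2 6]"

text \<open>All machine jumps are conditional, so an unconditional one puts 1 into register 2 and
  tests it; a copy is a zeroing followed by an addition. Jump targets are absolute, hence the start
  address \<open>p\<close>; \<open>d\<close> is the loop nesting depth.\<close>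

primrec compile :: "com \<Rightarrow> nat \<Rightarrow> nat \<Rightarrow> instr list" where
  "compile (Set v x) d p = [Const (4 * v) x]"
| "compile (Plus v a b) d p = [Add (4 * v) (4 * a) (4 * b)]"
| "compile (Minus v a b) d p = [Sub (4 * v) (4 * a) (4 * b)]"
| "compile (Get v t a) d p = addr_code t a @ [Load (4 * v) 2]"
| "compile (Put t a v) d p = addr_code t a @ [Store 2 (4 * v)]"
| "compile (Inp v) d p = [Read (4 * v)]"
| "compile Skip d p = []"
| "compile (c1 ;; c2) d p = (let l1 = compile c1 d p in l1 @ compile c2 d (p + length l1))"
| "compile (Cond v c1 c2) d p =
    (let l2 = compile c2 d (p + 1); l1 = compile c1 d (p + length l2 + 3) in
     Jump (p + length l2 + 3) (4 * v) # l2
     @ Const 2 1 # Jump (p + length l2 + 3 + length l1) 2 # l1)"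
| "compile (For v n c) d p =
    (let l = compile c (d + 1) (p + 8); cnt = 8 * d + 10; idx = 8 * d + 14 in
     Const cnt 0 # Add cnt cnt (4 * n) # Const idx 0
     # Jump (p + 6) cnt # Const 2 1 # Jump (p + length l + 12) 2
     # Const (4 * v) 0 # Add (4 * v) (4 * v) idx # l
     @ [Const 2 1, Add idx idx 2, Sub cnt cnt 2, Jump (p + 3) 2])"

primrec code_at :: "instr list \<Rightarrow> nat \<Rightarrow> instr list \<Rightarrow> bool" where
  "code_at prog p [] = True"
| "code_at prog p (i # is) = (p < length prog \<and> prog ! p = i \<and> code_at prog (Suc p) is)"

lemma code_at_append [simp]:
  "code_at prog p (xs @ ys) \<longleftrightarrow> code_at prog p xs \<and> code_at prog (p + length xs) ys"
  by (induction xs arbitrary: p) auto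

lemma code_at_self: "code_at prog 0 prog"
proof -
  have "code_at (pre @ xs) (length pre) xs" for pre xs
  proof (induction xs arbitrary: pre)
    case (Cons x xs)
    from Cons[of "pre @ [x]"] show ?case by simp
  qed simp
  from this[of "[]"] show ?thesis by simp
qed

definition reach :: "instr list \<Rightarrow> config \<Rightarrow> nat \<Rightarrow> config \<Rightarrow> bool" where
  "reach prog c k c' \<longleftrightarrow> (ram_step prog ^^ k) c = c'"

lemma reach_0 [simp]: "reach prog c 0 c' \<longleftrightarrow> c = c'"
  by (simp add: reach_def)

lemma reach_Suc [simp]: "reach prog c (Suc k) c' \<longleftrightarrow> reach prog (ram_step prog c) k c'"
  by (simp add: reach_def funpow_swap1)

lemma reach_trans: "reach prog a k b \<Longrightarrow> reach prog b l c \<Longrightarrow> reach prog a (k + l) c"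
  by (auto simp: reach_def funpow_add add.commute[of k])

lemma reach_numeral [simp]:
  "reach prog c (numeral n) c' \<longleftrightarrow> reach prog (ram_step prog c) (pred_numeral n) c'"
  by (simp add: numeral_eq_Suc)

definition rep :: "(nat \<Rightarrow> nat) \<Rightarrow> st \<Rightarrow> bool" where
  "rep X s \<longleftrightarrow> (\<forall>v. X (4 * v) = vars s v) \<and> (\<forall>t<8. \<forall>a. X (16 * a + 2 * t + 1) = heap s t a)"

text \<open>Time is an equality, so clocks simply add up along a composition. Preservation of the
  loop registers below depth \<open>d\<close> is what lets an enclosing loop resume after its
  body.\<close>

definition simulates :: "instr list \<Rightarrow> nat \<Rightarrow> nat \<Rightarrow> nat \<Rightarrow> (nat \<Rightarrow> nat) \<Rightarrow> st \<Rightarrow> st \<Rightarrow> bool" where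
  "simulates prog d p q X s s' \<longleftrightarrow>
    (\<exists>k X'. reach prog (p, X, inp s) k (q, X', inp s') \<and> clock s' = clock s + k \<and> rep X' s'
      \<and> (\<forall>e<d. X' (8 * e + 10) = X (8 * e + 10) \<and> X' (8 * e + 14) = X (8 * e + 14)))"

text \<open>Variables are 0 modulo 4, loop registers are 2 modulo 4, and heap cells are odd.\<close>

lemma regs_disjoint:
  fixes e :: nat
  shows "8 * e + 10 \<noteq> 4 * v" "8 * e + 14 \<noteq> 4 * v" "4 * v \<noteq> 8 * e + 10" "4 * v \<noteq> 8 * e + 14"
    "Suc (16 * a + 2 * t) \<noteq> 4 * v" "4 * v \<noteq> Suc (16 * a + 2 * t)"
    "Suc (16 * a + 2 * t) \<noteq> 8 * e + 10" "Suc (16 * a + 2 * t) \<noteq> 8 * e + 14"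
    "8 * e + 10 \<noteq> Suc (16 * a + 2 * t)" "8 * e + 14 \<noteq> Suc (16 * a + 2 * t)"
  by presburger+

lemma heap_address_inj:
  fixes t t' :: nat
  assumes "t < 8" "t' < 8"
  shows "16 * b + 2 * t' + 1 = 16 * a + 2 * t + 1 \<longleftrightarrow> b = a \<and> t' = t"
proof
  assume "16 * b + 2 * t' + 1 = 16 * a + 2 * t + 1"
  then have "t' + b * 8 = t + a * 8" by simp
  then have "(t' + b * 8) mod 8 = (t + a * 8) mod 8" "(t' + b * 8) div 8 = (t + a * 8) div 8" by simp_all
  then show "b = a \<and> t' = t" using assms by simp
qed simp

lemma rep_assign:
  "rep X s \<Longrightarrow> rep (X(4 * v := x)) (assign v x k s)"
  unfolding rep_def by (auto simp: regs_disjoint)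

lemma rep_temp:
  "rep X s \<Longrightarrow> r mod 4 = 2 \<Longrightarrow> rep (X(r := x)) s"
  unfolding rep_def by (auto; presburger)

lemma length_addr_code [simp]: "length (addr_code t a) = 6"
  by (simp add: addr_code_def)

lemma addr_code_reach:
  assumes "code_at prog p (addr_code t a)" "rep X s"
  shows "\<exists>y. reach prog (p, X, inp s) 6 (p + 6, X(2 := 16 * vars s a + 2 * t + 1, 6 := y), inp s)"
proof -
  have "X (4 * a) = vars s a" using assms(2) by (simp add: rep_def)
  then show ?thesis using assms(1)
    by (intro exI[of _ "2 * t + 1"]) (auto simp: addr_code_def fun_eq_iff algebra_simps)
qed

lemma simulates_trans:
  "simulates prog d p q X s s' \<Longrightarrow> (\<And>X'. rep X' s' \<Longrightarrow> simulates prog d q r X' s' s'') \<Longrightarrow>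
   simulates prog d p r X s s''"
  unfolding simulates_def by (smt (verit, ccfv_threshold) add.assoc reach_trans)

lemma simulates_steps:
  assumes "reach prog (p, X, inp s) k (p', X', inp sm)" "clock sm = clock s + k"
    "\<And>e. e < d \<Longrightarrow> X' (8 * e + 10) = X (8 * e + 10) \<and> X' (8 * e + 14) = X (8 * e + 14)"
    and "simulates prog d p' q X' sm s'"
  shows "simulates prog d p q X s s'"
proof -
  from assms(2,4) obtain l Y where "reach prog (p', X', inp sm) l (q, Y, inp s')" "clock s' = clock s + k + l"
     "rep Y s'" "\<forall>e<d. Y (8 * e + 10) = X' (8 * e + 10) \<and> Y (8 * e + 14) = X' (8 * e + 14)"
    by (auto simp: simulates_def)
  with reach_trans[OF assms(1) this(1)] assms(3) show ?thesis
    unfolding simulates_def by (intro exI[of _ "k + l"] exI[of _ Y]) auto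
qed

lemma simulates_refl: "rep X s \<Longrightarrow> simulates prog d p p X s s"
  unfolding simulates_def by (intro exI[of _ 0] exI[of _ X]) auto

lemma rep_tick [simp]: "rep X (tick k s) \<longleftrightarrow> rep X s"
  by (simp add: rep_def)

lemma rep_var: "rep X s \<Longrightarrow> X (4 * v) = vars s v"
  by (simp add: rep_def)

lemma compile_correct:
  "\<lbrakk>tags_ok c; code_at prog p (compile c d p); rep X s\<rbrakk> \<Longrightarrow>
    simulates prog d p (p + length (compile c d p)) X s (sem c s)"
proof (induction c arbitrary: d p X s)
  case (Set v x)
  then show ?case unfolding simulates_def
    by (intro exI[of _ 1] exI[of _ "X(4 * v := x)"]) (auto intro!: rep_assign simp: regs_disjoint)
next
  case (Plus v a b)
  then show ?case unfolding simulates_def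
    by (intro exI[of _ 1] exI[of _ "X(4 * v := X (4 * a) + X (4 * b))"])
      (auto intro!: rep_assign simp: rep_var regs_disjoint)
next
  case (Minus v a b)
  then show ?case unfolding simulates_def
    by (intro exI[of _ 1] exI[of _ "X(4 * v := X (4 * a) - X (4 * b))"])
      (auto intro!: rep_assign simp: rep_var regs_disjoint)
next
  case (Get v t a)
  from Get.prems obtain y where
    y: "reach prog (p, X, inp s) 6 (p + 6, X(2 := 16 * vars s a + 2 * t + 1, 6 := y), inp s)"
    using addr_code_reach by fastforce
  let ?Y = "X(2 := 16 * vars s a + 2 * t + 1, 6 := y)"
  have Y: "rep ?Y s" using Get.prems by (intro rep_temp) auto
  with Get.prems(1) have h: "?Y (16 * vars s a + 2 * t + 1) = heap s t (vars s a)"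
    unfolding rep_def by simp
  have 1: "reach prog (p + 6, ?Y, inp s) 1 (p + 7, ?Y(4 * v := heap s t (vars s a)), inp s)"
    using Get.prems(2) h by (auto simp: fun_eq_iff)
  show ?case unfolding simulates_def
  proof (intro exI conjI)
    show "reach prog (p, X, inp s) (6 + 1) (p + length (compile (Get v t a) d p),
        ?Y(4 * v := heap s t (vars s a)), inp (sem (Get v t a) s))"
      using reach_trans[OF y 1] by (simp add: addr_code_def add.commute)
    show "rep (?Y(4 * v := heap s t (vars s a))) (sem (Get v t a) s)"
      using rep_assign[OF Y] by simp
  qed (auto simp: regs_disjoint)
next
  case (Put t a v)
  from Put.prems obtain y where
    y: "reach prog (p, X, inp s) 6 (p + 6, X(2 := 16 * vars s a + 2 * t + 1, 6 := y), inp s)"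
    using addr_code_reach by fastforce
  let ?Y = "X(2 := 16 * vars s a + 2 * t + 1, 6 := y)" and ?z = "16 * vars s a + 2 * t + 1"
  have Y: "rep ?Y s" using Put.prems by (intro rep_temp) auto
  have "?Y (4 * v) = vars s v" using rep_var[OF Y] .
  then have 1: "reach prog (p + 6, ?Y, inp s) 1 (p + 7, ?Y(?z := vars s v), inp s)"
    using Put.prems(2) by (auto simp: fun_eq_iff)
  show ?case unfolding simulates_def
  proof (intro exI conjI)
    show "reach prog (p, X, inp s) (6 + 1) (p + length (compile (Put t a v) d p),
        ?Y(?z := vars s v), inp (sem (Put t a v) s))"
      using reach_trans[OF y 1] by (simp add: addr_code_def add.commute)
    show "rep (?Y(?z := vars s v)) (sem (Put t a v) s)"
      unfolding rep_def
    proof (intro conjI allI impI)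
      fix w
      show "(?Y(?z := vars s v)) (4 * w) = vars (sem (Put t a v) s) w"
        using rep_var[OF Y, of w] regs_disjoint(6)[of w "vars s a" t] by simp
    next
      fix t' b :: nat
      assume "t' < 8"
      moreover from this have "?Y (16 * b + 2 * t' + 1) = heap s t' b" using Y unfolding rep_def by blast
      moreover have "t < 8" using Put.prems(1) by simp
      ultimately show "(?Y(?z := vars s v)) (16 * b + 2 * t' + 1) = heap (sem (Put t a v) s) t' b"
        using heap_address_inj[of t t' b "vars s a"] by (simp only: fun_upd_apply) auto
    qed
  qed (auto simp: regs_disjoint)
next
  case (Inp v)
  then show ?case unfolding simulates_def
    by (intro exI[of _ 1] exI[of _ "X(4 * v := (case inp s of [] \<Rightarrow> 0 | x # _ \<Rightarrow> x))"])
      (auto simp: rep_def regs_disjoint)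
next
  case Skip
  then show ?case by (simp add: simulates_refl)
next
  case (Seq c1 c2)
  define l1 where "l1 = compile c1 d p"
  define l2 where "l2 = compile c2 d (p + length l1)"
  have at: "code_at prog p l1" "code_at prog (p + length l1) l2"
    using Seq.prems(2) by (simp_all add: l1_def l2_def Let_def)
  have "simulates prog d p (p + length l1 + length l2) X s (sem c2 (sem c1 s))"
  proof (rule simulates_trans)
    show "simulates prog d p (p + length l1) X s (sem c1 s)"
      using Seq.IH(1)[of p d X s] Seq.prems at(1) by (simp add: l1_def)
    show "simulates prog d (p + length l1) (p + length l1 + length l2) Y (sem c1 s) (sem c2 (sem c1 s))"
      if "rep Y (sem c1 s)" for Y
      using Seq.IH(2)[of "p + length l1" d Y "sem c1 s"] Seq.prems at(2) that by (simp add: l2_def)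
  qed
  then show ?case by (simp add: l1_def l2_def Let_def add.assoc)
next
  case (Cond v c1 c2)
  define l2 where "l2 = compile c2 d (p + 1)"
  define q where "q = p + length l2 + 3"
  define l1 where "l1 = compile c1 d q"
  have eq: "compile (Cond v c1 c2) d p = Jump q (4 * v) # l2 @ Const 2 1 # Jump (q + length l1) 2 # l1"
    by (simp add: l1_def l2_def q_def Let_def)
  have at: "p < length prog" "prog ! p = Jump q (4 * v)" "code_at prog (p + 1) l2"
    "code_at prog (p + 1 + length l2) [Const 2 1, Jump (q + length l1) 2]" "code_at prog q l1"
    using Cond.prems(2) unfolding eq by (simp_all add: q_def eval_nat_numeral)
  have X: "X (4 * v) = vars s v" using Cond.prems by (simp add: rep_var)
  show ?case
  proof (cases "0 < vars s v")
    case True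
    have "simulates prog d q (q + length l1) X (tick 1 s) (sem c1 (tick 1 s))"
      unfolding l1_def using Cond at by (intro Cond.IH(1)) (auto simp: l1_def)
    then have "simulates prog d p (q + length l1) X s (sem c1 (tick 1 s))"
      by (rule simulates_steps[where k = 1, rotated -1]) (use at X True Cond.prems in auto)
    then show ?thesis using True unfolding eq by (simp add: add.assoc q_def eval_nat_numeral)
  next
    case False
    have "simulates prog d (p + 1) (p + 1 + length l2) X (tick 1 s) (sem c2 (tick 1 s))"
      unfolding l2_def using Cond at by (intro Cond.IH(2)) (auto simp: l2_def)
    then have "simulates prog d p (p + 1 + length l2) X s (sem c2 (tick 1 s))"
      by (rule simulates_steps[where k = 1, rotated -1]) (use at X False Cond.prems in auto)
    moreover have "simulates prog d (p + 1 + length l2) (q + length l1) Y s' (tick 2 s')"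
      if "rep Y s'" for Y s'
    proof (rule simulates_steps[where k = 2 and sm = "tick 2 s'"])
      show "reach prog (p + 1 + length l2, Y, inp s') 2 (q + length l1, Y(2 := 1), inp (tick 2 s'))"
        using at(4) by auto
      have "rep (Y(2 := 1)) (tick 2 s')" using rep_temp[OF that] by simp
      then show "simulates prog d (q + length l1) (q + length l1) (Y(2 := 1)) (tick 2 s') (tick 2 s')"
        by (rule simulates_refl)
    qed auto
    ultimately show ?thesis using False unfolding eq by (auto simp: add.assoc q_def eval_nat_numeral intro: simulates_trans)
  qed
next
  case (For v n c)
  define l where "l = compile c (d + 1) (p + 8)"
  define cnt where "cnt = 8 * d + 10"
  define idx where "idx = 8 * d + 14"
  define f where "f = (\<lambda>i s. tick 4 (sem c (assign v i 3 s)))"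
  have eq: "compile (For v n c) d p = Const cnt 0 # Add cnt cnt (4 * n) # Const idx 0
     # Jump (p + 6) cnt # Const 2 1 # Jump (p + length l + 12) 2
     # Const (4 * v) 0 # Add (4 * v) (4 * v) idx # l
     @ [Const 2 1, Add idx idx 2, Sub cnt cnt 2, Jump (p + 3) 2]"
    by (simp add: l_def cnt_def idx_def Let_def)
  have at: "code_at prog p [Const cnt 0, Add cnt cnt (4 * n), Const idx 0]"
    "code_at prog (p + 3) [Jump (p + 6) cnt, Const 2 1, Jump (p + length l + 12) 2]"
    "code_at prog (p + 6) [Const (4 * v) 0, Add (4 * v) (4 * v) idx]"
    "code_at prog (p + 8) l"
    "code_at prog (p + 8 + length l) [Const 2 1, Add idx idx 2, Sub cnt cnt 2, Jump (p + 3) 2]"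
    using For.prems(2) unfolding eq by (simp_all add: eval_nat_numeral)
  have ne: "cnt \<noteq> idx" "idx \<noteq> 2" "cnt \<noteq> 2" "cnt mod 4 = 2" "idx mod 4 = 2"
    "4 * w \<noteq> cnt" "4 * w \<noteq> idx" "4 * w \<noteq> 2"  for w
    by (simp_all add: cnt_def idx_def; presburger)+
  have ned: "8 * e + 10 \<noteq> cnt \<and> 8 * e + 14 \<noteq> cnt \<and> 8 * e + 10 \<noteq> idx \<and> 8 * e + 14 \<noteq> idx
      \<and> 8 * e + 10 \<noteq> 4 * w \<and> 8 * e + 14 \<noteq> 4 * w \<and> 8 * e + 10 \<noteq> (2::nat) \<and> 8 * e + 14 \<noteq> (2::nat)"
    if "e < d" for e w
    using that by (simp add: cnt_def idx_def; presburger)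
  \<comment> \<open>The state at the loop head with \<open>m\<close> iterations left and
    \<open>i\<close> as the next index; \<open>i\<close> has to be general for the induction on
    \<open>m\<close>.\<close>
  have loop: "simulates prog d (p + 3) (p + length l + 12) Y s' (tick 3 (fold f [i..<i + m] s'))"
    if "rep Y s'" "Y cnt = m" "Y idx = i" for Y s' i m
    using that
  proof (induction m arbitrary: i Y s')
    case 0
    show ?case
    proof (rule simulates_steps[where k = 3 and sm = "tick 3 s'"])
      show "reach prog (p + 3, Y, inp s') 3 (p + length l + 12, Y(2 := 1), inp (tick 3 s'))"
        using at(2) 0 by (auto simp: ne eval_nat_numeral)
      have "rep (Y(2 := 1)) (tick 3 s')" using rep_temp 0 by simp
      then show "simulates prog d (p + length l + 12) (p + length l + 12) (Y(2 := 1)) (tick 3 s')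
          (tick 3 (fold f [i..<i + 0] s'))"
        using simulates_refl by simp
    qed (use ned in auto)
  next
    case (Suc m)
    let ?s1 = "assign v i 3 s'"
    define Y1 where "Y1 = Y(4 * v := i)"
    have reach1: "reach prog (p + 3, Y, inp s') 3 (p + 8, Y1, inp s')"
      using at(2,3) Suc.prems by (auto simp: ne ne(7)[symmetric] Y1_def)
    have Y1: "rep Y1 ?s1" unfolding Y1_def by (rule rep_assign) (rule Suc.prems(1))
    have "simulates prog (d + 1) (p + 8) (p + 8 + length l) Y1 ?s1 (sem c ?s1)"
      unfolding l_def using For.prems(1) at(4) Y1 by (intro For.IH) (auto simp: l_def)
    then obtain k Y2 where k: "reach prog (p + 8, Y1, inp s') k (p + 8 + length l, Y2, inp (sem c ?s1))"
      "clock (sem c ?s1) = clock s' + 3 + k" "rep Y2 (sem c ?s1)"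
      "\<And>e. e < d + 1 \<Longrightarrow> Y2 (8 * e + 10) = Y1 (8 * e + 10) \<and> Y2 (8 * e + 14) = Y1 (8 * e + 14)"
      by (auto simp: simulates_def)
    \<comment> \<open>The body is compiled at depth \<open>d + 1\<close>, so the registers of depth
      \<open>d\<close>, which belong to this very loop, survive it.\<close>
    have Y2: "Y2 cnt = Suc m" "Y2 idx = i"
      using k(4)[of d] Suc.prems ne by (auto simp: Y1_def cnt_def[symmetric] idx_def[symmetric])
    define Y3 where "Y3 = Y2(2 := 1, idx := i + 1, cnt := m)"
    have reach2: "reach prog (p + 8 + length l, Y2, inp (sem c ?s1)) 4 (p + 3, Y3, inp (f i s'))"
    proof -
      have "reach prog (q, Y2, inp (sem c ?s1)) 4 (p + 3, Y3, inp (f i s'))" if "q = p + 8 + length l" for q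
        using at(5)[folded that] Y2 by (auto simp: ne ne(2)[symmetric] ne(3)[symmetric] Y3_def f_def)
      then show ?thesis by blast
    qed
    have Y3: "rep Y3 (f i s')"
      using rep_temp k(3) by (auto simp: Y3_def f_def ne)
    have "simulates prog d (p + 3) (p + length l + 12) Y3 (f i s') (tick 3 (fold f [Suc i..<Suc i + m] (f i s')))"
      by (rule Suc.IH[OF Y3]) (simp_all add: Y3_def ne ne(1)[symmetric])
    moreover have "[i..<i + Suc m] = i # [Suc i..<Suc i + m]" by (subst upt_conv_Cons) auto
    then have "fold f [i..<i + Suc m] s' = fold f [Suc i..<Suc i + m] (f i s')" by (simp only: fold_simps)
    ultimately have rest: "simulates prog d (p + 3) (p + length l + 12) Y3 (f i s')
        (tick 3 (fold f [i..<i + Suc m] s'))" by simp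
    show ?case
    proof (rule simulates_steps[OF _ _ _ rest])
      show "reach prog (p + 3, Y, inp s') (3 + k + 4) (p + 3, Y3, inp (f i s'))"
        using reach_trans[OF reach_trans[OF reach1 k(1)] reach2] .
      show "clock (f i s') = clock s' + (3 + k + 4)" using k(2) by (simp add: f_def)
      show "Y3 (8 * e + 10) = Y (8 * e + 10) \<and> Y3 (8 * e + 14) = Y (8 * e + 14)" if "e < d" for e
        using k(4)[of e] ned[OF that] that by (auto simp: Y3_def Y1_def)
    qed
  qed
  have "simulates prog d (p + 3) (p + length l + 12) (X(cnt := vars s n, idx := 0)) (tick 3 s)
      (tick 3 (fold f [0..<vars s n] (tick 3 s)))"
    using loop[of "X(cnt := vars s n, idx := 0)" "tick 3 s" "vars s n" 0] For.prems(3) ne rep_temp by auto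
  then have "simulates prog d p (p + length l + 12) X s (tick 3 (fold f [0..<vars s n] (tick 3 s)))"
  proof (rule simulates_steps[where k = 3, rotated -1])
    show "reach prog (p, X, inp s) 3 (p + 3, X(cnt := vars s n, idx := 0), inp (tick 3 s))"
      using at(1) rep_var[OF For.prems(3)] by (auto simp: ne fun_eq_iff)
  qed (use ned in auto)
  then show ?case unfolding eq by (simp add: add.assoc f_def eval_nat_numeral)
qed

text \<open>From here on loops are opaque to the simplifier and are handled only through
  \<open>for_rule\<close> and the rules derived from it.\<close>

declare sem.simps(10) [simp del]

lemma ram_computes_within_compile:
  assumes "tags_ok c" "s = sem c \<lparr>vars = \<lambda>_. 0, heap = \<lambda>_ _. 0, inp = xs, clock = 0\<rparr>" "clock s \<le> T"
  shows "ram_computes_within (compile c 0 0) xs T (vars s 0)"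
proof -
  let ?s = "\<lparr>vars = \<lambda>_. 0, heap = \<lambda>_ _. 0, inp = xs, clock = 0\<rparr>"
  have "simulates (compile c 0 0) 0 0 (length (compile c 0 0)) (\<lambda>_. 0) ?s s"
    unfolding assms(2) using compile_correct[of c "compile c 0 0" 0 0 "\<lambda>_. 0" ?s] assms(1) code_at_self
    by (simp add: rep_def)
  then obtain X' where "reach (compile c 0 0) (0, \<lambda>_. 0, xs) (clock s) (length (compile c 0 0), X', inp s)" "rep X' s"
    by (auto simp: simulates_def)
  then show ?thesis using assms(3) rep_var[of X' s 0]
    unfolding ram_computes_within_def reach_def by auto
qed

section \<open>Context-free derivations as items over one word\<close>

text \<open>A big-step form of derivability that consumes a sentential form from the left. Without
  surrounding contexts, inductions follow right-hand sides symbol by symbol, as the table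
  does.\<close>

inductive yields :: "('n, 't) production set \<Rightarrow> ('n, 't) sym list \<Rightarrow> 't list \<Rightarrow> bool" for P where
  Nil: "yields P [] []"
| Tm: "yields P \<alpha> w \<Longrightarrow> yields P (Tm d # \<alpha>) (d # w)"
| NT: "(X, \<beta>) \<in> P \<Longrightarrow> yields P \<beta> u \<Longrightarrow> yields P \<alpha> v \<Longrightarrow> yields P (NT X # \<alpha>) (u @ v)"

inductive_cases yields_NilE: "yields P [] w"
inductive_cases yields_TmE: "yields P (Tm d # \<alpha>) w"
inductive_cases yields_NTE: "yields P (NT X # \<alpha>) w"

lemma yields_append: "yields P \<alpha> u \<Longrightarrow> yields P \<beta> v \<Longrightarrow> yields P (\<alpha> @ \<beta>) (u @ v)"
proof (induction rule: yields.induct)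
  case (NT X \<gamma> u' \<alpha> v')
  then show ?case using yields.NT[of X \<gamma> P u' "\<alpha> @ \<beta>" "v' @ v"] by simp
qed (auto intro: yields.intros)

lemma yields_appendD: "yields P (\<alpha> @ \<beta>) w \<Longrightarrow> \<exists>u v. w = u @ v \<and> yields P \<alpha> u \<and> yields P \<beta> v"
proof (induction \<alpha> arbitrary: w)
  case Nil
  then show ?case by (auto intro: yields.Nil)
next
  case (Cons s \<alpha>)
  show ?case
  proof (cases s)
    case (NT X)
    with Cons.prems obtain \<gamma> u v where *: "(X, \<gamma>) \<in> P" "yields P \<gamma> u" "yields P (\<alpha> @ \<beta>) v" "w = u @ v"
      by (auto elim: yields_NTE)
    from Cons.IH[OF *(3)] obtain v1 v2 where "v = v1 @ v2" "yields P \<alpha> v1" "yields P \<beta> v2" by blast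
    then show ?thesis using * NT by (intro exI[of _ "u @ v1"] exI[of _ v2]) (auto intro: yields.NT)
  next
    case (Tm d)
    with Cons.prems obtain v where *: "yields P (\<alpha> @ \<beta>) v" "w = d # v" by (auto elim: yields_TmE)
    from Cons.IH[OF *(1)] obtain v1 v2 where "v = v1 @ v2" "yields P \<alpha> v1" "yields P \<beta> v2" by blast
    then show ?thesis using * Tm by (intro exI[of _ "d # v1"] exI[of _ v2]) (auto intro: yields.Tm)
  qed
qed

lemma yields_map_Tm: "yields P (map Tm w) w"
  by (induction w) (auto intro: yields.intros)

text \<open>A derivation is traversed backwards from its terminal word: the part of the word that
  the right-hand side yields is reassigned to the nonterminal.\<close>

lemma yields_step: "cfg_step P \<alpha> \<beta> \<Longrightarrow> yields P \<beta> w \<Longrightarrow> yields P \<alpha> w"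
proof (induction rule: cfg_step.induct)
  case (1 X \<gamma> u v)
  from 1(2) obtain w1 w2 w3 where *: "w = w1 @ w2 @ w3" "yields P u w1" "yields P \<gamma> w2" "yields P v w3"
    by (metis yields_appendD)
  with 1(1) have "yields P ([NT X] @ v) (w2 @ w3)" by (auto intro: yields.NT)
  with * show ?case by (auto intro: yields_append)
qed

lemma cfg_step_context: "(cfg_step P)\<^sup>*\<^sup>* \<alpha> \<beta> \<Longrightarrow> (cfg_step P)\<^sup>*\<^sup>* (u @ \<alpha> @ v) (u @ \<beta> @ v)"
proof (induction rule: rtranclp_induct)
  case (step \<beta> \<gamma>)
  from step(2) have "cfg_step P (u @ \<beta> @ v) (u @ \<gamma> @ v)"
  proof cases
    case (1 X \<delta> u' v')
    then show ?thesis using cfg_step.intros[of X \<delta> P "u @ u'" "v' @ v"] by simp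
  qed
  with step show ?case by auto
qed simp

lemma yields_derives: "yields P \<alpha> w \<Longrightarrow> (cfg_step P)\<^sup>*\<^sup>* \<alpha> (map Tm w)"
proof (induction rule: yields.induct)
  case (Tm \<alpha> w d)
  then show ?case using cfg_step_context[of P \<alpha> "map Tm w" "[Tm d]" "[]"] by simp
next
  case (NT X \<beta> u \<alpha> v)
  have "cfg_step P (NT X # \<alpha>) (\<beta> @ \<alpha>)" using cfg_step.intros[of X \<beta> P "[]" \<alpha>] NT by simp
  also have "(cfg_step P)\<^sup>*\<^sup>* (\<beta> @ \<alpha>) (map Tm u @ \<alpha>)"
    using cfg_step_context[of P \<beta> "map Tm u" "[]" \<alpha>] NT by simp
  also have "(cfg_step P)\<^sup>*\<^sup>* (map Tm u @ \<alpha>) (map Tm u @ map Tm v)"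
    using cfg_step_context[of P \<alpha> "map Tm v" "map Tm u" "[]"] NT by simp
  finally show ?case by simp
qed simp

lemma cfg_lang_yields: "w \<in> cfg_lang P S \<longleftrightarrow> yields P [NT S] w"
proof
  assume "w \<in> cfg_lang P S"
  then have "(cfg_step P)\<^sup>*\<^sup>* [NT S] (map Tm w)" by (simp add: cfg_lang_def)
  then show "yields P [NT S] w"
    by (induction rule: converse_rtranclp_induct) (auto intro: yields_map_Tm yields_step)
qed (auto simp: cfg_lang_def dest: yields_derives)

lemma yields_terminals:
  assumes "\<And>X \<alpha> d. (X, \<alpha>) \<in> P \<Longrightarrow> Tm d \<in> set \<alpha> \<Longrightarrow> d \<in> D"
  shows "yields P \<alpha> w \<Longrightarrow> (\<And>d. Tm d \<in> set \<alpha> \<Longrightarrow> d \<in> D) \<Longrightarrow> set w \<subseteq> D"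
  by (induction rule: yields.induct) (auto dest: assms)

section \<open>Factors of a word, table items and their agreement with the grammar\<close>

definition seg :: "'a list \<Rightarrow> nat \<Rightarrow> nat \<Rightarrow> 'a list" where
  "seg c i j = take (j - i) (drop i c)"

lemma seg_append: "i \<le> k \<Longrightarrow> k \<le> j \<Longrightarrow> seg c i j = seg c i k @ seg c k j"
  unfolding seg_def using take_add[of "k - i" "j - k" "drop i c"] by simp

lemma seg_same [simp]: "seg c i i = []" by (simp add: seg_def)

lemma seg_Suc: "i < length c \<Longrightarrow> seg c i (Suc i) = [c ! i]"
  by (simp add: seg_def take_Suc_conv_app_nth)

lemma length_seg [simp]: "j \<le> length c \<Longrightarrow> length (seg c i j) = j - i"
  by (simp add: seg_def)

lemma seg_split:
  assumes "seg c i j = u @ v" "i \<le> j" "j \<le> length c"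
  obtains k where "i \<le> k" "k \<le> j" "seg c i k = u" "seg c k j = v"
proof -
  have "length (u @ v) = j - i" using assms by (metis length_seg)
  then have le: "i + length u \<le> j" using assms by simp
  have "seg c i (i + length u) @ seg c (i + length u) j = u @ v"
    using seg_append[of i "i + length u" j c] le assms by simp
  moreover have "length (seg c i (i + length u)) = length u" using le assms(3) by simp
  ultimately show ?thesis using that[of "i + length u"] le by (simp add: append_eq_append_conv)
qed

text \<open>Row 0 stands for the empty factor and may be paired with itself, so an empty right-hand
  side is a binary rule like any other and the grammar needs no normal form.\<close>

inductive item :: "(nat \<times> nat \<times> nat) set \<Rightarrow> nat list \<Rightarrow> nat \<Rightarrow> nat \<Rightarrow> nat \<Rightarrow> bool" for R c where
  eps: "i \<le> length c \<Longrightarrow> item R c 0 i i"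
| chr: "i < length c \<Longrightarrow> item R c (Suc (c ! i)) i (Suc i)"
| bin: "(q, a, b) \<in> R \<Longrightarrow> item R c a i k \<Longrightarrow> item R c b k j \<Longrightarrow> item R c q i j"

lemma item_bounds: "item R c q i j \<Longrightarrow> i \<le> j \<and> j \<le> length c"
  by (induction rule: item.induct) auto

text \<open>Names of table rows: 0 for the empty word, \<open>1 + x\<close> for the class code \<open>x\<close> (with the separator
  counted as code 2), \<open>4 + 2 X\<close> for the nonterminal \<open>X\<close>, and \<open>5 + 2 r\<close> for the part of a right-hand side that
  remains after the first symbol of rule number \<open>r\<close>. A word in a right-hand side is expanded into its letters.\<close>

fun rhs_rules :: "nat \<Rightarrow> nat \<Rightarrow> nat list \<Rightarrow> (nat \<times> nat \<times> nat) list" where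
  "rhs_rules r q [] = [(q, 0, 0)]"
| "rhs_rules r q (t # ts) = (q, t, 5 + 2 * r) # rhs_rules (Suc r) (5 + 2 * r) ts"

lemma length_rhs_rules [simp]: "length (rhs_rules r q ts) = Suc (length ts)"
  by (induction r q ts rule: rhs_rules.induct) auto

fun sym_ids :: "(nat \<Rightarrow> nat) \<Rightarrow> (nat, word) sym \<Rightarrow> nat list" where
  "sym_ids cl (NT X) = [4 + 2 * X]"
| "sym_ids cl (Tm d) = map (\<lambda>a. Suc (cl a)) d"

abbreviation ids :: "(nat \<Rightarrow> nat) \<Rightarrow> (nat, word) sym list \<Rightarrow> nat list" where
  "ids cl \<alpha> \<equiv> concat (map (sym_ids cl) \<alpha>)"

text \<open>\<open>r\<close> counts the rules produced so far, including the closing rule of each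
  right-hand side; hence the suffix names \<open>5 + 2 * r\<close> of different productions never
  collide.\<close>

fun grammar_rules :: "(nat \<Rightarrow> nat) \<Rightarrow> nat \<Rightarrow> (nat, word) production list \<Rightarrow> (nat \<times> nat \<times> nat) list" where
  "grammar_rules cl r [] = []"
| "grammar_rules cl r ((X, \<alpha>) # ps) =
     rhs_rules r (4 + 2 * X) (ids cl \<alpha>) @ grammar_rules cl (r + Suc (length (ids cl \<alpha>))) ps"

lemma rhs_rules_subset:
  "(X, \<alpha>) \<in> set ps \<Longrightarrow> \<exists>r'. set (rhs_rules r' (4 + 2 * X) (ids cl \<alpha>)) \<subseteq> set (grammar_rules cl r ps)"
proof (induction cl r ps rule: grammar_rules.induct)
  case (2 cl r Y \<beta> ps)
  show ?case
  proof (cases "(X, \<alpha>) = (Y, \<beta>)")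
    case True
    then show ?thesis by auto
  next
    case False
    with 2 show ?thesis by fastforce
  qed
qed simp

text \<open>A word inside a right-hand side is matched letter by letter: each letter is a
  \<open>chr\<close> item, and the chain of rules goes on behind it.\<close>

lemma item_chars:
  assumes "seg c i k = u" "i \<le> k" "k \<le> length c" "set (rhs_rules r q (map Suc u @ ts)) \<subseteq> R"
    "\<And>r' q'. set (rhs_rules r' q' ts) \<subseteq> R \<Longrightarrow> item R c q' k j"
  shows "item R c q i j"
  using assms
proof (induction u arbitrary: i r q)
  case Nil
  then have "i = k" by (metis diff_is_0_eq' length_0_conv length_seg le_antisym diff_diff_cancel diff_zero)
  with Nil show ?case by auto
next
  case (Cons x u)
  have lt: "i < k" using Cons.prems(1) Cons.prems(2) by (cases "i = k") auto
  have "seg c i (Suc i) @ seg c (Suc i) k = [x] @ u"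
    using seg_append[of i "Suc i" k c] lt Cons.prems(1) by simp
  then have x: "c ! i = x" "seg c (Suc i) k = u"
    using seg_Suc[of i c] lt Cons.prems(3) by auto
  have "item R c (5 + 2 * r) (Suc i) j"
    using Cons.prems lt x by (intro Cons.IH[of "Suc i" "Suc r"]) auto
  moreover have "item R c (Suc x) i (Suc i)" using item.chr[of i c R] lt Cons.prems x by auto
  ultimately show ?case using Cons.prems(4) by (auto intro: item.bin)
qed

abbreviation spell :: "(nat \<Rightarrow> nat) \<Rightarrow> word list \<Rightarrow> nat list" where
  "spell cl w \<equiv> map cl (concat w)"

text \<open>The continuation \<open>ts\<close> is needed because the rules for a right-hand side are chained: they speak
  about its suffixes only.\<close>

lemma item_complete:
  assumes "yields (set ps) \<alpha> w" "seg c i k = spell cl w" "i \<le> k" "k \<le> length c"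
    "set (rhs_rules r q (ids cl \<alpha> @ ts)) \<subseteq> set (grammar_rules cl 0 ps)"
    "\<And>r' q'. set (rhs_rules r' q' ts) \<subseteq> set (grammar_rules cl 0 ps) \<Longrightarrow> item (set (grammar_rules cl 0 ps)) c q' k j"
  shows "item (set (grammar_rules cl 0 ps)) c q i j"
  using assms
proof (induction arbitrary: i k j r q ts rule: yields.induct)
  case Nil
  then have "i = k" by (metis concat.simps(1) diff_is_0_eq le_antisym length_0_conv length_seg list.simps(8))
  with Nil show ?case by auto
next
  case (Tm \<alpha> w d)
  from Tm.prems(1) have "seg c i k = map cl d @ spell cl w" by simp
  then obtain m where m: "i \<le> m" "m \<le> k" "seg c i m = map cl d" "seg c m k = spell cl w"
    using Tm.prems seg_split by metis
  have *: "set (rhs_rules r q (map Suc (map cl d) @ ids cl \<alpha> @ ts)) \<subseteq> set (grammar_rules cl 0 ps)"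
    using Tm.prems(4) by (simp add: comp_def)
  show ?case
  proof (rule item_chars[OF m(3) m(1) _ *])
    fix r' q'
    assume "set (rhs_rules r' q' (ids cl \<alpha> @ ts)) \<subseteq> set (grammar_rules cl 0 ps)"
    then show "item (set (grammar_rules cl 0 ps)) c q' m j"
      using Tm.IH[OF m(4) m(2) Tm.prems(3), of r' q' ts] Tm.prems(5) by blast
  qed (use m Tm.prems in auto)
next
  case (NT X \<beta> u \<alpha> v)
  from NT.prems(1) have "seg c i k = spell cl u @ spell cl v" by simp
  then obtain m where m: "i \<le> m" "m \<le> k" "seg c i m = spell cl u" "seg c m k = spell cl v"
    using NT.prems seg_split by metis
  \<comment> \<open>The production applied here has a chain of its own. Its continuation is empty
    and ends in a rule \<open>(q', 0, 0)\<close>, which derives the empty factor at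
    \<open>m\<close>.\<close>
  obtain r0 where r0: "set (rhs_rules r0 (4 + 2 * X) (ids cl \<beta> @ [])) \<subseteq> set (grammar_rules cl 0 ps)"
    using rhs_rules_subset[OF NT.hyps(1), where cl = cl and r = 0] by auto
  have "item (set (grammar_rules cl 0 ps)) c (4 + 2 * X) i m"
  proof (rule NT.IH(1)[OF m(3) m(1) _ r0])
    show "item (set (grammar_rules cl 0 ps)) c q' m m" if "set (rhs_rules r' q' []) \<subseteq> set (grammar_rules cl 0 ps)" for r' q'
      using that m NT.prems(3) by (auto intro!: item.bin[of q' 0 0] item.eps)
  qed (use m NT.prems in auto)
  moreover have "item (set (grammar_rules cl 0 ps)) c (5 + 2 * r) m j"
    using NT.IH(2)[OF m(4) m(2) NT.prems(3), of "Suc r" "5 + 2 * r" ts] NT.prems(4,5) by auto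
  ultimately show ?case using NT.prems(4) by (auto intro: item.bin)
qed

text \<open>The language that a row name is meant to denote. Soundness is then closure of these
  languages under each rule, with no need to rebuild derivations from items.\<close>

definition tok_lang :: "(nat \<Rightarrow> nat) \<Rightarrow> (nat, word) production set \<Rightarrow> nat \<Rightarrow> nat list set" where
  "tok_lang cl P t = (if t = 0 then {[]} else if t < 4 then {[t - 1]}
     else {spell cl w | w. yields P [NT ((t - 4) div 2)] w})"

fun toks_lang :: "(nat \<Rightarrow> nat) \<Rightarrow> (nat, word) production set \<Rightarrow> nat list \<Rightarrow> nat list set" where
  "toks_lang cl P [] = {[]}"
| "toks_lang cl P (t # ts) = {u @ v | u v. u \<in> tok_lang cl P t \<and> v \<in> toks_lang cl P ts}"

lemma toks_lang_chars:
  assumes "\<And>a. cl a < 2"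
  shows "toks_lang cl P (map (\<lambda>a. Suc (cl a)) d @ ts) = {map cl d @ v | v. v \<in> toks_lang cl P ts}"
proof (induction d)
  case (Cons a d)
  have "tok_lang cl P (Suc (cl a)) = {[cl a]}" using assms[of a] by (simp add: tok_lang_def)
  with Cons show ?case by auto
qed auto

lemma toks_lang_ids:
  assumes "\<And>a. cl a < 2"
  shows "toks_lang cl P (ids cl \<alpha>) = {spell cl w | w. yields P \<alpha> w}"
proof (induction \<alpha>)
  case Nil
  have "yields P [] w \<longleftrightarrow> w = []" for w by (auto elim: yields_NilE intro: yields.Nil)
  then show ?case by simp
next
  case (Cons s \<alpha>)
  show ?case
  proof (cases s)
    case (NT X)
    have "u @ v \<in> {spell cl w | w. yields P (NT X # \<alpha>) w}"
      if "u \<in> tok_lang cl P (4 + 2 * X)" "v \<in> {spell cl w | w. yields P \<alpha> w}" for u v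
    proof -
      from that(1) obtain w1 where w1: "u = spell cl w1" "yields P [NT X] w1" by (auto simp: tok_lang_def)
      from that(2) obtain w2 where w2: "v = spell cl w2" "yields P \<alpha> w2" by auto
      show ?thesis using w1 w2 yields_append[OF w1(2) w2(2)] by (auto intro!: exI[of _ "w1 @ w2"])
    qed
    moreover have "\<exists>u v. spell cl w = u @ v \<and> u \<in> tok_lang cl P (4 + 2 * X) \<and> v \<in> {spell cl w | w. yields P \<alpha> w}"
      if w: "yields P (NT X # \<alpha>) w" for w
    proof -
      from w yields_appendD[of P "[NT X]" \<alpha> w] obtain w1 w2
        where "w = w1 @ w2" "yields P [NT X] w1" "yields P \<alpha> w2" by auto
      then show ?thesis by (intro exI[of _ "spell cl w1"] exI[of _ "spell cl w2"]) (auto simp: tok_lang_def)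
    qed
    ultimately show ?thesis using NT Cons by (auto; blast)
  next
    case (Tm d)
    have "{w. yields P (Tm d # \<alpha>) w} = (#) d ` {v. yields P \<alpha> v}"
      by (auto elim: yields_TmE intro: yields.Tm)
    then have "spell cl ` {w. yields P (Tm d # \<alpha>) w} = (@) (map cl d) ` spell cl ` {v. yields P \<alpha> v}"
      by (simp add: image_image)
    then show ?thesis
      unfolding Tm using Cons toks_lang_chars[of cl P d "ids cl \<alpha>"] assms
      by (simp add: setcompr_eq_image)
  qed
qed

text \<open>The lists \<open>suffs ts\<close> run parallel to the rules \<open>rhs_rules r q ts\<close>, so that their concatenation tells
  which suffix a row name \<open>5 + 2 r\<close> stands for.\<close>

fun suffs :: "nat list \<Rightarrow> nat list list" where
  "suffs [] = [[]]"
| "suffs (t # ts) = ts # suffs ts"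

lemma length_suffs [simp]: "length (suffs ts) = Suc (length ts)"
  by (induction ts) auto

text \<open>The odd names from 5 on are the suffix rows; \<open>(q - 5) div 2\<close> recovers the
  rule number, which is also the position in \<open>sfs\<close>.\<close>

definition id_lang :: "(nat \<Rightarrow> nat) \<Rightarrow> (nat, word) production set \<Rightarrow> nat list list \<Rightarrow> nat \<Rightarrow> nat list set" where
  "id_lang cl P sfs q =
     (if q < 4 \<or> even q then tok_lang cl P q else toks_lang cl P (sfs ! ((q - 5) div 2)))"

text \<open>Since \<open>pre\<close> has length \<open>r\<close>, entry \<open>r\<close> of
  \<open>sfs\<close> is the suffix behind the first symbol, so the fresh name denotes the right
  language. The condition on the members of \<open>ts\<close> keeps symbols from being mistaken for
  suffix rows.\<close>

lemma rhs_rules_sound: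
  assumes "sfs = pre @ suffs ts @ post" "length pre = r" "toks_lang cl P ts \<subseteq> id_lang cl P sfs q"
    "\<And>t. t \<in> set ts \<Longrightarrow> t < 4 \<or> even t" "(q', a, b) \<in> set (rhs_rules r q ts)"
    "u \<in> id_lang cl P sfs a" "v \<in> id_lang cl P sfs b"
  shows "u @ v \<in> id_lang cl P sfs q'"
  using assms
proof (induction ts arbitrary: pre r q)
  case Nil
  then show ?case by (auto simp: id_lang_def tok_lang_def)
next
  case (Cons t ts)
  have nth: "sfs ! r = ts" using Cons.prems(1,2) by (simp add: nth_append)
  have fresh: "id_lang cl P sfs (5 + 2 * r) = toks_lang cl P ts"
    using nth by (auto simp: id_lang_def)
  show ?case
  proof (cases "(q', a, b) = (q, t, 5 + 2 * r)")
    case True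
    have "id_lang cl P sfs t = tok_lang cl P t" using Cons.prems(4)[of t] by (auto simp: id_lang_def)
    with True fresh Cons.prems show ?thesis by auto
  next
    case False
    show ?thesis
    proof (rule Cons.IH[of "pre @ [ts]" "Suc r" "5 + 2 * r"])
      show "toks_lang cl P ts \<subseteq> id_lang cl P sfs (5 + 2 * r)" using fresh by simp
    qed (use False Cons.prems in auto)
  qed
qed

lemma ids_small:
  assumes "\<And>a. cl a < 2" "t \<in> set (ids cl \<alpha>)"
  shows "t < 4 \<or> even t"
proof -
  have cl: "cl a < 3" for a using assms(1)[of a] by linarith
  have "t < 4 \<or> even t" if "t \<in> set (sym_ids cl s)" for s
    using that cl by (cases s) auto
  then show ?thesis using assms(2) by auto
qed

text \<open>\<open>P\<close> remains the full set of productions while the induction shrinks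
  \<open>ps\<close>; \<open>pre\<close> collects the suffixes of the productions already
  passed.\<close>

lemma grammar_rules_sound:
  assumes cl: "\<And>a. cl a < 2"
    and "sfs = pre @ concat (map (\<lambda>(X, \<alpha>). suffs (ids cl \<alpha>)) ps)" "length pre = r" "set ps \<subseteq> P"
    and "(q', a, b) \<in> set (grammar_rules cl r ps)" "u \<in> id_lang cl P sfs a" "v \<in> id_lang cl P sfs b"
  shows "u @ v \<in> id_lang cl P sfs q'"
  using assms
proof (induction cl r ps arbitrary: pre rule: grammar_rules.induct)
  case (2 cl' r X \<alpha> ps)
  show ?case
  proof (cases "(q', a, b) \<in> set (rhs_rules r (4 + 2 * X) (ids cl' \<alpha>))")
    case True
    have "toks_lang cl' P (ids cl' \<alpha>) \<subseteq> id_lang cl' P sfs (4 + 2 * X)"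
    proof
      fix x assume "x \<in> toks_lang cl' P (ids cl' \<alpha>)"
      then obtain w where "x = spell cl' w" "yields P \<alpha> w" using toks_lang_ids[OF 2(2)] by auto
      moreover have "yields P [NT X] w" if "yields P \<alpha> w"
        using yields.NT[of X \<alpha> P w "[]" "[]"] that 2(5) yields.Nil by auto
      ultimately show "x \<in> id_lang cl' P sfs (4 + 2 * X)" by (auto simp: id_lang_def tok_lang_def)
    qed
    with True 2 ids_small[OF 2(2)] show ?thesis
      by (intro rhs_rules_sound[of sfs pre "ids cl' \<alpha>" _ r cl' P "4 + 2 * X" q' a b u v]) auto
  next
    case False
    with 2(2-) show ?thesis
      by (intro 2(1)[of "pre @ suffs (ids cl' \<alpha>)"]) auto
  qed
qed simp

lemma item_sound:
  assumes cl: "\<And>a. cl a < 2" and c: "\<And>x. x \<in> set c \<Longrightarrow> x < 3"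
    and sfs: "sfs = concat (map (\<lambda>(X, \<alpha>). suffs (ids cl \<alpha>)) ps)"
  shows "item (set (grammar_rules cl 0 ps)) c q i j \<Longrightarrow>
    i \<le> j \<and> j \<le> length c \<and> seg c i j \<in> id_lang cl (set ps) sfs q"
proof (induction rule: item.induct)
  case (eps i)
  then show ?case by (simp add: id_lang_def tok_lang_def)
next
  case (chr i)
  \<comment> \<open>Codes 0, 1 and 2 have the row names 1, 2 and 3, the range in which
    \<open>tok_lang\<close> is a single code.\<close>
  then have "c ! i < 3" using c by simp
  with chr show ?case by (simp add: id_lang_def tok_lang_def seg_Suc)
next
  case (bin q a b i k j)
  then have "seg c i k @ seg c k j \<in> id_lang cl (set ps) sfs q"
    using grammar_rules_sound[where cl = cl and sfs = sfs and pre = "[]" and ps = ps and r = 0 and P = "set ps"] cl sfs by auto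
  with bin show ?case using seg_append[of i k j c] by auto
qed

theorem item_iff:
  assumes cl: "\<And>a. cl a < 2" and c: "\<And>x. x \<in> set c \<Longrightarrow> x < 3" and "i \<le> j" "j \<le> length c"
  shows "item (set (grammar_rules cl 0 ps)) c (4 + 2 * X) i j \<longleftrightarrow>
    (\<exists>w \<in> cfg_lang (set ps) X. spell cl w = seg c i j)"
proof
  assume "item (set (grammar_rules cl 0 ps)) c (4 + 2 * X) i j"
  from item_sound[OF cl c refl this] show "\<exists>w \<in> cfg_lang (set ps) X. spell cl w = seg c i j"
    by (auto simp: id_lang_def tok_lang_def cfg_lang_yields)
next
  assume "\<exists>w \<in> cfg_lang (set ps) X. spell cl w = seg c i j"
  then obtain w where w: "yields (set ps) [NT X] w" "spell cl w = seg c i j"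
    by (auto simp: cfg_lang_yields)
  from w(1) obtain \<alpha> u where u: "(X, \<alpha>) \<in> set ps" "yields (set ps) \<alpha> u" "w = u"
    by (auto elim!: yields_NTE yields_NilE)
  obtain r where "set (rhs_rules r (4 + 2 * X) (ids cl \<alpha> @ [])) \<subseteq> set (grammar_rules cl 0 ps)"
    using rhs_rules_subset[OF u(1), where cl = cl and r = 0] by auto
  note r = this
  have "seg c i j = spell cl u" using u w by simp
  then show "item (set (grammar_rules cl 0 ps)) c (4 + 2 * X) i j"
  proof (rule item_complete[OF u(2) _ _ _ r])
    show "item (set (grammar_rules cl 0 ps)) c q' j j" if "set (rhs_rules r' q' []) \<subseteq> set (grammar_rules cl 0 ps)" for r' q'
      using that assms by (auto intro!: item.bin[of q' 0 0] item.eps)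
  qed (use assms in auto)
qed

section \<open>Block languages as sequences of class codes\<close>

fun other :: "letter_class \<Rightarrow> letter_class" where
  "other ClassA = ClassB"
| "other ClassB = ClassA"

fun code :: "letter_class \<Rightarrow> nat" where
  "code ClassA = 0"
| "code ClassB = 1"

fun position_codes :: "nat \<Rightarrow> nat list \<Rightarrow> nat list" where
  "position_codes b [] = []"
| "position_codes b (k # ks) = replicate k b @ position_codes (1 - b) ks"

lemma code_less_2: "code x < 2" by (cases x) auto

lemma code_other: "code (other x) = 1 - code x" by (cases x) auto

text \<open>The starting class \<open>x\<close> is arbitrary because the induction passes to a tail
  that starts with the other class.\<close>

lemma block_lang_iff:
  "(\<exists>t. map snd t = ks \<and> (\<forall>(C, k) \<in> set t. set_mset C \<subseteq> \<Sigma> \<and> size C = k) \<and>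
      (\<forall>i < length t. set_mset (fst (t ! i)) \<subseteq> class_of \<Sigma> \<Pi> (if even i then x else other x)) \<and>
      s \<in> block_lang t) \<longleftrightarrow>
   set s \<subseteq> \<Sigma> \<and> map (\<lambda>a. code (\<Pi> a)) s = position_codes (code x) ks"
proof (induction ks arbitrary: s x)
  case (Cons k ks)
  have other2: "other (other x) = x" by (cases x) auto
  have inj: "code y = code z \<longleftrightarrow> y = z" for y z by (cases y; cases z) auto
  show ?case (is "?L \<longleftrightarrow> ?R")
  proof
    assume ?L
    then obtain t where t: "map snd t = k # ks" "\<forall>(C, k) \<in> set t. set_mset C \<subseteq> \<Sigma> \<and> size C = k"
      "\<forall>i < length t. set_mset (fst (t ! i)) \<subseteq> class_of \<Sigma> \<Pi> (if even i then x else other x)"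
      "s \<in> block_lang t" by (elim exE conjE) (rule that)
    then obtain C t' where [simp]: "t = (C, k) # t'" by (cases t) auto
    from t(4) obtain u v where uv: "s = u @ v" "length u = k" "set u \<subseteq> set_mset C" "v \<in> block_lang t'"
      by auto
    have "set_mset C \<subseteq> class_of \<Sigma> \<Pi> x" using t(3)[rule_format, of 0] by simp
    then have u: "set u \<subseteq> class_of \<Sigma> \<Pi> x" using uv(3) by simp
    then have "map (\<lambda>a. code (\<Pi> a)) u = replicate k (code x)"
      using uv(2) by (intro nth_equalityI) (auto simp: class_of_def subset_iff)
    moreover have "set v \<subseteq> \<Sigma> \<and> map (\<lambda>a. code (\<Pi> a)) v = position_codes (code (other x)) ks"
    proof (rule Cons.IH[THEN iffD1], intro exI[of _ t'] conjI allI impI)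
      fix i assume "i < length t'"
      then show "set_mset (fst (t' ! i)) \<subseteq> class_of \<Sigma> \<Pi> (if even i then other x else other (other x))"
        using t(3)[rule_format, of "Suc i"] other2 by (simp split: if_splits)
    qed (use t uv in auto)
    ultimately show ?R using u uv by (auto simp: code_other class_of_def)
  next
    assume R: ?R
    define u v where "u = take k s" and "v = drop k s"
    have s: "s = u @ v" by (simp add: u_def v_def)
    have "length (map (\<lambda>a. code (\<Pi> a)) s) \<ge> k" using R by simp
    then have len: "length u = k" by (simp add: u_def)
    from R len have u: "map (\<lambda>a. code (\<Pi> a)) u = replicate k (code x)"
      and v: "map (\<lambda>a. code (\<Pi> a)) v = position_codes (code (other x)) ks"
      by (auto simp: s append_eq_append_conv code_other)
    have uc: "set u \<subseteq> class_of \<Sigma> \<Pi> x"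
    proof
      fix a assume a: "a \<in> set u"
      then have "code (\<Pi> a) \<in> set (map (\<lambda>a. code (\<Pi> a)) u)" by auto
      then have "\<Pi> a = x" unfolding u using inj by (auto split: if_splits)
      then show "a \<in> class_of \<Sigma> \<Pi> x" using a R s by (auto simp: class_of_def)
    qed
    from v R s Cons.IH[of "other x" v] obtain t' where t': "map snd t' = ks"
      "\<forall>(C, k) \<in> set t'. set_mset C \<subseteq> \<Sigma> \<and> size C = k"
      "\<forall>i < length t'. set_mset (fst (t' ! i)) \<subseteq> class_of \<Sigma> \<Pi> (if even i then other x else other (other x))"
      "v \<in> block_lang t'" by auto
    \<comment> \<open>The multiset for the first block is the block itself, so its size is
      \<open>k\<close> and all its letters are of class \<open>x\<close>.\<close>
    show ?L
    proof (intro exI[of _ "(mset u, k) # t'"] conjI allI impI)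
      fix i assume "i < length ((mset u, k) # t')"
      then show "set_mset (fst (((mset u, k) # t') ! i)) \<subseteq> class_of \<Sigma> \<Pi> (if even i then x else other x)"
        using uc t'(3)[rule_format, of "i - 1"] other2 by (cases i) (simp_all split: if_splits)
    qed (use t' len uc s in \<open>auto simp: class_of_def\<close>)
  qed
qed auto

lemma alternating_block_iff:
  "(\<exists>t. alternating \<Sigma> \<Pi> ks t \<and> s \<in> block_lang t) \<longleftrightarrow>
   set s \<subseteq> \<Sigma> \<and> (\<exists>b<2. map (\<lambda>a. code (\<Pi> a)) s = position_codes b ks)"
proof -
  \<comment> \<open>\<open>alternating\<close> numbers blocks from 1 and lists are indexed from 0,
    so odd block numbers turn into even indices.\<close>
  have shift: "(\<forall>i \<in> {1..n}. Q (i - 1) (odd i)) \<longleftrightarrow> (\<forall>i<n. Q i (even i))" for n and Q :: "nat \<Rightarrow> bool \<Rightarrow> bool"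
  proof -
    have "{1..n} = Suc ` {..<n}" by (simp add: image_Suc_lessThan)
    then show ?thesis by auto
  qed
  let ?A = "\<lambda>t x. map snd t = ks \<and> (\<forall>(C, k) \<in> set t. set_mset C \<subseteq> \<Sigma> \<and> size C = k) \<and>
      (\<forall>i < length t. set_mset (fst (t ! i)) \<subseteq> class_of \<Sigma> \<Pi> (if even i then x else other x))"
  have alt: "alternating \<Sigma> \<Pi> ks t \<longleftrightarrow> ?A t ClassA \<or> ?A t ClassB" for t
  proof -
    have "alternating \<Sigma> \<Pi> ks t \<longleftrightarrow> map snd t = ks \<and>
      (\<forall>(C, k) \<in> set t. set_mset C \<subseteq> \<Sigma> \<and> size C = k) \<and>
      ((\<forall>i < length t. set_mset (fst (t ! i)) \<subseteq> class_of \<Sigma> \<Pi> (if even i then ClassA else ClassB)) \<or>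
       (\<forall>i < length t. set_mset (fst (t ! i)) \<subseteq> class_of \<Sigma> \<Pi> (if even i then ClassB else ClassA)))"
      unfolding alternating_def
      using shift[of "length t" "\<lambda>i e. set_mset (fst (t ! i)) \<subseteq> class_of \<Sigma> \<Pi> (if e then ClassA else ClassB)"]
        shift[of "length t" "\<lambda>i e. set_mset (fst (t ! i)) \<subseteq> class_of \<Sigma> \<Pi> (if e then ClassB else ClassA)"]
      by simp
    then show ?thesis by (simp only: other.simps) (rule iffI; elim conjE disjE; simp)
  qed
  have ex_class: "(\<exists>x. E x) \<longleftrightarrow> E ClassA \<or> E ClassB" for E
    by (metis letter_class.exhaust)
  have "(\<exists>t. alternating \<Sigma> \<Pi> ks t \<and> s \<in> block_lang t) \<longleftrightarrow>
    (\<exists>t. ?A t ClassA \<and> s \<in> block_lang t) \<or> (\<exists>t. ?A t ClassB \<and> s \<in> block_lang t)"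
    unfolding alt by (simp only: conj_disj_distribR ex_disj_distrib)
  also have "\<dots> \<longleftrightarrow> (\<exists>x t. ?A t x \<and> s \<in> block_lang t)"
    by (rule ex_class[symmetric])
  also have "\<dots> \<longleftrightarrow> (\<exists>x. set s \<subseteq> \<Sigma> \<and> map (\<lambda>a. code (\<Pi> a)) s = position_codes (code x) ks)"
    unfolding conj_assoc block_lang_iff ..
  also have "\<dots> \<longleftrightarrow> set s \<subseteq> \<Sigma> \<and> (\<exists>b<2. map (\<lambda>a. code (\<Pi> a)) s = position_codes b ks)"
  proof -
    have "(\<exists>b<2. Q b) \<longleftrightarrow> (\<exists>x. Q (code x))" for Q
      unfolding ex_class by (auto simp: less_2_cases_iff)
    then show ?thesis by auto
  qed
  finally show ?thesis .
qed

text \<open>The separator 2 is not the code of a class, so no nonterminal has an item that contains its position.\<close>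

definition two_way_codes :: "nat list \<Rightarrow> nat list" where
  "two_way_codes ks = position_codes 0 ks @ 2 # position_codes 1 ks"

text \<open>The input can be read only once, so the second half of the class word is computed as the
  complement of the first.\<close>

lemma position_codes_flip: "b < 2 \<Longrightarrow> map ((-) 1) (position_codes b ks) = position_codes (1 - b) ks"
proof (induction b ks rule: position_codes.induct)
  case (2 b k ks)
  then have "1 - b < 2" by simp
  with 2 show ?case by simp
qed simp

lemma length_position_codes [simp]: "length (position_codes b ks) = sum_list ks"
  by (induction b ks rule: position_codes.induct) auto

lemma position_codes_less: "b < 2 \<Longrightarrow> x \<in> set (position_codes b ks) \<Longrightarrow> x < 2"
  by (induction b ks rule: position_codes.induct) (auto split: if_splits)

text \<open>The default value 0 in \<open>cl\<close> keeps \<open>cl a\<close> below 2 for every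
  number \<open>a\<close>, and it is also the content of the class cells that the program never
  writes.\<close>

lemma rcs_solvable_iff_item:
  fixes I :: rcs_instance
  assumes "wf_rcs I" and cl: "cl = (\<lambda>a. if a < length (classes I) then code (classes I ! a) else 0)"
    and K: "K = sum_list (pattern I)" and R: "R = set (grammar_rules cl 0 (prods I))"
    and c: "c = two_way_codes (pattern I)"
  shows "rcs_solvable I \<longleftrightarrow>
    item R c (4 + 2 * start I) 0 K \<or> item R c (4 + 2 * start I) (Suc K) (Suc (2 * K))"
proof -
  let ?P = "set (prods I)"
  have cl2: "cl a < 2" for a using code_less_2 by (simp add: cl)
  have c3: "x < 3" if "x \<in> set c" for x
    using that position_codes_less[of 0 x "pattern I"] position_codes_less[of 1 x "pattern I"]
    by (auto simp: c two_way_codes_def)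
  \<comment> \<open>Right-hand sides contain dictionary words only, so every derived word sequence
    is automatically one over the dictionary.\<close>
  have D: "w \<in> lists (set (dict I))" if "w \<in> cfg_lang ?P (start I)" for w
    using that assms(1) yields_terminals[of ?P "set (dict I)" "[NT (start I)]" w]
    by (fastforce simp: cfg_lang_yields wf_rcs_def)
  have A: "set (concat w) \<subseteq> alphabet I" if "w \<in> lists (set (dict I))" for w
    using that assms(1) by (fastforce simp: wf_rcs_def)
  have spell: "map (\<lambda>a. code (partition_fun I a)) (concat w) = spell cl w" if "w \<in> lists (set (dict I))" for w
    using A[OF that] by (auto simp: cl partition_fun_def alphabet_def subset_iff)
  have "rcs_solvable I \<longleftrightarrow> (\<exists>w \<in> cfg_lang ?P (start I). w \<in> lists (set (dict I)) \<and>
    (\<exists>t. alternating (alphabet I) (partition_fun I) (pattern I) t \<and> concat w \<in> block_lang t))"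
    by (auto simp: rcs_solvable_def)
  also have "\<dots> \<longleftrightarrow> (\<exists>w \<in> cfg_lang ?P (start I). \<exists>b<2. spell cl w = position_codes b (pattern I))"
    unfolding alternating_block_iff using D A spell by (metis (no_types, lifting))
  also have "\<dots> \<longleftrightarrow> (\<exists>w \<in> cfg_lang ?P (start I). spell cl w = seg c 0 K)
      \<or> (\<exists>w \<in> cfg_lang ?P (start I). spell cl w = seg c (Suc K) (Suc (2 * K)))"
  proof -
    \<comment> \<open>The separator occupies position \<open>K\<close>, so the second half starts at
      \<open>Suc K\<close>.\<close>
    have "seg c 0 K = position_codes 0 (pattern I)" "seg c (Suc K) (Suc (2 * K)) = position_codes 1 (pattern I)"
      by (simp_all add: seg_def c two_way_codes_def K)
    then show ?thesis by (auto simp: less_2_cases_iff)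
  qed
  also have "\<dots> \<longleftrightarrow> item R c (4 + 2 * start I) 0 K \<or> item R c (4 + 2 * start I) (Suc K) (Suc (2 * K))"
  proof -
    have "length c = Suc (2 * K)" by (simp add: c two_way_codes_def K)
    then show ?thesis unfolding R by (subst (1 2) item_iff[OF cl2 c3]) auto
  qed
  finally show ?thesis .
qed

section \<open>Reading the instance\<close>

text \<open>The counterpart of \<open>for_rule\<close> for an encoded list: the invariant sees the
  elements already consumed and those still to come, and each run of the body must consume exactly
  one code \<open>f x\<close>.\<close>

lemma for_read:
  fixes s0 :: st
  assumes "vars s0 r = length xs" "length xs \<le> M" "inp s0 = concat (map f xs) @ rest"
    "P [] xs (vars s0) (heap s0)"
    and "\<And>ys x zs (s :: st) rest'. xs = ys @ x # zs \<Longrightarrow> P ys (x # zs) (vars s) (heap s) \<Longrightarrow>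
      inp s = f x @ rest' \<Longrightarrow>
      (\<And>w. w \<noteq> v \<Longrightarrow> w \<notin> mods c \<Longrightarrow> vars s w = vars s0 w) \<Longrightarrow>
      (\<And>t. t \<notin> puts c \<Longrightarrow> heap s t = heap s0 t) \<Longrightarrow>
      P (ys @ [x]) zs (vars (sem c (assign v (length ys) 3 s))) (heap (sem c (assign v (length ys) 3 s)))
      \<and> inp (sem c (assign v (length ys) 3 s)) = rest'
      \<and> clock (sem c (assign v (length ys) 3 s)) \<le> clock s + T"
  shows "P xs [] (vars (sem (For v r c) s0)) (heap (sem (For v r c) s0)) \<and> inp (sem (For v r c) s0) = rest
    \<and> clock (sem (For v r c) s0) \<le> clock s0 + M * (T + 4) + 6"
proof -
  let ?P = "\<lambda>i V H I. P (take i xs) (drop i xs) V H \<and> I = concat (map f (drop i xs)) @ rest"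
  let ?s = "sem (For v r c) s0"
  have "?P (length xs) (vars ?s) (heap ?s) (inp ?s) \<and> clock ?s \<le> clock s0 + M * (T + 4) + 6"
  proof (rule for_rule[where P = ?P])
    fix i and s :: st
    assume i: "i < length xs" and P: "?P i (vars s) (heap s) (inp s)"
      and frame: "\<And>w. w \<noteq> v \<Longrightarrow> w \<notin> mods c \<Longrightarrow> vars s w = vars s0 w"
        "\<And>t. t \<notin> puts c \<Longrightarrow> heap s t = heap s0 t"
    have d: "drop i xs = xs ! i # drop (Suc i) xs" using i by (rule Cons_nth_drop_Suc[symmetric])
    have t: "take (Suc i) xs = take i xs @ [xs ! i]" using i by (rule take_Suc_conv_app_nth)
    have "xs = take i xs @ xs ! i # drop (Suc i) xs" using i by (rule id_take_nth_drop)
    from assms(5)[OF this, of s "concat (map f (drop (Suc i) xs)) @ rest"] P frame i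
    show "?P (Suc i) (vars (sem c (assign v i 3 s))) (heap (sem c (assign v i 3 s)))
        (inp (sem c (assign v i 3 s))) \<and> clock (sem c (assign v i 3 s)) \<le> clock s + T"
      unfolding t d by simp
  qed (use assms in auto)
  then show ?thesis by simp
qed

text \<open>Variable 0 is compiled to register 0, where the machine delivers its answer. The
  arithmetic commands take variables only, so the constants 0, 1 and 2 get variables of their
  own.\<close>

abbreviation (input) "v_ans \<equiv> 0 :: nat"
abbreviation (input) "v_one \<equiv> 2 :: nat"
abbreviation (input) "v_two \<equiv> 3 :: nat"
abbreviation (input) "v_zero \<equiv> 4 :: nat"
abbreviation (input) "v_x \<equiv> 5 :: nat"
abbreviation (input) "v_y \<equiv> 6 :: nat"
abbreviation (input) "v_i \<equiv> 7 :: nat"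
abbreviation (input) "v_j \<equiv> 8 :: nat"
abbreviation (input) "v_k \<equiv> 9 :: nat"
abbreviation (input) "v_n \<equiv> 10 :: nat"
abbreviation (input) "v_m \<equiv> 11 :: nat"
abbreviation (input) "v_len \<equiv> 12 :: nat"
abbreviation (input) "v_pos \<equiv> 13 :: nat"
abbreviation (input) "v_K \<equiv> 14 :: nat"
abbreviation (input) "v_c \<equiv> 15 :: nat"
abbreviation (input) "v_W \<equiv> 16 :: nat"
abbreviation (input) "v_R \<equiv> 17 :: nat"
abbreviation (input) "v_fresh \<equiv> 18 :: nat"
abbreviation (input) "v_q \<equiv> 19 :: nat"
abbreviation (input) "v_t \<equiv> 20 :: nat"
abbreviation (input) "v_start \<equiv> 21 :: nat"
abbreviation (input) "v_a \<equiv> 22 :: nat"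
abbreviation (input) "v_b \<equiv> 23 :: nat"
abbreviation (input) "v_u \<equiv> 24 :: nat"
abbreviation (input) "v_sum \<equiv> 25 :: nat"
abbreviation (input) "v_tri \<equiv> 26 :: nat"
abbreviation (input) "v_l \<equiv> 27 :: nat"
abbreviation (input) "v_round \<equiv> 28 :: nat"
abbreviation (input) "v_rounds \<equiv> 29 :: nat"
abbreviation (input) "v_rule \<equiv> 30 :: nat"

abbreviation (input) "h_class \<equiv> 0 :: nat"
abbreviation (input) "h_code \<equiv> 1 :: nat"
abbreviation (input) "h_lhs \<equiv> 2 :: nat"
abbreviation (input) "h_fst \<equiv> 3 :: nat"
abbreviation (input) "h_snd \<equiv> 4 :: nat"
abbreviation (input) "h_tab \<equiv> 5 :: nat"

definition "arr h l \<longleftrightarrow> (\<forall>p < length l. h p = l ! p)"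

lemma arr_snoc: "arr h l \<Longrightarrow> arr (h(length l := x)) (l @ [x])"
  by (auto simp: arr_def nth_append less_Suc_eq)

lemma arr_nth: "arr h l \<Longrightarrow> p < length l \<Longrightarrow> h p = l ! p"
  by (simp add: arr_def)

definition "read_classes = Inp v_n ;; For v_i v_n (Inp v_x ;; Put h_class v_i v_x)"

lemma mods_read_classes [simp]: "mods read_classes = {v_n, v_i, v_x}" "puts read_classes = {h_class}"
  by (auto simp: read_classes_def)

lemma read_classes:
  assumes "inp s = enc_list enc_class xs @ rest" "length xs \<le> M" "\<And>a. heap s h_class a = 0"
  shows "(\<forall>a. heap (sem read_classes s) h_class a = (if a < length xs then code (xs ! a) else 0)) \<and>
    inp (sem read_classes s) = rest \<and> clock (sem read_classes s) \<le> clock s + M * 15 + 7"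
proof -
  let ?s = "sem (Inp v_n) s"
  have enc: "enc_class x = [code x]" for x by (cases x) auto
  have "(\<forall>a. heap (sem (For v_i v_n (Inp v_x ;; Put h_class v_i v_x)) ?s) h_class a
      = (if a < length xs then code (xs ! a) else 0))
    \<and> inp (sem (For v_i v_n (Inp v_x ;; Put h_class v_i v_x)) ?s) = rest
    \<and> clock (sem (For v_i v_n (Inp v_x ;; Put h_class v_i v_x)) ?s) \<le> clock ?s + M * (11 + 4) + 6"
    by (rule for_read[where P = "\<lambda>ys zs V H. \<forall>a. H h_class a = (if a < length ys then code (ys ! a) else 0)"
          and f = enc_class])
      (use assms in \<open>auto simp: enc_list_def enc nth_append less_Suc_eq\<close>)
  then show ?thesis by (simp add: read_classes_def)
qed

definition "fill_block = For v_j v_k (Put h_code v_pos v_c ;; Plus v_pos v_pos v_one)"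

lemma mods_fill_block [simp]: "mods fill_block = {v_j, v_pos}" "puts fill_block = {h_code}" "\<not> reads fill_block"
  by (auto simp: fill_block_def)

lemma fill_block:
  assumes "arr (heap s h_code) l" "vars s v_pos = length l" "vars s v_one = 1" "vars s v_k \<le> M"
  shows "arr (heap (sem fill_block s) h_code) (l @ replicate (vars s v_k) (vars s v_c))
    \<and> vars (sem fill_block s) v_pos = length l + vars s v_k
    \<and> clock (sem fill_block s) \<le> clock s + M * 15 + 6"
proof -
  let ?P = "\<lambda>i V H I. arr (H h_code) (l @ replicate i (vars s v_c)) \<and> V v_pos = length l + i"
  have "?P (vars s v_k) (vars (sem fill_block s)) (heap (sem fill_block s)) (inp (sem fill_block s))
    \<and> clock (sem fill_block s) \<le> clock s + M * (11 + 4) + 6"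
    unfolding fill_block_def
  proof (rule for_rule[where P = ?P])
    fix i and s' :: st
    assume i: "?P i (vars s') (heap s') (inp s')"
      and frame: "\<And>w. w \<noteq> v_j \<Longrightarrow> w \<notin> mods (Put h_code v_pos v_c ;; Plus v_pos v_pos v_one) \<Longrightarrow> vars s' w = vars s w"
    have "vars s' v_one = 1" "vars s' v_c = vars s v_c" using frame assms(3) by auto
    then show "?P (Suc i) (vars (sem (Put h_code v_pos v_c ;; Plus v_pos v_pos v_one) (assign v_j i 3 s')))
        (heap (sem (Put h_code v_pos v_c ;; Plus v_pos v_pos v_one) (assign v_j i 3 s')))
        (inp (sem (Put h_code v_pos v_c ;; Plus v_pos v_pos v_one) (assign v_j i 3 s')))
      \<and> clock (sem (Put h_code v_pos v_c ;; Plus v_pos v_pos v_one) (assign v_j i 3 s')) \<le> clock s' + 11"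
      using i arr_snoc[of "heap s' h_code" "l @ replicate i (vars s v_c)" "vars s v_c"]
      by (simp add: replicate_append_same)
  qed (use assms in auto)
  then show ?thesis by simp
qed

definition "read_pattern =
  Set v_pos 0 ;; Set v_c 0 ;; Inp v_m ;; For v_i v_m (Inp v_k ;; fill_block ;; Minus v_c v_one v_c)"

lemma mods_read_pattern [simp]:
  "mods read_pattern = {v_pos, v_c, v_m, v_i, v_k, v_j}" "puts read_pattern = {h_code}"
  by (auto simp: read_pattern_def)

lemma read_pattern:
  assumes "inp s = enc_list enc_nat ks @ rest" "length ks \<le> M" "sum_list ks \<le> M" "vars s v_one = 1"
  shows "arr (heap (sem read_pattern s) h_code) (position_codes 0 ks)
    \<and> vars (sem read_pattern s) v_pos = sum_list ks
    \<and> inp (sem read_pattern s) = rest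
    \<and> clock (sem read_pattern s) \<le> clock s + M * (M * 15 + 15) + 9"
proof -
  let ?c = "Inp v_k ;; fill_block ;; Minus v_c v_one v_c"
  let ?s = "sem (Set v_pos 0 ;; Set v_c 0 ;; Inp v_m) s"
  \<comment> \<open>\<open>l\<close> is what has been written; the codes still owed for the unread
    entries, starting with the current class in \<open>v_c\<close>, complete it to the whole
    sequence.\<close>
  let ?P = "\<lambda>ys zs V H. \<exists>l. arr (H h_code) l \<and> V v_pos = length l \<and> position_codes 0 ks = l @ position_codes (V v_c) zs"
  have "?P ks [] (vars (sem (For v_i v_m ?c) ?s)) (heap (sem (For v_i v_m ?c) ?s))
    \<and> inp (sem (For v_i v_m ?c) ?s) = rest
    \<and> clock (sem (For v_i v_m ?c) ?s) \<le> clock ?s + M * ((M * 15 + 11) + 4) + 6"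
  proof (rule for_read[where P = ?P and f = enc_nat])
    fix ys x zs and s' :: st and rest'
    assume ks: "ks = ys @ x # zs" and P: "?P ys (x # zs) (vars s') (heap s')"
      and inp: "inp s' = enc_nat x @ rest'"
      and frame: "\<And>w. w \<noteq> v_i \<Longrightarrow> w \<notin> mods ?c \<Longrightarrow> vars s' w = vars ?s w"
    from P obtain l where l: "arr (heap s' h_code) l" "vars s' v_pos = length l"
      "position_codes 0 ks = l @ position_codes (vars s' v_c) (x # zs)" by blast
    let ?t = "sem (Inp v_k) (assign v_i (length ys) 3 s')"
    have k: "vars ?t v_k = x" "inp ?t = rest'" using inp by (simp_all add: enc_nat_def)
    have one: "vars s' v_one = 1" using frame[of v_one] assms(4) by simp
    have "x \<le> M" using assms(3) ks by simp
    then have "arr (heap (sem fill_block ?t) h_code) (l @ replicate x (vars s' v_c))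
      \<and> vars (sem fill_block ?t) v_pos = length l + x
      \<and> clock (sem fill_block ?t) \<le> clock ?t + M * 15 + 6"
      using fill_block[of ?t l M] l one k by simp
    then show "?P (ys @ [x]) zs (vars (sem ?c (assign v_i (length ys) 3 s'))) (heap (sem ?c (assign v_i (length ys) 3 s')))
      \<and> inp (sem ?c (assign v_i (length ys) 3 s')) = rest'
      \<and> clock (sem ?c (assign v_i (length ys) 3 s')) \<le> clock s' + (M * 15 + 11)"
      using l k one by (auto intro!: exI[of _ "l @ replicate x (vars s' v_c)"])
  qed (use assms in \<open>auto simp: enc_list_def arr_def\<close>)
  then have "arr (heap (sem read_pattern s) h_code) (position_codes 0 ks)
    \<and> vars (sem read_pattern s) v_pos = length (position_codes 0 ks)
    \<and> inp (sem read_pattern s) = rest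
    \<and> clock (sem read_pattern s) \<le> clock s + M * (M * 15 + 15) + 9"
    by (auto simp: read_pattern_def add.assoc)
  then show ?thesis by simp
qed

text \<open>\<open>v_W\<close> becomes one more than the length of the class word: the number of
  positions between its letters, both ends included.\<close>

definition "flip_pattern =
  Plus v_K v_pos v_zero ;; Put h_code v_pos v_two ;; Plus v_pos v_pos v_one ;;
  For v_j v_K (Get v_x h_code v_j ;; Minus v_x v_one v_x ;; Put h_code v_pos v_x ;; Plus v_pos v_pos v_one) ;;
  Plus v_W v_pos v_one"

lemma mods_flip_pattern [simp]:
  "mods flip_pattern = {v_K, v_pos, v_j, v_x, v_W}" "puts flip_pattern = {h_code}" "\<not> reads flip_pattern"
  by (auto simp: flip_pattern_def)

lemma flip_pattern:
  assumes "arr (heap s h_code) (position_codes 0 ks)" "vars s v_pos = sum_list ks" "sum_list ks \<le> M"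
    "vars s v_one = 1" "vars s v_two = 2" "vars s v_zero = 0"
  shows "arr (heap (sem flip_pattern s) h_code) (two_way_codes ks)
    \<and> vars (sem flip_pattern s) v_pos = Suc (2 * sum_list ks)
    \<and> vars (sem flip_pattern s) v_W = Suc (Suc (2 * sum_list ks))
    \<and> vars (sem flip_pattern s) v_K = sum_list ks
    \<and> clock (sem flip_pattern s) \<le> clock s + M * 23 + 16"
proof -
  let ?c = "Get v_x h_code v_j ;; Minus v_x v_one v_x ;; Put h_code v_pos v_x ;; Plus v_pos v_pos v_one"
  let ?s = "sem (Plus v_K v_pos v_zero ;; Put h_code v_pos v_two ;; Plus v_pos v_pos v_one) s"
  let ?l = "position_codes 0 ks" and ?K = "sum_list ks"
  let ?l' = "\<lambda>i. ?l @ 2 # map ((-) 1) (take i ?l)"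
  let ?P = "\<lambda>i V H I. arr (H h_code) (?l' i) \<and> V v_pos = Suc (?K + i)"
  have "?P ?K (vars (sem (For v_j v_K ?c) ?s)) (heap (sem (For v_j v_K ?c) ?s)) (inp (sem (For v_j v_K ?c) ?s))
    \<and> clock (sem (For v_j v_K ?c) ?s) \<le> clock ?s + M * (19 + 4) + 6"
  proof (rule for_rule[where P = ?P])
    fix i and s' :: st
    assume i: "i < ?K" and P: "?P i (vars s') (heap s') (inp s')"
      and frame: "\<And>w. w \<noteq> v_j \<Longrightarrow> w \<notin> mods ?c \<Longrightarrow> vars s' w = vars ?s w"
    have one: "vars s' v_one = 1" using frame[of v_one] assms(4) by simp
    have len: "length (?l' i) = Suc (?K + i)" using i by simp
    have x: "heap s' h_code i = ?l ! i" using arr_nth[of "heap s' h_code" "?l' i" i] P i by (simp add: nth_append)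
    have "?l' (Suc i) = ?l' i @ [1 - ?l ! i]" using i by (simp add: take_Suc_conv_app_nth)
    moreover have "arr ((heap s' h_code)(Suc (?K + i) := 1 - ?l ! i)) (?l' i @ [1 - ?l ! i])"
      using arr_snoc[of "heap s' h_code" "?l' i" "1 - ?l ! i"] P unfolding len by simp
    ultimately have "arr ((heap s' h_code)(Suc (?K + i) := 1 - ?l ! i)) (?l' (Suc i))" by (simp only:)
    then show "?P (Suc i) (vars (sem ?c (assign v_j i 3 s'))) (heap (sem ?c (assign v_j i 3 s')))
        (inp (sem ?c (assign v_j i 3 s'))) \<and> clock (sem ?c (assign v_j i 3 s')) \<le> clock s' + 19"
      using P one x by simp
  next
    show "?P 0 (vars ?s) (heap ?s) (inp ?s)" using assms arr_snoc[OF assms(1), of 2] by simp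
  qed (use assms in auto)
  moreover have "?l' ?K = two_way_codes ks"
    using position_codes_flip[of 0 ks] by (simp add: two_way_codes_def)
  ultimately have "arr (heap (sem (For v_j v_K ?c) ?s) h_code) (two_way_codes ks) \<and>
     vars (sem (For v_j v_K ?c) ?s) v_pos = Suc (2 * ?K) \<and>
     clock (sem (For v_j v_K ?c) ?s) \<le> clock ?s + M * (19 + 4) + 6"
    by simp
  then show ?thesis using assms(2,4,6) by (simp add: flip_pattern_def)
qed

text \<open>Right-hand sides spell out their words, so the dictionary is only passed over here; the
  last \<open>Inp\<close> consumes the number of nonterminals.\<close>

definition "skip_dict = Inp v_n ;; For v_i v_n (Inp v_len ;; For v_j v_len (Inp v_x)) ;; Inp v_x"

lemma mods_skip_dict [simp]: "mods skip_dict = {v_n, v_i, v_len, v_j, v_x}" "puts skip_dict = {}"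
  by (auto simp: skip_dict_def)

lemma skip_dict:
  assumes "inp s = enc_list (enc_list enc_nat) ds @ enc_nat n @ rest" "length ds \<le> M" "\<And>d. d \<in> set ds \<Longrightarrow> length d \<le> M"
  shows "inp (sem skip_dict s) = rest \<and> clock (sem skip_dict s) \<le> clock s + M * (M * 8 + 14) + 8"
proof -
  let ?c = "Inp v_len ;; For v_j v_len (Inp v_x)"
  let ?s = "sem (Inp v_n) s"
  have "True \<and> inp (sem (For v_i v_n ?c) ?s) = enc_nat n @ rest
    \<and> clock (sem (For v_i v_n ?c) ?s) \<le> clock ?s + M * ((M * 8 + 10) + 4) + 6"
  proof (rule for_read[where P = "\<lambda>_ _ _ _. True" and f = "enc_list enc_nat"])
    fix ys x zs and s' :: st and rest'
    assume ds: "ds = ys @ x # zs" and inp: "inp s' = enc_list enc_nat x @ rest'"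
    let ?t = "sem (Inp v_len) (assign v_i (length ys) 3 s')"
    have "True \<and> inp (sem (For v_j v_len (Inp v_x)) ?t) = rest'
      \<and> clock (sem (For v_j v_len (Inp v_x)) ?t) \<le> clock ?t + M * (4 + 4) + 6"
      by (rule for_read[where P = "\<lambda>_ _ _ _. True" and f = enc_nat and xs = x])
        (use ds inp assms(3)[of x] in \<open>auto simp: enc_list_def enc_nat_def\<close>)
    then show "True \<and> inp (sem ?c (assign v_i (length ys) 3 s')) = rest'
      \<and> clock (sem ?c (assign v_i (length ys) 3 s')) \<le> clock s' + (M * 8 + 10)"
      by simp
  qed (use assms in \<open>auto simp: enc_list_def\<close>)
  then show ?thesis by (simp add: skip_dict_def enc_nat_def algebra_simps)
qed

section \<open>Producing the rules while the productions are read\<close>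

definition "emit =
  Put h_lhs v_R v_q ;; Put h_fst v_R v_t ;; Put h_snd v_R v_fresh ;;
  Plus v_q v_fresh v_zero ;; Plus v_fresh v_fresh v_two ;; Plus v_R v_R v_one"

text \<open>The closing rule introduces no new row, but \<open>v_fresh\<close> advances all the
  same, to stay equal to \<open>5 + 2 * v_R\<close>.\<close>

definition "emit_end =
  Put h_lhs v_R v_q ;; Put h_fst v_R v_zero ;; Put h_snd v_R v_zero ;;
  Plus v_fresh v_fresh v_two ;; Plus v_R v_R v_one"

definition rules_rep :: "(nat \<times> nat \<times> nat) list \<Rightarrow> (nat \<Rightarrow> nat) \<Rightarrow> (nat \<Rightarrow> nat \<Rightarrow> nat) \<Rightarrow> bool" where
  "rules_rep rl V H \<longleftrightarrow> V v_R = length rl \<and> V v_fresh = 5 + 2 * length rl \<and>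
     arr (\<lambda>p. (H h_lhs p, H h_fst p, H h_snd p)) rl"

text \<open>\<open>rl0\<close> is the rule list as it will be once the current right-hand side is
  finished. With this target fixed in advance, right-hand sides are processed symbol by symbol
  without being stored: reading a symbol only shortens what is still due.\<close>

definition pending :: "(nat \<times> nat \<times> nat) list \<Rightarrow> nat list \<Rightarrow> (nat \<Rightarrow> nat) \<Rightarrow> (nat \<Rightarrow> nat \<Rightarrow> nat) \<Rightarrow> bool" where
  "pending rl0 ts V H \<longleftrightarrow>
     (\<exists>rl. rules_rep rl V H \<and> rl0 = rl @ rhs_rules (length rl) (V v_q) ts)"

lemma mods_emit [simp]:
  "mods emit = {v_q, v_fresh, v_R}" "puts emit = {h_lhs, h_fst, h_snd}" "\<not> reads emit"
  by (auto simp: emit_def)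

lemma mods_emit_end [simp]:
  "mods emit_end = {v_fresh, v_R}" "puts emit_end = {h_lhs, h_fst, h_snd}" "\<not> reads emit_end"
  by (auto simp: emit_end_def)

lemma clock_emit [simp]: "clock (sem emit s) = clock s + 24"
  by (simp add: emit_def)

lemma clock_emit_end [simp]: "clock (sem emit_end s) = clock s + 23"
  by (simp add: emit_end_def)

lemma rules_rep_snoc:
  assumes "rules_rep rl V H" "V' v_R = Suc (length rl)" "V' v_fresh = V v_fresh + 2"
    "H' h_lhs = (H h_lhs)(V v_R := q)" "H' h_fst = (H h_fst)(V v_R := a)" "H' h_snd = (H h_snd)(V v_R := b)"
  shows "rules_rep (rl @ [(q, a, b)]) V' H'"
  using assms by (auto simp: rules_rep_def arr_def nth_append less_Suc_eq)

lemma emit: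
  assumes "pending rl0 (t # ts) (vars s) (heap s)" "vars s v_t = t"
    "vars s v_one = 1" "vars s v_two = 2" "vars s v_zero = 0"
  shows "pending rl0 ts (vars (sem emit s)) (heap (sem emit s))"
proof -
  from assms(1) obtain rl where rl: "rules_rep rl (vars s) (heap s)"
    "rl0 = rl @ rhs_rules (length rl) (vars s v_q) (t # ts)" by (auto simp: pending_def)
  have "rules_rep (rl @ [(vars s v_q, t, vars s v_fresh)]) (vars (sem emit s)) (heap (sem emit s))"
    using rl assms by (intro rules_rep_snoc[OF rl(1)]) (auto simp: emit_def rules_rep_def)
  moreover have "vars (sem emit s) v_q = vars s v_fresh" using assms by (simp add: emit_def)
  ultimately show ?thesis using rl
    by (auto simp: pending_def rules_rep_def intro!: exI[of _ "rl @ [(vars s v_q, t, vars s v_fresh)]"])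
qed

lemma emit_end:
  assumes "pending rl0 [] (vars s) (heap s)" "vars s v_one = 1" "vars s v_two = 2" "vars s v_zero = 0"
  shows "rules_rep rl0 (vars (sem emit_end s)) (heap (sem emit_end s))"
proof -
  from assms(1) obtain rl where rl: "rules_rep rl (vars s) (heap s)" "rl0 = rl @ [(vars s v_q, 0, 0)]"
    by (auto simp: pending_def)
  show ?thesis unfolding rl(2)
    using rl assms by (intro rules_rep_snoc[OF rl(1)]) (auto simp: emit_end_def rules_rep_def)
qed

lemma pending_cong:
  assumes "pending rl0 ts V H" "V' v_R = V v_R" "V' v_fresh = V v_fresh" "V' v_q = V v_q"
    "H' h_lhs = H h_lhs" "H' h_fst = H h_fst" "H' h_snd = H h_snd"
  shows "pending rl0 ts V' H'"
  using assms by (simp add: pending_def rules_rep_def)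

lemma rules_rep_cong:
  assumes "rules_rep rl V H" "V' v_R = V v_R" "V' v_fresh = V v_fresh"
    "H' h_lhs = H h_lhs" "H' h_fst = H h_fst" "H' h_snd = H h_snd"
  shows "rules_rep rl V' H'"
  using assms by (simp add: rules_rep_def)

definition "read_word = Inp v_m ;; For v_k v_m (Inp v_x ;; Get v_x h_class v_x ;; Plus v_t v_x v_one ;; emit)"

lemma mods_read_word [simp]:
  "mods read_word = {v_m, v_k, v_x, v_t, v_q, v_fresh, v_R}" "puts read_word = {h_lhs, h_fst, h_snd}"
  by (auto simp: read_word_def)

lemma read_word:
  assumes "inp s = enc_list enc_nat d @ rest" "length d \<le> M"
    "pending rl0 (map (\<lambda>a. Suc (cl a)) d @ ts) (vars s) (heap s)" "\<And>a. heap s h_class a = cl a"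
    "vars s v_one = 1" "vars s v_two = 2" "vars s v_zero = 0"
  shows "pending rl0 ts (vars (sem read_word s)) (heap (sem read_word s)) \<and> inp (sem read_word s) = rest
    \<and> clock (sem read_word s) \<le> clock s + M * 40 + 7"
proof -
  let ?c = "Inp v_x ;; Get v_x h_class v_x ;; Plus v_t v_x v_one ;; emit"
  let ?s = "sem (Inp v_m) s"
  let ?P = "\<lambda>(ys :: nat list) zs V H. pending rl0 (map (\<lambda>a. Suc (cl a)) zs @ ts) V H"
  have "?P d [] (vars (sem (For v_k v_m ?c) ?s)) (heap (sem (For v_k v_m ?c) ?s))
    \<and> inp (sem (For v_k v_m ?c) ?s) = rest
    \<and> clock (sem (For v_k v_m ?c) ?s) \<le> clock ?s + M * (36 + 4) + 6"
  proof (rule for_read[where P = ?P and f = enc_nat])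
    fix ys x zs and s' :: st and rest'
    assume "d = ys @ x # zs" and P: "?P ys (x # zs) (vars s') (heap s')" and inp: "inp s' = enc_nat x @ rest'"
      and frame: "\<And>w. w \<noteq> v_k \<Longrightarrow> w \<notin> mods ?c \<Longrightarrow> vars s' w = vars ?s w"
        "\<And>t. t \<notin> puts ?c \<Longrightarrow> heap s' t = heap ?s t"
    let ?t = "sem (Inp v_x ;; Get v_x h_class v_x ;; Plus v_t v_x v_one) (assign v_k (length ys) 3 s')"
    have vals: "vars s' v_one = 1" "vars s' v_two = 2" "vars s' v_zero = 0" "heap s' h_class x = cl x"
      using frame assms by auto
    have "pending rl0 (map (\<lambda>a. Suc (cl a)) zs @ ts) (vars (sem emit ?t)) (heap (sem emit ?t))"
    proof (rule emit)
      show "pending rl0 (Suc (cl x) # map (\<lambda>a. Suc (cl a)) zs @ ts) (vars ?t) (heap ?t)"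
        by (rule pending_cong[of _ _ "vars s'" "heap s'"]) (use P in auto)
    qed (use vals inp in \<open>auto simp: enc_nat_def\<close>)
    then show "?P (ys @ [x]) zs (vars (sem ?c (assign v_k (length ys) 3 s'))) (heap (sem ?c (assign v_k (length ys) 3 s')))
      \<and> inp (sem ?c (assign v_k (length ys) 3 s')) = rest'
      \<and> clock (sem ?c (assign v_k (length ys) 3 s')) \<le> clock s' + 36"
      using inp by (simp add: enc_nat_def)
  next
    show "?P [] d (vars ?s) (heap ?s)"
      by (rule pending_cong[OF assms(3)]) auto
  qed (use assms in \<open>auto simp: enc_list_def\<close>)
  then show ?thesis by (simp add: read_word_def)
qed

definition "read_nonterminal v = Inp v ;; Plus v v v ;; Plus v v v_two ;; Plus v v v_two"

text \<open>The tag of a symbol is 1 for a word and 0 for a nonterminal, so it serves directly as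
  the condition.\<close>

definition "read_sym = Inp v_m ;; Cond v_m read_word (read_nonterminal v_t ;; emit)"

lemma mods_read_nonterminal [simp]: "mods (read_nonterminal v) = {v}" "puts (read_nonterminal v) = {}"
  by (auto simp: read_nonterminal_def)

lemma read_nonterminal:
  assumes "vars s v_two = 2" "inp s = X # rest" "v \<noteq> v_two"
  shows "vars (sem (read_nonterminal v) s) v = 4 + 2 * X \<and> inp (sem (read_nonterminal v) s) = rest
    \<and> clock (sem (read_nonterminal v) s) = clock s + 4"
  using assms by (simp add: read_nonterminal_def)

lemma mods_read_sym [simp]:
  "mods read_sym = {v_m, v_k, v_x, v_t, v_q, v_fresh, v_R}" "puts read_sym = {h_lhs, h_fst, h_snd}"
  by (auto simp: read_sym_def)

lemma read_sym:
  assumes "inp s = enc_sym x @ rest" "\<And>d. x = Tm d \<Longrightarrow> length d \<le> M"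
    "pending rl0 (sym_ids cl x @ ts) (vars s) (heap s)" "\<And>a. heap s h_class a = cl a"
    "vars s v_one = 1" "vars s v_two = 2" "vars s v_zero = 0"
  shows "pending rl0 ts (vars (sem read_sym s)) (heap (sem read_sym s)) \<and> inp (sem read_sym s) = rest
    \<and> clock (sem read_sym s) \<le> clock s + M * 40 + 32"
proof (cases x)
  case (NT X)
  let ?t = "sem (read_nonterminal v_t) (tick 1 (sem (Inp v_m) s))"
  have t: "vars ?t v_t = 4 + 2 * X \<and> inp ?t = rest \<and> clock ?t = clock (tick 1 (sem (Inp v_m) s)) + 4"
    by (rule read_nonterminal) (use assms NT in auto)
  have "pending rl0 ts (vars (sem emit ?t)) (heap (sem emit ?t))"
  proof (rule emit)
    show "pending rl0 ((4 + 2 * X) # ts) (vars ?t) (heap ?t)"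
      by (rule pending_cong[of _ _ "vars s" "heap s"]) (use assms NT in auto)
  qed (use assms t in auto)
  then show ?thesis using NT t assms by (simp add: read_sym_def)
next
  case (Tm d)
  let ?t = "tick 1 (sem (Inp v_m) s)"
  have "pending rl0 ts (vars (sem read_word ?t)) (heap (sem read_word ?t)) \<and> inp (sem read_word ?t) = rest
    \<and> clock (sem read_word ?t) \<le> clock ?t + M * 40 + 7"
  proof (rule read_word)
    show "pending rl0 (map (\<lambda>a. Suc (cl a)) d @ ts) (vars ?t) (heap ?t)"
      by (rule pending_cong[of _ _ "vars s" "heap s"]) (use assms Tm in auto)
  qed (use assms Tm in auto)
  then show ?thesis using Tm assms by (simp add: read_sym_def)
qed

definition "read_prod = read_nonterminal v_q ;; Inp v_len ;; For v_j v_len read_sym ;; emit_end"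

lemma mods_read_prod [simp]:
  "mods read_prod = {v_len, v_j, v_m, v_k, v_x, v_t, v_q, v_fresh, v_R}" "puts read_prod = {h_lhs, h_fst, h_snd}"
  by (auto simp: read_prod_def)

lemma read_prod:
  assumes "inp s = enc_prod (X, \<alpha>) @ rest" "length \<alpha> \<le> M" "\<And>d. Tm d \<in> set \<alpha> \<Longrightarrow> length d \<le> M"
    "rules_rep rl (vars s) (heap s)" "\<And>a. heap s h_class a = cl a"
    "vars s v_one = 1" "vars s v_two = 2" "vars s v_zero = 0"
  shows "rules_rep (rl @ rhs_rules (length rl) (4 + 2 * X) (ids cl \<alpha>)) (vars (sem read_prod s)) (heap (sem read_prod s))
    \<and> inp (sem read_prod s) = rest \<and> clock (sem read_prod s) \<le> clock s + M * (M * 40 + 39) + 34"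
proof -
  let ?rl = "rl @ rhs_rules (length rl) (4 + 2 * X) (ids cl \<alpha>)"
  let ?s = "sem (read_nonterminal v_q ;; Inp v_len) s"
  let ?P = "\<lambda>(ys :: (nat, word) sym list) zs V H. pending ?rl (ids cl zs) V H"
  have nt: "vars (sem (read_nonterminal v_q) s) v_q = 4 + 2 * X
     \<and> inp (sem (read_nonterminal v_q) s) = enc_list enc_sym \<alpha> @ rest
     \<and> clock (sem (read_nonterminal v_q) s) = clock s + 4"
    by (rule read_nonterminal) (use assms in auto)
  define t where "t = sem (For v_j v_len read_sym) ?s"
  have sem: "sem read_prod s = sem emit_end t" and clock: "clock ?s = clock s + 5"
    using nt by (simp_all add: read_prod_def t_def)
  have t: "?P \<alpha> [] (vars t) (heap t) \<and> inp t = rest \<and> clock t \<le> clock ?s + M * ((M * 40 + 35) + 4) + 6"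
    unfolding t_def
  proof (rule for_read[where P = ?P and f = enc_sym])
    fix ys x zs and s' :: st and rest'
    assume \<alpha>: "\<alpha> = ys @ x # zs" and P: "?P ys (x # zs) (vars s') (heap s')" and inp: "inp s' = enc_sym x @ rest'"
      and frame: "\<And>w. w \<noteq> v_j \<Longrightarrow> w \<notin> mods read_sym \<Longrightarrow> vars s' w = vars ?s w"
        "\<And>t. t \<notin> puts read_sym \<Longrightarrow> heap s' t = heap ?s t"
    let ?t = "assign v_j (length ys) 3 s'"
    have "pending ?rl (ids cl zs) (vars (sem read_sym ?t)) (heap (sem read_sym ?t)) \<and> inp (sem read_sym ?t) = rest'
      \<and> clock (sem read_sym ?t) \<le> clock ?t + M * 40 + 32"
    proof (rule read_sym)
      show "pending ?rl (sym_ids cl x @ ids cl zs) (vars ?t) (heap ?t)"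
        by (rule pending_cong[of _ _ "vars s'" "heap s'"]) (use P in auto)
      show "heap ?t h_class a = cl a" for a using frame(2)[of h_class] assms(5) by simp
      show "vars ?t v_one = 1" using frame(1)[of v_one] assms(6) by simp
      show "vars ?t v_two = 2" using frame(1)[of v_two] assms(7) by simp
      show "vars ?t v_zero = 0" using frame(1)[of v_zero] assms(8) by simp
    qed (use assms(3) \<alpha> inp in auto)
    then show "?P (ys @ [x]) zs (vars (sem read_sym ?t)) (heap (sem read_sym ?t))
      \<and> inp (sem read_sym ?t) = rest' \<and> clock (sem read_sym ?t) \<le> clock s' + (M * 40 + 35)"
      by simp
  next
    have "rules_rep rl (vars ?s) (heap ?s)"
      by (rule rules_rep_cong[OF assms(4)]) auto
    then show "?P [] \<alpha> (vars ?s) (heap ?s)"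
      unfolding pending_def using nt by (intro exI[of _ rl]) simp
  qed (use assms(2) nt in \<open>auto simp: enc_list_def\<close>)
  then have "rules_rep ?rl (vars (sem emit_end t)) (heap (sem emit_end t))"
    by (intro emit_end) (use assms in \<open>auto simp: t_def\<close>)
  with t show ?thesis unfolding sem clock by (simp add: algebra_simps)
qed

definition "read_prods = Set v_R 0 ;; Set v_fresh 5 ;; Inp v_n ;; For v_i v_n read_prod"

lemma mods_read_prods [simp]:
  "mods read_prods = {v_n, v_i, v_len, v_j, v_m, v_k, v_x, v_t, v_q, v_fresh, v_R}"
  "puts read_prods = {h_lhs, h_fst, h_snd}"
  by (auto simp: read_prods_def)

lemma read_prods:
  assumes "inp s = enc_list enc_prod ps @ rest" "length ps \<le> M"
    "\<And>X \<alpha>. (X, \<alpha>) \<in> set ps \<Longrightarrow> length \<alpha> \<le> M" "\<And>X \<alpha> d. (X, \<alpha>) \<in> set ps \<Longrightarrow> Tm d \<in> set \<alpha> \<Longrightarrow> length d \<le> M"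
    "\<And>a. heap s h_class a = cl a" "vars s v_one = 1" "vars s v_two = 2" "vars s v_zero = 0"
  shows "rules_rep (grammar_rules cl 0 ps) (vars (sem read_prods s)) (heap (sem read_prods s))
    \<and> inp (sem read_prods s) = rest \<and> clock (sem read_prods s) \<le> clock s + M * (M * (M * 40 + 39) + 41) + 9"
proof -
  let ?s = "sem (Set v_R 0 ;; Set v_fresh 5 ;; Inp v_n) s"
  let ?P = "\<lambda>(ys :: (nat, word) production list) zs V H. \<exists>rl. rules_rep rl V H \<and> grammar_rules cl 0 ps = rl @ grammar_rules cl (length rl) zs"
  have "?P ps [] (vars (sem (For v_i v_n read_prod) ?s)) (heap (sem (For v_i v_n read_prod) ?s))
    \<and> inp (sem (For v_i v_n read_prod) ?s) = rest
    \<and> clock (sem (For v_i v_n read_prod) ?s) \<le> clock ?s + M * ((M * (M * 40 + 39) + 37) + 4) + 6"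
  proof (rule for_read[where P = ?P and f = enc_prod])
    fix ys x zs and s' :: st and rest'
    assume ps: "ps = ys @ x # zs" and P: "?P ys (x # zs) (vars s') (heap s')" and inp: "inp s' = enc_prod x @ rest'"
      and frame: "\<And>w. w \<noteq> v_i \<Longrightarrow> w \<notin> mods read_prod \<Longrightarrow> vars s' w = vars ?s w"
        "\<And>t. t \<notin> puts read_prod \<Longrightarrow> heap s' t = heap ?s t"
    obtain X \<alpha> where x: "x = (X, \<alpha>)" by (cases x)
    from P obtain rl where rl: "rules_rep rl (vars s') (heap s')"
      "grammar_rules cl 0 ps = rl @ grammar_rules cl (length rl) (x # zs)" by blast
    let ?t = "assign v_i (length ys) 3 s'"
    have "rules_rep (rl @ rhs_rules (length rl) (4 + 2 * X) (ids cl \<alpha>)) (vars (sem read_prod ?t)) (heap (sem read_prod ?t))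
      \<and> inp (sem read_prod ?t) = rest' \<and> clock (sem read_prod ?t) \<le> clock ?t + M * (M * 40 + 39) + 34"
    proof (rule read_prod)
      show "rules_rep rl (vars ?t) (heap ?t)"
        by (rule rules_rep_cong[OF rl(1)]) auto
      show "heap ?t h_class a = cl a" for a using frame(2)[of h_class] assms(5) by simp
      show "vars ?t v_one = 1" using frame(1)[of v_one] assms(6) by simp
      show "vars ?t v_two = 2" using frame(1)[of v_two] assms(7) by simp
      show "vars ?t v_zero = 0" using frame(1)[of v_zero] assms(8) by simp
      show "length \<alpha> \<le> M" using assms(3)[of X \<alpha>] ps x by simp
      show "length d \<le> M" if "Tm d \<in> set \<alpha>" for d using assms(4)[of X \<alpha> d] ps x that by simp
    qed (use inp x in auto)
    then show "?P (ys @ [x]) zs (vars (sem read_prod ?t)) (heap (sem read_prod ?t))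
      \<and> inp (sem read_prod ?t) = rest' \<and> clock (sem read_prod ?t) \<le> clock s' + (M * (M * 40 + 39) + 37)"
      using rl(2) x by (auto intro!: exI[of _ "rl @ rhs_rules (length rl) (4 + 2 * X) (ids cl \<alpha>)"])
  qed (use assms in \<open>auto simp: enc_list_def rules_rep_def arr_def\<close>)
  then show ?thesis by (auto simp: read_prods_def algebra_simps)
qed

section \<open>Saturating the table\<close>

lemma sem_heap_all [simp]: "puts c = {} \<Longrightarrow> heap (sem c s) = heap s"
  by (rule ext) simp

text \<open>Cantor pairing by additions: the loop sums the numbers below \<open>a + b\<close>, and
  one more addition of \<open>a + b\<close> completes the triangular number.\<close>

definition "pair_code u a b =
  Plus v_sum a b ;; Set v_tri 0 ;; For v_l v_sum (Plus v_tri v_tri v_l) ;;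
  Plus v_tri v_tri v_sum ;; Plus u v_tri a"

lemma mods_pair_code [simp]:
  "mods (pair_code u a b) = {u, v_sum, v_tri, v_l}" "puts (pair_code u a b) = {}" "\<not> reads (pair_code u a b)"
  by (auto simp: pair_code_def)

text \<open>\<open>a\<close> is read again after the loop, hence the restriction on it.
  \<open>u\<close> may coincide with \<open>b\<close>, which \<open>index_code\<close> uses to nest
  two pairings in one variable.\<close>

lemma pair_code:
  assumes "a \<notin> {v_sum, v_tri, v_l}"
  shows "vars (sem (pair_code u a b) s) u = prod_encode (vars s a, vars s b)
    \<and> clock (sem (pair_code u a b) s) \<le> clock s + 8 * (vars s a + vars s b) + 10"
proof -
  let ?s = "sem (Plus v_sum a b ;; Set v_tri 0) s" and ?n = "vars s a + vars s b"
  let ?c = "Plus v_tri v_tri v_l"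
  have "(vars (sem (For v_l v_sum ?c) ?s) v_tri + ?n = triangle ?n)
    \<and> clock (sem (For v_l v_sum ?c) ?s) \<le> clock ?s + ?n * (4 + 4) + 6"
    by (rule for_rule[where P = "\<lambda>i V H J. V v_tri + i = triangle i" and n = ?n]) auto
  then show ?thesis using assms by (auto simp: pair_code_def prod_encode_def)
qed

definition "index_code u q i j = pair_code u i j ;; pair_code u q u"

lemma mods_index_code [simp]:
  "mods (index_code u q i j) = {u, v_sum, v_tri, v_l}" "puts (index_code u q i j) = {}" "\<not> reads (index_code u q i j)"
  by (auto simp: index_code_def)

definition "idx q i j = prod_encode (q, prod_encode (i, j))"

lemma idx_eq_iff [simp]: "idx q i j = idx q' i' j' \<longleftrightarrow> q = q' \<and> i = i' \<and> j = j'"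
  by (auto simp: idx_def)

text \<open>Two pairings at 8 steps per unit of their sums plus 10: the inner sum is at most
  \<open>2 * W\<close>, the outer one at most \<open>Q\<close> plus the inner code, which
  \<open>prod_encode_le\<close> bounds by the square.\<close>

definition "index_cost Q W = 16 * W + 8 * (Q + (2 * W + 1)\<^sup>2) + 20"

lemma prod_encode_le: "prod_encode (i, j) \<le> (i + j + 1)\<^sup>2"
proof -
  have "triangle n \<le> n * (n + 1)" for n by (simp add: triangle_def)
  from this[of "i + j"] show ?thesis by (simp add: prod_encode_def power2_eq_square algebra_simps)
qed

lemma index_code:
  assumes "q \<notin> {u, v_sum, v_tri, v_l}" "i \<notin> {v_sum, v_tri, v_l}" "u \<notin> {v_sum, v_tri, v_l}"
    and "vars s q \<le> Q" "vars s i \<le> W" "vars s j \<le> W"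
  shows "vars (sem (index_code u q i j) s) u = idx (vars s q) (vars s i) (vars s j)
    \<and> clock (sem (index_code u q i j) s) \<le> clock s + index_cost Q W"
proof -
  let ?s = "sem (pair_code u i j) s"
  have 1: "vars ?s u = prod_encode (vars s i, vars s j)" "clock ?s \<le> clock s + 8 * (vars s i + vars s j) + 10"
    using pair_code[of i u j s] assms by auto
  have 2: "vars (sem (pair_code u q u) ?s) u = prod_encode (vars ?s q, vars ?s u)"
    "clock (sem (pair_code u q u) ?s) \<le> clock ?s + 8 * (vars ?s q + vars ?s u) + 10"
    using pair_code[of q u u ?s] assms by auto
  have "(vars s i + vars s j + 1)\<^sup>2 \<le> (2 * W + 1)\<^sup>2" using assms by (intro power_mono) auto
  then have "vars ?s u \<le> (2 * W + 1)\<^sup>2" using 1 prod_encode_le order_trans by metis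
  moreover have "vars ?s q \<le> Q" using assms by simp
  ultimately show ?thesis using 1 2 assms by (simp add: index_code_def idx_def index_cost_def)
qed

text \<open>Everything that saturation reads but never changes. The table is left out, since
  \<open>adds\<close> tracks it separately.\<close>

definition env :: "nat \<Rightarrow> nat list \<Rightarrow> (nat \<times> nat \<times> nat) list \<Rightarrow> nat \<Rightarrow> (nat \<Rightarrow> nat) \<Rightarrow> (nat \<Rightarrow> nat \<Rightarrow> nat) \<Rightarrow> bool" where
  "env K c rl S V H \<longleftrightarrow> V v_one = 1 \<and> V v_zero = 0 \<and> V v_pos = length c \<and> V v_W = Suc (length c)
     \<and> V v_K = K \<and> V v_R = length rl \<and> V v_start = S \<and> arr (H h_code) c
     \<and> arr (\<lambda>p. (H h_lhs p, H h_fst p, H h_snd p)) rl"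

text \<open>Absence is the value 0, so the initial memory already is the empty table.\<close>

definition tab :: "(nat \<Rightarrow> nat \<Rightarrow> nat) \<Rightarrow> (nat \<times> nat \<times> nat) set" where
  "tab H = {(q, i, j). 0 < H h_tab (idx q i j)}"

text \<open>Such a precondition survives any change that \<open>c\<close> could cause, so it is
  available again at the start of each loop iteration.\<close>

definition stable :: "com \<Rightarrow> ((nat \<Rightarrow> nat) \<Rightarrow> (nat \<Rightarrow> nat \<Rightarrow> nat) \<Rightarrow> bool) \<Rightarrow> bool" where
  "stable c E \<longleftrightarrow> (\<forall>V H V' H'. E V H \<longrightarrow> (\<forall>w. w \<notin> mods c \<longrightarrow> V' w = V w) \<longrightarrow> (\<forall>t. t \<notin> puts c \<longrightarrow> H' t = H t)
     \<longrightarrow> E V' H')"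

lemma stableD: "stable c E \<Longrightarrow> E V H \<Longrightarrow> (\<And>w. w \<notin> mods c \<Longrightarrow> V' w = V w) \<Longrightarrow> (\<And>t. t \<notin> puts c \<Longrightarrow> H' t = H t) \<Longrightarrow> E V' H'"
  unfolding stable_def by blast

text \<open>Keeping \<open>F0\<close> fixed lets \<open>G\<close> be described independently of the entries that earlier
  iterations have added.\<close>

definition adds :: "((nat \<Rightarrow> nat) \<Rightarrow> (nat \<Rightarrow> nat \<Rightarrow> nat) \<Rightarrow> bool) \<Rightarrow> com \<Rightarrow> (nat \<times> nat \<times> nat) set \<Rightarrow>
    (nat \<times> nat \<times> nat) set \<Rightarrow> (nat \<times> nat \<times> nat) set \<Rightarrow> nat \<Rightarrow> bool" where
  "adds E c F0 G I T \<longleftrightarrow> (\<forall>s. E (vars s) (heap s) \<longrightarrow> F0 \<subseteq> tab (heap s) \<longrightarrow> tab (heap s) \<subseteq> I \<longrightarrow>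
     tab (heap s) \<union> G \<subseteq> tab (heap (sem c s)) \<and> tab (heap (sem c s)) \<subseteq> I \<and> clock (sem c s) \<le> clock s + T)"

lemma addsD:
  assumes "adds E c F0 G I T" "E (vars s) (heap s)" "F0 \<subseteq> tab (heap s)" "tab (heap s) \<subseteq> I"
  shows "tab (heap s) \<union> G \<subseteq> tab (heap (sem c s))" "tab (heap (sem c s)) \<subseteq> I" "clock (sem c s) \<le> clock s + T"
  using assms unfolding adds_def by blast+

text \<open>Tables only grow, so the contributions \<open>G i\<close> of the iterations accumulate.
  Of the 7 extra steps per iteration, 3 set the loop variable and 4 advance the counter.\<close>

lemma adds_for:
  assumes n: "\<And>V H. E V H \<Longrightarrow> V r = n" "n \<le> M" and stable: "stable (For v r c) E"
    and body: "\<And>i. i < n \<Longrightarrow> adds (\<lambda>V H. E V H \<and> V v = i) c F0 (G i) I T"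
  shows "adds E (For v r c) F0 (\<Union>i<n. G i) I (M * (T + 7) + 6)"
  unfolding adds_def
proof (intro allI impI)
  fix s :: st
  assume E: "E (vars s) (heap s)" and F0: "F0 \<subseteq> tab (heap s)" and I: "tab (heap s) \<subseteq> I"
  let ?P = "\<lambda>i V H J. tab (heap s) \<union> (\<Union>i'<i. G i') \<subseteq> tab H \<and> tab H \<subseteq> I"
  let ?s = "sem (For v r c) s"
  have "?P n (vars ?s) (heap ?s) (inp ?s) \<and> clock ?s \<le> clock s + M * ((T + 3) + 4) + 6"
  proof (rule for_rule[where P = ?P])
    show "n = vars s r" using n(1)[OF E] by simp
    fix i and s' :: st
    assume i: "i < n" and P: "?P i (vars s') (heap s') (inp s')"
      and frame: "\<And>w. w \<noteq> v \<Longrightarrow> w \<notin> mods c \<Longrightarrow> vars s' w = vars s w"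
       "\<And>t. t \<notin> puts c \<Longrightarrow> heap s' t = heap s t"
    let ?t = "assign v i 3 s'"
    have "E (vars ?t) (heap ?t)"
      by (rule stableD[OF stable, OF E]) (use frame in auto)
    moreover have "vars ?t v = i" by simp
    moreover have "F0 \<subseteq> tab (heap ?t)" "tab (heap ?t) \<subseteq> I" using P F0 by auto
    ultimately show "?P (Suc i) (vars (sem c ?t)) (heap (sem c ?t)) (inp (sem c ?t))
        \<and> clock (sem c ?t) \<le> clock s' + (T + 3)"
      using addsD[OF body[OF i], of ?t] P by (auto simp: lessThan_Suc)
  qed (use n(2) I in auto)
  then show "tab (heap s) \<union> (\<Union>i<n. G i) \<subseteq> tab (heap ?s) \<and> tab (heap ?s) \<subseteq> I
      \<and> clock ?s \<le> clock s + (M * (T + 7) + 6)"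
    by (simp add: algebra_simps)
qed

lemma adds_subset: "adds E c F0 G I T \<Longrightarrow> G' \<subseteq> G \<Longrightarrow> adds E c F0 G' I T"
  unfolding adds_def by blast

definition "put_entry q i j = index_code v_u q i j ;; Put h_tab v_u v_one"

lemma mods_put_entry [simp]:
  "mods (put_entry q i j) = {v_u, v_sum, v_tri, v_l}" "puts (put_entry q i j) = {h_tab}"
  by (auto simp: put_entry_def)

lemma put_entry:
  assumes "q \<notin> {v_u, v_sum, v_tri, v_l}" "i \<notin> {v_sum, v_tri, v_l}"
    and "vars s q \<le> Q" "vars s i \<le> W" "vars s j \<le> W" "vars s v_one = 1"
  shows "tab (heap (sem (put_entry q i j) s)) = insert (vars s q, vars s i, vars s j) (tab (heap s))
    \<and> clock (sem (put_entry q i j) s) \<le> clock s + index_cost Q W + 7"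
  using index_code[of q v_u i s Q W j] assms by (auto simp: put_entry_def tab_def)

definition "get_entry v q i j = index_code v_u q i j ;; Get v h_tab v_u"

lemma mods_get_entry [simp]:
  "mods (get_entry v q i j) = {v, v_u, v_sum, v_tri, v_l}" "puts (get_entry v q i j) = {}"
  by (auto simp: get_entry_def)

lemma get_entry:
  assumes "q \<notin> {v_u, v_sum, v_tri, v_l}" "i \<notin> {v_sum, v_tri, v_l}"
    and "vars s q \<le> Q" "vars s i \<le> W" "vars s j \<le> W"
  shows "(0 < vars (sem (get_entry v q i j) s) v \<longleftrightarrow> (vars s q, vars s i, vars s j) \<in> tab (heap s))
    \<and> clock (sem (get_entry v q i j) s) \<le> clock s + index_cost Q W + 7"
  using index_code[of q v_u i s Q W j] assms by (simp add: get_entry_def tab_def)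

definition "seed_eps = For v_i v_W (put_entry v_zero v_i v_i)"

definition "seed_chr =
  For v_i v_pos (Get v_x h_code v_i ;; Plus v_x v_x v_one ;; Plus v_j v_i v_one ;; put_entry v_x v_i v_j)"

definition "combine = get_entry v_y v_b v_k v_j ;; Cond v_y (put_entry v_q v_i v_j) Skip"

definition "combine_all =
  For v_i v_W (For v_k v_W (get_entry v_y v_a v_i v_k ;; Cond v_y (For v_j v_W combine) Skip))"

definition "sat_round =
  For v_rule v_R (Get v_q h_lhs v_rule ;; Get v_a h_fst v_rule ;; Get v_b h_snd v_rule ;; combine_all)"

lemma mods_combine [simp]:
  "mods combine = {v_y, v_u, v_sum, v_tri, v_l}" "puts combine = {h_tab}"
  by (auto simp: combine_def)

lemma mods_combine_all [simp]:
  "mods combine_all = {v_i, v_k, v_j, v_y, v_u, v_sum, v_tri, v_l}" "puts combine_all = {h_tab}"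
  by (auto simp: combine_all_def)

lemma mods_sat_round [simp]:
  "mods sat_round = {v_rule, v_q, v_a, v_b, v_i, v_k, v_j, v_y, v_u, v_sum, v_tri, v_l}" "puts sat_round = {h_tab}"
  by (auto simp: sat_round_def)

lemma mods_seed [simp]:
  "mods seed_eps = {v_i, v_u, v_sum, v_tri, v_l}" "puts seed_eps = {h_tab}"
  "mods seed_chr = {v_i, v_x, v_j, v_u, v_sum, v_tri, v_l}" "puts seed_chr = {h_tab}"
  by (auto simp: seed_eps_def seed_chr_def)

abbreviation (input) "items R c \<equiv> {(q, i, j). item R c q i j}"

lemma seed_eps:
  assumes "length c < W"
  shows "adds (env K c rl S) seed_eps F0 {(0, i, i) | i. i \<le> length c} (items R c) (W * (index_cost Q W + 14) + 6)"
proof -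
  have "adds (env K c rl S) seed_eps F0 (\<Union>i<Suc (length c). {(0, i, i)}) (items R c) (W * ((index_cost Q W + 7) + 7) + 6)"
    unfolding seed_eps_def
  proof (rule adds_for)
    show "stable (For v_i v_W (put_entry v_zero v_i v_i)) (env K c rl S)"
      by (simp add: stable_def env_def)
    show "adds (\<lambda>V H. env K c rl S V H \<and> V v_i = i) (put_entry v_zero v_i v_i) F0 {(0, i, i)} (items R c) (index_cost Q W + 7)"
      if "i < Suc (length c)" for i
      unfolding adds_def
    proof (intro allI impI, elim conjE)
      fix s :: st assume "env K c rl S (vars s) (heap s)" "vars s v_i = i" "tab (heap s) \<subseteq> items R c"
      with put_entry[of v_zero v_i s Q W v_i] assms that
      show "tab (heap s) \<union> {(0, i, i)} \<subseteq> tab (heap (sem (put_entry v_zero v_i v_i) s)) \<and>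
         tab (heap (sem (put_entry v_zero v_i v_i) s)) \<subseteq> items R c \<and>
         clock (sem (put_entry v_zero v_i v_i) s) \<le> clock s + (index_cost Q W + 7)"
        by (auto simp: env_def intro: item.eps)
    qed
  qed (use assms in \<open>auto simp: env_def\<close>)
  then have "adds (env K c rl S) seed_eps F0 {(0, i, i) | i. i \<le> length c} (items R c) (W * ((index_cost Q W + 7) + 7) + 6)"
    by (rule adds_subset) (auto simp: less_Suc_eq_le)
  then show ?thesis by (simp add: add.assoc)
qed

lemma seed_chr:
  assumes "length c < W" "\<And>i. i < length c \<Longrightarrow> Suc (c ! i) \<le> Q"
  shows "adds (env K c rl S) seed_chr F0 {(Suc (c ! i), i, Suc i) | i. i < length c} (items R c) (W * (index_cost Q W + 23) + 6)"
proof -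
  let ?c = "Get v_x h_code v_i ;; Plus v_x v_x v_one ;; Plus v_j v_i v_one ;; put_entry v_x v_i v_j"
  have "adds (env K c rl S) seed_chr F0 (\<Union>i<length c. {(Suc (c ! i), i, Suc i)}) (items R c) (W * ((index_cost Q W + 16) + 7) + 6)"
    unfolding seed_chr_def
  proof (rule adds_for)
    show "stable (For v_i v_pos ?c) (env K c rl S)"
      by (simp add: stable_def env_def)
    show "adds (\<lambda>V H. env K c rl S V H \<and> V v_i = i) ?c F0 {(Suc (c ! i), i, Suc i)} (items R c) (index_cost Q W + 16)"
      if "i < length c" for i
      unfolding adds_def
    proof (intro allI impI, elim conjE)
      fix s :: st assume s: "env K c rl S (vars s) (heap s)" "vars s v_i = i" "tab (heap s) \<subseteq> items R c"
      let ?s = "sem (Get v_x h_code v_i ;; Plus v_x v_x v_one ;; Plus v_j v_i v_one) s"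
      have "heap s h_code i = c ! i" using s that by (auto simp: env_def intro: arr_nth)
      then have "vars ?s v_x = Suc (c ! i)" "vars ?s v_j = Suc i" "vars ?s v_i = i" "vars ?s v_one = 1"
        using s by (auto simp: env_def)
      with put_entry[of v_x v_i ?s Q W v_j] assms that s
      show "tab (heap s) \<union> {(Suc (c ! i), i, Suc i)} \<subseteq> tab (heap (sem ?c s)) \<and>
         tab (heap (sem ?c s)) \<subseteq> items R c \<and> clock (sem ?c s) \<le> clock s + (index_cost Q W + 16)"
        by (auto intro: item.chr)
    qed
  qed (use assms in \<open>auto simp: env_def\<close>)
  then have "adds (env K c rl S) seed_chr F0 {(Suc (c ! i), i, Suc i) | i. i < length c} (items R c) (W * ((index_cost Q W + 16) + 7) + 6)"
    by (rule adds_subset) auto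
  then show ?thesis by (simp add: add.assoc)
qed

definition "env_rule K c rl S q a b V H \<longleftrightarrow> env K c rl S V H \<and> V v_q = q \<and> V v_a = a \<and> V v_b = b"

text \<open>The assumed item for \<open>a\<close> makes the added entries sound;
  \<open>combine_all\<close> obtains it by entering this loop only where the table holds that
  entry.\<close>

lemma combine_loop:
  assumes "length c < W" "(q, a, b) \<in> R" "q \<le> Q" "b \<le> Q" "item R c a i k"
  shows "adds (\<lambda>V H. (env_rule K c rl S q a b V H \<and> V v_i = i) \<and> V v_k = k) (For v_j v_W combine) F0
    {(q, i, j) | j. (b, k, j) \<in> F0 \<and> j \<le> length c} (items R c) (W * (2 * index_cost Q W + 24) + 6)"
proof -
  let ?E = "\<lambda>V H. (env_rule K c rl S q a b V H \<and> V v_i = i) \<and> V v_k = k"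
  \<comment> \<open>The variable of type \<open>unit\<close> is a dummy: the set is a singleton if
    the condition holds and empty otherwise.\<close>
  let ?G = "\<lambda>j. {(q, i, j) | x::unit. (b, k, j) \<in> F0}"
  have ik: "i \<le> length c" "k \<le> length c"
    using assms(5) item_bounds by (auto dest: item_bounds)
  have "adds ?E (For v_j v_W combine) F0 (\<Union>j<Suc (length c). ?G j) (items R c) (W * ((2 * index_cost Q W + 17) + 7) + 6)"
  proof (rule adds_for)
    show "stable (For v_j v_W combine) ?E"
      by (simp add: stable_def env_def env_rule_def)
    show "adds (\<lambda>V H. ?E V H \<and> V v_j = j) combine F0 (?G j) (items R c) (2 * index_cost Q W + 17)"
      if j: "j < Suc (length c)" for j
      unfolding adds_def
    proof (intro allI impI, elim conjE)
      fix s :: st assume s: "env_rule K c rl S q a b (vars s) (heap s)" "vars s v_i = i" "vars s v_k = k" "vars s v_j = j"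
        "F0 \<subseteq> tab (heap s)" "tab (heap s) \<subseteq> items R c"
      let ?s = "sem (get_entry v_y v_b v_k v_j) s"
      have v: "vars s v_q = q" "vars s v_b = b" "vars s v_one = 1" using s by (auto simp: env_rule_def env_def)
      have g: "0 < vars ?s v_y \<longleftrightarrow> (b, k, j) \<in> tab (heap s)" "clock ?s \<le> clock s + index_cost Q W + 7"
        using get_entry[of v_b v_k s Q W v_j v_y] s assms j ik v by auto
      have p: "tab (heap (sem (put_entry v_q v_i v_j) (tick 1 ?s))) = insert (q, i, j) (tab (heap s))"
        "clock (sem (put_entry v_q v_i v_j) (tick 1 ?s)) \<le> clock ?s + 1 + index_cost Q W + 7"
        using put_entry[of v_q v_i "tick 1 ?s" Q W v_j] s assms j ik v by auto
      have "item R c q i j" if "(b, k, j) \<in> tab (heap s)"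
        using that s(6) assms(2,5) by (auto intro: item.bin)
      then show "tab (heap s) \<union> ?G j \<subseteq> tab (heap (sem combine s)) \<and>
         tab (heap (sem combine s)) \<subseteq> items R c \<and> clock (sem combine s) \<le> clock s + (2 * index_cost Q W + 17)"
        using g p s(5,6) by (auto simp: combine_def)
    qed
  qed (use assms in \<open>auto simp: env_def env_rule_def\<close>)
  then have "adds ?E (For v_j v_W combine) F0 {(q, i, j) | j. (b, k, j) \<in> F0 \<and> j \<le> length c} (items R c)
      (W * ((2 * index_cost Q W + 17) + 7) + 6)"
    by (rule adds_subset) (auto simp: less_Suc_eq_le)
  then show ?thesis by (simp add: add.assoc)
qed

definition "combine_cost Q W = W * (W * (W * (2 * index_cost Q W + 24) + 6 + index_cost Q W + 17) + 13) + 6"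

lemma combine_all:
  assumes "length c < W" "(q, a, b) \<in> R" "q \<le> Q" "a \<le> Q" "b \<le> Q"
  shows "adds (env_rule K c rl S q a b) combine_all F0
    {(q, i, j) | i k j. (a, i, k) \<in> F0 \<and> (b, k, j) \<in> F0 \<and> i \<le> length c \<and> k \<le> length c \<and> j \<le> length c}
    (items R c) (combine_cost Q W)"
proof -
  let ?E = "env_rule K c rl S q a b"
  let ?c = "get_entry v_y v_a v_i v_k ;; Cond v_y (For v_j v_W combine) Skip"
  let ?G = "\<lambda>i k. {(q, i, j) | j. (a, i, k) \<in> F0 \<and> (b, k, j) \<in> F0 \<and> j \<le> length c}"
  let ?T = "W * (2 * index_cost Q W + 24) + 6 + index_cost Q W + 10"
  have body: "adds (\<lambda>V H. (?E V H \<and> V v_i = i) \<and> V v_k = k) ?c F0 (?G i k) (items R c) ?T"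
    if ik: "i < Suc (length c)" "k < Suc (length c)" for i k
    unfolding adds_def
  proof (intro allI impI, elim conjE)
    fix s :: st assume s: "?E (vars s) (heap s)" "vars s v_i = i" "vars s v_k = k" "F0 \<subseteq> tab (heap s)" "tab (heap s) \<subseteq> items R c"
    let ?s = "sem (get_entry v_y v_a v_i v_k) s"
    have v: "vars s v_a = a" using s by (auto simp: env_rule_def)
    have g: "0 < vars ?s v_y \<longleftrightarrow> (a, i, k) \<in> tab (heap s)" "clock ?s \<le> clock s + index_cost Q W + 7"
      using get_entry[of v_a v_i s Q W v_k v_y] s assms ik v by auto
    show "tab (heap s) \<union> ?G i k \<subseteq> tab (heap (sem ?c s)) \<and>
         tab (heap (sem ?c s)) \<subseteq> items R c \<and> clock (sem ?c s) \<le> clock s + ?T"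
    proof (cases "(a, i, k) \<in> tab (heap s)")
      case True
      then have it: "item R c a i k" using s(5) by auto
      have E: "(?E (vars (tick 1 ?s)) (heap (tick 1 ?s)) \<and> vars (tick 1 ?s) v_i = i) \<and> vars (tick 1 ?s) v_k = k"
        using s by (simp add: env_rule_def env_def)
      note a = addsD[OF combine_loop[OF assms(1,2,3,5) it, of K rl S F0], of "tick 1 ?s", OF E]
      have sem: "sem ?c s = sem (For v_j v_W combine) (tick 1 ?s)" using True g by simp
      have "?G i k \<subseteq> {(q, i, j) | j. (b, k, j) \<in> F0 \<and> j \<le> length c}" by blast
      then show ?thesis unfolding sem using g(2) s(4,5) a by auto
    next
      case False
      then show ?thesis using g s by auto
    qed
  qed
  have W: "V v_W = Suc (length c)" if "?E V H" for V H
    using that by (simp add: env_def env_rule_def)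
  have body': "adds (\<lambda>V H. ?E V H \<and> V v_i = i) (For v_k v_W ?c) F0 (\<Union>k<Suc (length c). ?G i k) (items R c) (W * (?T + 7) + 6)"
    if i: "i < Suc (length c)" for i
  proof (rule adds_for)
    show "stable (For v_k v_W ?c) (\<lambda>V H. ?E V H \<and> V v_i = i)"
      by (simp add: stable_def env_def env_rule_def)
    show "V v_W = Suc (length c)" if "?E V H \<and> V v_i = i" for V H using that W by blast
    show "Suc (length c) \<le> W" using assms(1) by simp
  qed (rule body[OF i])
  have "adds ?E combine_all F0 (\<Union>i<Suc (length c). \<Union>k<Suc (length c). ?G i k) (items R c)
      (W * (W * (?T + 7) + 6 + 7) + 6)"
    unfolding combine_all_def
  proof (rule adds_for)
    show "stable (For v_i v_W (For v_k v_W ?c)) ?E"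
      by (simp add: stable_def env_def env_rule_def)
    show "Suc (length c) \<le> W" using assms(1) by simp
  qed (fact W, fact body')
  then have "adds ?E combine_all F0 (\<Union>i<Suc (length c). \<Union>k<Suc (length c). ?G i k) (items R c) (combine_cost Q W)"
    by (simp add: combine_cost_def add.assoc)
  then show ?thesis by (rule adds_subset) (fastforce simp: less_Suc_eq_le)
qed

text \<open>One simultaneous application of all rules. \<open>L\<close> bounds the positions that
  the loops visit, and by \<open>item_bounds\<close> every item stays within it.\<close>

definition bin_step :: "(nat \<times> nat \<times> nat) set \<Rightarrow> nat \<Rightarrow> (nat \<times> nat \<times> nat) set \<Rightarrow> (nat \<times> nat \<times> nat) set" where
  "bin_step R L F = {(q, i, j) | q i j a b k. (q, a, b) \<in> R \<and> (a, i, k) \<in> F \<and> (b, k, j) \<in> F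
     \<and> i \<le> L \<and> k \<le> L \<and> j \<le> L}"

text \<open>Entries are inserted in place, so a round may already use its own additions. Guaranteed
  is only what follows in one step from \<open>F0\<close>, and that is enough for
  \<open>round_progress\<close>.\<close>

lemma sat_round:
  assumes "length c < W" "length rl \<le> Q" "\<And>q a b. (q, a, b) \<in> set rl \<Longrightarrow> q \<le> Q \<and> a \<le> Q \<and> b \<le> Q"
  shows "adds (env K c rl S) sat_round F0 (bin_step (set rl) (length c) F0) (items (set rl) c)
    (Q * (combine_cost Q W + 28) + 6)"
proof -
  let ?c = "Get v_q h_lhs v_rule ;; Get v_a h_fst v_rule ;; Get v_b h_snd v_rule ;; combine_all"
  let ?G = "\<lambda>r. {(q, i, j) | q i j a b k. (q, a, b) = rl ! r \<and> (a, i, k) \<in> F0 \<and> (b, k, j) \<in> F0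
     \<and> i \<le> length c \<and> k \<le> length c \<and> j \<le> length c}"
  have "adds (env K c rl S) sat_round F0 (\<Union>r<length rl. ?G r) (items (set rl) c) (Q * ((combine_cost Q W + 21) + 7) + 6)"
    unfolding sat_round_def
  proof (rule adds_for)
    show "stable (For v_rule v_R ?c) (env K c rl S)"
      by (simp add: stable_def env_def)
    show "adds (\<lambda>V H. env K c rl S V H \<and> V v_rule = r) ?c F0 (?G r) (items (set rl) c) (combine_cost Q W + 21)"
      if r: "r < length rl" for r
      unfolding adds_def
    proof (intro allI impI, elim conjE)
      fix s :: st assume s: "env K c rl S (vars s) (heap s)" "vars s v_rule = r" "F0 \<subseteq> tab (heap s)" "tab (heap s) \<subseteq> items (set rl) c"
      obtain q a b where rule: "rl ! r = (q, a, b)" by (cases "rl ! r") auto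
      then have mem: "(q, a, b) \<in> set rl" using r by (metis nth_mem)
      let ?s = "sem (Get v_q h_lhs v_rule ;; Get v_a h_fst v_rule ;; Get v_b h_snd v_rule) s"
      have "(heap s h_lhs r, heap s h_fst r, heap s h_snd r) = (q, a, b)"
        using s(1) r rule by (auto simp: env_def arr_def)
      then have E: "env_rule K c rl S q a b (vars ?s) (heap ?s)" using s by (simp add: env_rule_def env_def)
      have "adds (env_rule K c rl S q a b) combine_all F0
          {(q, i, j) | i k j. (a, i, k) \<in> F0 \<and> (b, k, j) \<in> F0 \<and> i \<le> length c \<and> k \<le> length c \<and> j \<le> length c}
          (items (set rl) c) (combine_cost Q W)"
        using combine_all[OF assms(1) mem] assms(3)[OF mem] by blast
      note a = addsD[OF this, of ?s, OF E]
      have G: "?G r = {(q, i, j) | i k j. (a, i, k) \<in> F0 \<and> (b, k, j) \<in> F0 \<and> i \<le> length c \<and> k \<le> length c \<and> j \<le> length c}"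
        unfolding rule by blast
      have sem: "sem ?c s = sem combine_all ?s" and old: "tab (heap ?s) = tab (heap s)" and clock: "clock ?s = clock s + 21"
        by simp_all
      show "tab (heap s) \<union> ?G r \<subseteq> tab (heap (sem ?c s)) \<and>
         tab (heap (sem ?c s)) \<subseteq> items (set rl) c \<and> clock (sem ?c s) \<le> clock s + (combine_cost Q W + 21)"
        using a s(3,4) unfolding sem old clock G by simp
    qed
  qed (use assms in \<open>auto simp: env_def\<close>)
  then have "adds (env K c rl S) sat_round F0 (bin_step (set rl) (length c) F0) (items (set rl) c) (Q * ((combine_cost Q W + 21) + 7) + 6)"
  proof (rule adds_subset, intro subsetI)
    fix x assume "x \<in> bin_step (set rl) (length c) F0"
    then obtain q i j a b k where x: "x = (q, i, j)" "(a, i, k) \<in> F0" "(b, k, j) \<in> F0"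
      "i \<le> length c" "k \<le> length c" "j \<le> length c" and "(q, a, b) \<in> set rl"
      unfolding bin_step_def by blast
    then obtain r where r: "r < length rl" "rl ! r = (q, a, b)" by (auto simp: in_set_conv_nth)
    have G: "x \<in> ?G r"
      by (rule CollectI, rule exI[of _ q], rule exI[of _ i], rule exI[of _ j], rule exI[of _ a],
          rule exI[of _ b], rule exI[of _ k]) (simp add: x r(2))
    show "x \<in> (\<Union>r<length rl. ?G r)"
      by (rule UN_I[where a = r and B = ?G]) (simp add: r(1), rule G)
  qed
  then show ?thesis by (simp add: add.assoc)
qed

section \<open>The number of rounds and the final test\<close>

definition "rounds_bound Q W = (Q + (2 * W + 1)\<^sup>2 + 1)\<^sup>2"

text \<open>Since the pairing function dominates the product, \<open>idx R W W\<close> is a cheap upper bound for the number of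
  possible entries, hence for the number of rounds needed.\<close>

definition "saturate = index_code v_rounds v_R v_W v_W ;; For v_round v_rounds sat_round"

text \<open>The queries concern the factors before and after the separator; \<open>v_W\<close> minus
  one is the end of the class word. Adding the two answers forms their disjunction.\<close>

definition "accept =
  get_entry v_x v_start v_zero v_K ;; Plus v_i v_K v_one ;; Minus v_j v_W v_one ;;
  get_entry v_y v_start v_i v_j ;; Plus v_x v_x v_y ;; Cond v_x (Set v_ans 1) (Set v_ans 0)"

lemma mods_saturate [simp]:
  "mods saturate = {v_rounds, v_round, v_rule, v_q, v_a, v_b, v_i, v_k, v_j, v_y, v_u, v_sum, v_tri, v_l}"
  "puts saturate = {h_tab}"
  by (auto simp: saturate_def)

lemma mult_le_prod_encode: "m * n \<le> prod_encode (m, n)"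
proof -
  have "2 * (m * n) \<le> (m + n) * Suc (m + n)" by (simp add: algebra_simps)
  then have "m * n \<le> triangle (m + n)" by (simp add: triangle_def)
  then show ?thesis by (simp add: prod_encode_def)
qed

definition seeds :: "nat list \<Rightarrow> (nat \<times> nat \<times> nat) set" where
  "seeds c = {(0, i, i) | i. i \<le> length c} \<union> {(Suc (c ! i), i, Suc i) | i. i < length c}"

lemma items_subset_if_closed:
  assumes "seeds c \<subseteq> F" "bin_step R (length c) F \<subseteq> F"
  shows "items R c \<subseteq> F"
proof -
  have "item R c q i j \<Longrightarrow> (q, i, j) \<in> F" for q i j
  proof (induction rule: item.induct)
    case (bin q a b i k j)
    then have "i \<le> length c" "k \<le> length c" "j \<le> length c"
      using item_bounds[OF bin(2)] item_bounds[OF bin(3)] by auto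
    with bin have "(q, i, j) \<in> bin_step R (length c) F" by (auto simp: bin_step_def)
    then show ?case using assms(2) by blast
  qed (use assms(1) in \<open>auto simp: seeds_def\<close>)
  then show ?thesis by auto
qed

text \<open>Beyond the seeds, an item arises only through a rule, so its row is a left-hand side.
  Counting left-hand sides instead of numbers keeps the bound free of the size of row names.\<close>

definition "candidates rl L = fst ` set rl \<times> {..L} \<times> {..L::nat}"

lemma candidates: "finite (candidates rl L)" "card (candidates rl L) \<le> length rl * (Suc L * Suc L)"
proof -
  show "finite (candidates rl L)" by (simp add: candidates_def)
  have "card (fst ` set rl) \<le> length rl" by (metis card_image_le card_length finite_set le_trans)
  then show "card (candidates rl L) \<le> length rl * (Suc L * Suc L)"
    by (simp only: candidates_def card_cartesian_product card_atMost) (rule mult_le_mono1)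
qed

lemma items_cases: "(q, i, j) \<in> items (set rl) c \<Longrightarrow> (q, i, j) \<in> seeds c \<union> candidates rl (length c)"
proof -
  assume "(q, i, j) \<in> items (set rl) c"
  then have it: "item (set rl) c q i j" by simp
  from it show ?thesis
  proof cases
    case (bin a b k)
    then have "q \<in> fst ` set rl" by force
    then show ?thesis using item_bounds[OF it] by (auto simp: candidates_def)
  qed (auto simp: seeds_def)
qed

text \<open>A round without effect has reached a closed set, which contains all items. Any other
  round adds an item that is not a seed and hence is a new candidate. So after \<open>r\<close>
  rounds the table is complete or holds at least \<open>r\<close> candidates.\<close>

lemma round_progress:
  assumes "seeds c \<subseteq> F" "F \<subseteq> F'" "F' \<subseteq> items (set rl) c" "bin_step (set rl) (length c) F \<subseteq> F'"
    and "items (set rl) c \<subseteq> F \<or> r \<le> card (F \<inter> candidates rl (length c))"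
  shows "items (set rl) c \<subseteq> F' \<or> Suc r \<le> card (F' \<inter> candidates rl (length c))"
proof (cases "F' = F")
  case True
  then show ?thesis using items_subset_if_closed[of c F "set rl"] assms by auto
next
  case False
  then obtain x where x: "x \<in> F'" "x \<notin> F" using assms(2) by blast
  then have "x \<in> items (set rl) c" using assms(3) by blast
  then have "x \<in> seeds c \<union> candidates rl (length c)"
    using items_cases by (cases x) blast
  then have "x \<in> candidates rl (length c)" using x assms(1) by blast
  then have "F \<inter> candidates rl (length c) \<subset> F' \<inter> candidates rl (length c)" using x assms(2) by blast
  then have "card (F \<inter> candidates rl (length c)) < card (F' \<inter> candidates rl (length c))"
    using candidates(1) by (intro psubset_card_mono) auto
  then show ?thesis using assms(2,5) by auto
qed

lemma saturate:
  assumes env: "env K c rl S (vars s) (heap s)" and "seeds c \<subseteq> tab (heap s)" "tab (heap s) \<subseteq> items (set rl) c"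
    and "length c < W" "length rl \<le> Q" "\<And>q a b. (q, a, b) \<in> set rl \<Longrightarrow> q \<le> Q \<and> a \<le> Q \<and> b \<le> Q"
  shows "tab (heap (sem saturate s)) = items (set rl) c
    \<and> clock (sem saturate s) \<le> clock s + index_cost Q W + rounds_bound Q W * (Q * (combine_cost Q W + 28) + 13) + 6"
proof -
  let ?I = "items (set rl) c" and ?C = "candidates rl (length c)"
  define t where "t = sem (index_code v_rounds v_R v_W v_W) s"
  define N where "N = idx (length rl) (Suc (length c)) (Suc (length c))"
  have s: "vars s v_R = length rl" "vars s v_W = Suc (length c)" using env by (auto simp: env_def)
  have t: "vars t v_rounds = N" "clock t \<le> clock s + index_cost Q W"
    using index_code[of v_R v_rounds v_W s Q W v_W] assms s by (auto simp: t_def N_def)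
  have env_t: "env K c rl S (vars t) (heap t)" using env by (simp add: t_def env_def)
  \<comment> \<open>\<open>prod_encode_le\<close> is applied once per level of pairing to bound the
    number \<open>N\<close> of rounds.\<close>
  have "prod_encode (Suc (length c), Suc (length c)) \<le> (2 * W + 1)\<^sup>2"
  proof -
    have "(Suc (length c) + Suc (length c) + 1)\<^sup>2 \<le> (2 * W + 1)\<^sup>2" using assms(4) by (intro power_mono) auto
    then show ?thesis using prod_encode_le order_trans by blast
  qed
  then have "(length rl + prod_encode (Suc (length c), Suc (length c)) + 1)\<^sup>2 \<le> rounds_bound Q W"
    unfolding rounds_bound_def using assms(5) by (intro power_mono) auto
  then have N: "N \<le> rounds_bound Q W"
    unfolding N_def idx_def using prod_encode_le order_trans by blast
  let ?P = "\<lambda>r V H J. seeds c \<subseteq> tab H \<and> tab H \<subseteq> ?I \<and> (?I \<subseteq> tab H \<or> r \<le> card (tab H \<inter> ?C))"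
  let ?T = "Q * (combine_cost Q W + 28) + 6 + 3"
  have sat: "sem saturate s = sem (For v_round v_rounds sat_round) t" by (simp add: saturate_def t_def)
  have P: "?P N (vars (sem saturate s)) (heap (sem saturate s)) (inp (sem saturate s)) \<and>
    clock (sem saturate s) \<le> clock t + rounds_bound Q W * (?T + 4) + 6"
    unfolding sat
  proof (rule for_rule[where P = ?P])
    fix r and s' :: st
    assume r: "?P r (vars s') (heap s') (inp s')"
      and frame: "\<And>w. w \<noteq> v_round \<Longrightarrow> w \<notin> mods sat_round \<Longrightarrow> vars s' w = vars t w"
        "\<And>a. a \<notin> puts sat_round \<Longrightarrow> heap s' a = heap t a"
    let ?s = "assign v_round r 3 s'"
    have E: "env K c rl S (vars ?s) (heap ?s)" using env_t frame by (simp add: env_def)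
    have "adds (env K c rl S) sat_round (tab (heap s')) (bin_step (set rl) (length c) (tab (heap s'))) ?I
        (Q * (combine_cost Q W + 28) + 6)"
      by (rule sat_round) (use assms(4-6) in auto)
    note a = addsD[OF this, of ?s, OF E]
    have "tab (heap ?s) \<subseteq> ?I" using r by simp
    with a have a': "tab (heap s') \<subseteq> tab (heap (sem sat_round ?s))"
      "bin_step (set rl) (length c) (tab (heap s')) \<subseteq> tab (heap (sem sat_round ?s))"
      "tab (heap (sem sat_round ?s)) \<subseteq> ?I" "clock (sem sat_round ?s) \<le> clock s' + ?T"
      by auto
    then show "?P (Suc r) (vars (sem sat_round ?s)) (heap (sem sat_round ?s)) (inp (sem sat_round ?s))
      \<and> clock (sem sat_round ?s) \<le> clock s' + ?T"
      using round_progress[of c "tab (heap s')" "tab (heap (sem sat_round ?s))" rl r] r by blast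
  qed (use t N assms(2,3) in \<open>auto simp: t_def\<close>)
  \<comment> \<open>An incomplete table would hold at least \<open>N\<close> candidates after
    \<open>N\<close> rounds. There are at most \<open>N\<close> of them, so it would hold them all
    and, with the seeds, every item.\<close>
  have "?I \<subseteq> tab (heap (sem saturate s))"
  proof (rule ccontr)
    let ?F = "tab (heap (sem saturate s))"
    assume no: "\<not> ?I \<subseteq> ?F"
    have "card ?C \<le> length rl * (Suc (length c) * Suc (length c))" by (rule candidates)
    also have "\<dots> \<le> length rl * prod_encode (Suc (length c), Suc (length c))"
      by (intro mult_le_mono2 mult_le_prod_encode)
    also have "\<dots> \<le> N" unfolding N_def idx_def by (rule mult_le_prod_encode)
    also have "N \<le> card (?F \<inter> ?C)" using P no by blast
    finally have "?F \<inter> ?C = ?C" using candidates(1) by (intro card_seteq) auto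
    then have "?C \<subseteq> ?F" by blast
    moreover have "seeds c \<subseteq> ?F" using P by blast
    moreover have "?I \<subseteq> seeds c \<union> ?C"
    proof
      fix x assume "x \<in> ?I"
      then show "x \<in> seeds c \<union> ?C" using items_cases by (cases x) blast
    qed
    ultimately have "?I \<subseteq> ?F" by blast
    with no show False ..
  qed
  with P t(2) show ?thesis by (auto simp: algebra_simps)
qed

lemma accept:
  assumes env: "env K c rl S (vars s) (heap s)" and "length c = Suc (2 * K)" "length c < W" "S \<le> Q"
  shows "vars (sem accept s) v_ans = (if (S, 0, K) \<in> tab (heap s) \<or> (S, Suc K, Suc (2 * K)) \<in> tab (heap s) then 1 else 0)
    \<and> clock (sem accept s) \<le> clock s + 2 * index_cost Q W + 21"
proof -
  let ?s = "sem (get_entry v_x v_start v_zero v_K) s"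
  let ?t = "sem (Plus v_i v_K v_one ;; Minus v_j v_W v_one) ?s"
  let ?u = "sem (get_entry v_y v_start v_i v_j) ?t"
  have s: "vars s v_start = S" "vars s v_zero = 0" "vars s v_K = K" "vars s v_W = Suc (Suc (2 * K))" "vars s v_one = 1"
    using env assms(2) by (auto simp: env_def)
  have 1: "0 < vars ?s v_x \<longleftrightarrow> (S, 0, K) \<in> tab (heap s)" "clock ?s \<le> clock s + index_cost Q W + 7"
    using get_entry[of v_start v_zero s Q W v_K v_x] s assms by auto
  have 2: "0 < vars ?u v_y \<longleftrightarrow> (S, Suc K, Suc (2 * K)) \<in> tab (heap s)" "clock ?u \<le> clock ?t + index_cost Q W + 7"
    using get_entry[of v_start v_i ?t Q W v_j v_y] s assms by auto
  have "0 < vars ?s v_x + vars ?u v_y \<longleftrightarrow> (S, 0, K) \<in> tab (heap s) \<or> (S, Suc K, Suc (2 * K)) \<in> tab (heap s)"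
    using 1(1) 2(1) by simp
  moreover have "sem accept s = sem (Plus v_x v_x v_y ;; Cond v_x (Set v_ans 1) (Set v_ans 0)) ?u"
    by (simp add: accept_def)
  moreover have "vars ?u v_x = vars ?s v_x" "clock ?t = clock ?s + 2" by simp_all
  ultimately show ?thesis using 1(2) 2(2) by auto
qed

section \<open>The complete program and its running time\<close>

definition "main =
  Set v_one 1 ;; Set v_two 2 ;; Set v_zero 0 ;; read_classes ;; read_pattern ;; flip_pattern ;;
  skip_dict ;; read_prods ;; read_nonterminal v_start ;; seed_eps ;; seed_chr ;; saturate ;; accept"

lemma tags_ok_main: "tags_ok main"
  by (simp add: main_def read_classes_def read_pattern_def fill_block_def flip_pattern_def skip_dict_def
      read_prods_def read_prod_def read_nonterminal_def read_sym_def read_word_def emit_def emit_end_def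
      seed_eps_def seed_chr_def put_entry_def get_entry_def index_code_def pair_code_def saturate_def
      sat_round_def combine_all_def combine_def accept_def)

definition "run_time M =
  3 + (M * 15 + 7) + (M * (M * 15 + 15) + 9) + (M * 23 + 16) + (M * (M * 8 + 14) + 8)
  + (M * (M * (M * 40 + 39) + 41) + 9) + 4 + (M * (index_cost M M + 14) + 6) + (M * (index_cost M M + 23) + 6)
  + (index_cost M M + rounds_bound M M * (M * (combine_cost M M + 28) + 13) + 6) + (2 * index_cost M M + 21)"

text \<open>One \<open>M\<close> bounds all counts, positions and row names.
  \<open>2 * sum_list (pattern I) + 2 \<le> M\<close> makes the class word shorter than
  \<open>M\<close>, and \<open>3 \<le> M\<close> admits the row names of the three codes.\<close>

lemma main_correct:
  assumes "wf_rcs I" and s0: "s0 = \<lparr>vars = \<lambda>_. 0, heap = \<lambda>_ _. 0, inp = enc_rcs I, clock = 0\<rparr>"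
    and cl: "cl = (\<lambda>a. if a < length (classes I) then code (classes I ! a) else 0)"
    and "length (classes I) \<le> M" "length (pattern I) \<le> M" "2 * sum_list (pattern I) + 2 \<le> M" "3 \<le> M"
    and "length (dict I) \<le> M" "\<And>d. d \<in> set (dict I) \<Longrightarrow> length d \<le> M"
    and "length (prods I) \<le> M" "\<And>X \<alpha>. (X, \<alpha>) \<in> set (prods I) \<Longrightarrow> length \<alpha> \<le> M"
    and "length (grammar_rules cl 0 (prods I)) \<le> M"
    and "\<And>q a b. (q, a, b) \<in> set (grammar_rules cl 0 (prods I)) \<Longrightarrow> q \<le> M \<and> a \<le> M \<and> b \<le> M"
    and "4 + 2 * start I \<le> M"
  shows "vars (sem main s0) v_ans = (if rcs_solvable I then 1 else 0) \<and> clock (sem main s0) \<le> run_time M"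
proof -
  let ?rl = "grammar_rules cl 0 (prods I)" and ?c = "two_way_codes (pattern I)" and ?K = "sum_list (pattern I)"
  let ?S = "4 + 2 * start I"
  define s1 where "s1 = sem (Set v_one 1 ;; Set v_two 2 ;; Set v_zero 0) s0"
  define s2 where "s2 = sem read_classes s1"
  define s3 where "s3 = sem read_pattern s2"
  define s4 where "s4 = sem flip_pattern s3"
  define s5 where "s5 = sem skip_dict s4"
  define s6 where "s6 = sem read_prods s5"
  define s7 where "s7 = sem (read_nonterminal v_start) s6"
  define s8 where "s8 = sem seed_eps s7"
  define s9 where "s9 = sem seed_chr s8"
  define s10 where "s10 = sem saturate s9"
  define s11 where "s11 = sem accept s10"
  have main: "sem main s0 = s11"
    by (simp add: main_def s1_def s2_def s3_def s4_def s5_def s6_def s7_def s8_def s9_def s10_def s11_def)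
  let ?r6 = "enc_nat (start I)"
  let ?r5 = "enc_list enc_prod (prods I) @ ?r6"
  let ?r4 = "enc_list (enc_list enc_nat) (dict I) @ enc_nat (nnonterms I) @ ?r5"
  let ?r3 = "enc_list enc_nat (pattern I) @ ?r4"
  have one: "vars s1 v_one = 1" "vars s1 v_two = 2" "vars s1 v_zero = 0" "heap s1 t a = 0" "clock s1 = 3"
    "inp s1 = enc_list enc_class (classes I) @ ?r3" for t a
    by (simp_all add: s1_def s0 enc_rcs_def)
  have 2: "(\<forall>a. heap s2 h_class a = cl a) \<and> inp s2 = ?r3 \<and> clock s2 \<le> clock s1 + M * 15 + 7"
    unfolding s2_def cl by (rule read_classes) (use one assms in auto)
  have one2: "vars s2 v_one = 1" "vars s2 v_two = 2" "vars s2 v_zero = 0" using one by (simp_all add: s2_def)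
  have 3: "arr (heap s3 h_code) (position_codes 0 (pattern I)) \<and> vars s3 v_pos = ?K
      \<and> inp s3 = ?r4 \<and> clock s3 \<le> clock s2 + M * (M * 15 + 15) + 9"
    unfolding s3_def by (rule read_pattern) (use 2 one2 assms in auto)
  have one3: "vars s3 v_one = 1" "vars s3 v_two = 2" "vars s3 v_zero = 0" using one2 by (simp_all add: s3_def)
  have 4: "arr (heap s4 h_code) ?c \<and> vars s4 v_pos = Suc (2 * ?K) \<and> vars s4 v_W = Suc (Suc (2 * ?K))
      \<and> vars s4 v_K = ?K \<and> clock s4 \<le> clock s3 + M * 23 + 16"
    unfolding s4_def by (rule flip_pattern) (use 3 one3 assms in auto)
  have one4: "vars s4 v_one = 1" "vars s4 v_two = 2" "vars s4 v_zero = 0" using one3 by (simp_all add: s4_def)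
  have 5: "inp s5 = ?r5 \<and> clock s5 \<le> clock s4 + M * (M * 8 + 14) + 8"
    unfolding s5_def by (rule skip_dict) (use 3 assms in \<open>auto simp: s4_def\<close>)
  have one5: "vars s5 v_one = 1" "vars s5 v_two = 2" "vars s5 v_zero = 0" using one4 by (simp_all add: s5_def)
  have word: "length d \<le> M" if "(X, \<alpha>) \<in> set (prods I)" "Tm d \<in> set \<alpha>" for X \<alpha> d
    using that assms(1,9) by (fastforce simp: wf_rcs_def)
  have 6: "rules_rep ?rl (vars s6) (heap s6) \<and> inp s6 = ?r6 \<and> clock s6 \<le> clock s5 + M * (M * (M * 40 + 39) + 41) + 9"
    unfolding s6_def
  proof (rule read_prods)
    show "heap s5 h_class a = cl a" for a using 2 by (simp add: s5_def s4_def s3_def)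
  qed (use 5 one5 assms(10,11) word in auto)
  have one6: "vars s6 v_one = 1" "vars s6 v_two = 2" "vars s6 v_zero = 0" using one5 by (simp_all add: s6_def)
  have 7: "vars s7 v_start = ?S \<and> clock s7 = clock s6 + 4"
    using read_nonterminal[of s6 "start I" "[]" v_start] one6 6 by (simp add: s7_def enc_nat_def)
  have len: "length ?c = Suc (2 * ?K)" by (simp add: two_way_codes_def)
  have env7: "env ?K ?c ?rl ?S (vars s7) (heap s7)"
    using 4 6 7 one6 len by (simp add: env_def s7_def s6_def s5_def rules_rep_def)
  \<comment> \<open>No earlier stage writes to \<open>h_tab\<close>, so all its cells are still
    zero.\<close>
  have tab7: "tab (heap s7) = {}"
    using one(4) by (simp add: tab_def s7_def s6_def s5_def s4_def s3_def s2_def)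
  have lt: "length ?c < M" using len assms(6) by simp
  have c3: "?c ! i < 3" if "i < length ?c" for i
    using nth_mem[OF that] position_codes_less[of 0 "?c ! i" "pattern I"] position_codes_less[of 1 "?c ! i" "pattern I"]
    by (auto simp: two_way_codes_def)
  have 8: "{(0, i, i) | i. i \<le> length ?c} \<subseteq> tab (heap s8)" "tab (heap s8) \<subseteq> items (set ?rl) ?c"
    "clock s8 \<le> clock s7 + (M * (index_cost M M + 14) + 6)"
    using addsD[OF seed_eps[OF lt, of ?K ?rl ?S "{}" "set ?rl" M], of s7, OF env7] tab7
    by (auto simp: s8_def)
  have env8: "env ?K ?c ?rl ?S (vars s8) (heap s8)" using env7 by (simp add: env_def s8_def)
  have "adds (env ?K ?c ?rl ?S) seed_chr {} {(Suc (?c ! i), i, Suc i) | i. i < length ?c} (items (set ?rl) ?c)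
      (M * (index_cost M M + 23) + 6)"
    by (rule seed_chr[OF lt]) (use c3 assms(7) in fastforce)
  from addsD[OF this, of s8, OF env8] 8
  have 9: "seeds ?c \<subseteq> tab (heap s9)" "tab (heap s9) \<subseteq> items (set ?rl) ?c"
    "clock s9 \<le> clock s8 + (M * (index_cost M M + 23) + 6)"
    by (auto simp: s9_def seeds_def)
  have env9: "env ?K ?c ?rl ?S (vars s9) (heap s9)" using env8 by (simp add: env_def s9_def)
  have 10: "tab (heap s10) = items (set ?rl) ?c \<and> clock s10 \<le> clock s9 + index_cost M M
      + rounds_bound M M * (M * (combine_cost M M + 28) + 13) + 6"
    unfolding s10_def by (rule saturate[OF env9 9(1,2) lt assms(12,13)])
  have env10: "env ?K ?c ?rl ?S (vars s10) (heap s10)" using env9 by (simp add: env_def s10_def)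
  have 11: "vars s11 v_ans = (if (?S, 0, ?K) \<in> tab (heap s10) \<or> (?S, Suc ?K, Suc (2 * ?K)) \<in> tab (heap s10) then 1 else 0)
    \<and> clock s11 \<le> clock s10 + 2 * index_cost M M + 21"
    unfolding s11_def by (rule accept[OF env10 len lt assms(14)])
  have "rcs_solvable I \<longleftrightarrow> (?S, 0, ?K) \<in> tab (heap s10) \<or> (?S, Suc ?K, Suc (2 * ?K)) \<in> tab (heap s10)"
    using rcs_solvable_iff_item[OF assms(1) cl refl refl refl] 10 by simp
  moreover have "clock s11 \<le> run_time M"
    using one(5) 2 3 4 5 6 7 8(3) 9(3) 10 11 unfolding run_time_def by linarith
  ultimately show ?thesis using 11 unfolding main by simp
qed

section \<open>Polynomial bounds in the size of the instance\<close>

definition is_poly :: "(nat \<Rightarrow> nat) \<Rightarrow> bool" where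
  "is_poly f \<longleftrightarrow> (\<exists>p :: nat poly. \<forall>n. f n = poly p n)"

lemma is_poly_const: "is_poly (\<lambda>_. c)"
  unfolding is_poly_def by (intro exI[of _ "[:c:]"]) simp

lemma is_poly_id: "is_poly (\<lambda>n. n)"
  unfolding is_poly_def by (intro exI[of _ "[:0, 1:]"]) simp

lemma is_poly_add: "is_poly f \<Longrightarrow> is_poly g \<Longrightarrow> is_poly (\<lambda>n. f n + g n)"
  unfolding is_poly_def by (metis poly_add)

lemma is_poly_mult: "is_poly f \<Longrightarrow> is_poly g \<Longrightarrow> is_poly (\<lambda>n. f n * g n)"
  unfolding is_poly_def by (metis poly_mult)

text \<open>All cost functions are built from sums and products, so closure properties give a
  polynomial that never has to be expanded.\<close>

lemma is_poly_run_time: "is_poly f \<Longrightarrow> is_poly (\<lambda>n. run_time (f n))"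
  unfolding run_time_def index_cost_def rounds_bound_def combine_cost_def power2_eq_square
  by (intro is_poly_const is_poly_add is_poly_mult)

lemma rhs_rules_bound:
  assumes "(q', a, b) \<in> set (rhs_rules r q ts)" "q \<le> B" "\<And>t. t \<in> set ts \<Longrightarrow> t \<le> B" "5 + 2 * (r + length ts) \<le> B"
  shows "q' \<le> B \<and> a \<le> B \<and> b \<le> B"
  using assms by (induction r q ts rule: rhs_rules.induct) auto

lemma grammar_rules_bound:
  assumes "(q', a, b) \<in> set (grammar_rules cl r ps)"
    "\<And>X \<alpha>. (X, \<alpha>) \<in> set ps \<Longrightarrow> 4 + 2 * X \<le> B" "\<And>X \<alpha> t. (X, \<alpha>) \<in> set ps \<Longrightarrow> t \<in> set (ids cl \<alpha>) \<Longrightarrow> t \<le> B"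
    "5 + 2 * (r + length (grammar_rules cl r ps)) \<le> B"
  shows "q' \<le> B \<and> a \<le> B \<and> b \<le> B"
  using assms
proof (induction cl r ps rule: grammar_rules.induct)
  case (2 cl r X \<alpha> ps)
  show ?case
  proof (cases "(q', a, b) \<in> set (rhs_rules r (4 + 2 * X) (ids cl \<alpha>))")
    case True
    then show ?thesis
      by (rule rhs_rules_bound) (use 2(3)[of X \<alpha>] 2(4)[of X \<alpha>] 2(5) in auto)
  next
    case False
    show ?thesis
      by (rule 2(1)) (use False 2(2) 2(3) 2(4) 2(5) in fastforce)+
  qed
qed simp

text \<open>A nonterminal contributes one name and a word at most \<open>n\<close>;
  \<open>Suc n\<close> covers both, also for \<open>n = 0\<close>.\<close>

lemma length_ids:
  assumes "\<And>d. Tm d \<in> set \<alpha> \<Longrightarrow> length d \<le> n"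
  shows "length (ids cl \<alpha>) \<le> length \<alpha> * Suc n"
  using assms
proof (induction \<alpha>)
  case (Cons x \<alpha>)
  then have "length (sym_ids cl x) \<le> Suc n" by (cases x) (auto intro: le_SucI)
  then show ?case using Cons by simp
qed simp

text \<open>The extra unit per production pays for its closing rule.\<close>

lemma length_grammar_rules:
  assumes "\<And>X \<alpha> d. (X, \<alpha>) \<in> set ps \<Longrightarrow> Tm d \<in> set \<alpha> \<Longrightarrow> length d \<le> n"
  shows "length (grammar_rules cl r ps) \<le> (\<Sum>(X, \<alpha>) \<leftarrow> ps. length \<alpha> + 1) * Suc n"
  using assms
proof (induction cl r ps rule: grammar_rules.induct)
  case (2 cl r X \<alpha> ps)
  have "length (ids cl \<alpha>) \<le> length \<alpha> * Suc n" by (rule length_ids) (use 2(2) in auto)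
  moreover have "length (grammar_rules cl (r + Suc (length (ids cl \<alpha>))) ps) \<le> (\<Sum>(X, \<alpha>) \<leftarrow> ps. length \<alpha> + 1) * Suc n"
    by (rule 2(1)) (use 2(2) in auto)
  ultimately show ?case by (simp add: algebra_simps)
qed simp

text \<open>The product bounds twice the number of rules and so the suffix names;
  \<open>2 * n\<close> covers nonterminal names and positions, and the constant absorbs the
  offsets.\<close>

definition "machine_bound n = 2 * (n * Suc n) + 2 * n + 9"

lemma is_poly_machine_bound: "is_poly machine_bound"
proof -
  have "is_poly (\<lambda>n. 2 * (n * (n + 1)) + 2 * n + 9)"
    by (intro is_poly_const is_poly_id is_poly_add is_poly_mult)
  then show ?thesis by (simp add: machine_bound_def[abs_def])
qed

lemma main_decides:
  assumes wf: "wf_rcs I" and s0: "s0 = \<lparr>vars = \<lambda>_. 0, heap = \<lambda>_ _. 0, inp = enc_rcs I, clock = 0\<rparr>"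
  shows "vars (sem main s0) v_ans = (if rcs_solvable I then 1 else 0)
    \<and> clock (sem main s0) \<le> run_time (machine_bound (rcs_size I))"
proof -
  let ?n = "rcs_size I" and ?M = "machine_bound (rcs_size I)"
  define cl where "cl = (\<lambda>a. if a < length (classes I) then code (classes I ! a) else 0)"
  have nM: "2 * ?n + 9 \<le> ?M" "?n \<le> ?M" by (simp_all add: machine_bound_def)
  have size: "length (classes I) \<le> ?n" "sum_list (pattern I) \<le> ?n" "(\<Sum>d \<leftarrow> dict I. length d + 1) \<le> ?n"
    "nnonterms I \<le> ?n" "(\<Sum>(X, \<alpha>) \<leftarrow> prods I. length \<alpha> + 1) \<le> ?n"
    by (simp_all add: rcs_size_def)
  \<comment> \<open>Positivity of the pattern matters here: the size charges only \<open>K\<close>,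
    but the program also loops over the blocks.\<close>
  have "length ks \<le> sum_list ks" if "\<forall>k \<in> set ks. 0 < k" for ks :: "nat list"
    using that by (induction ks) auto
  then have pat: "length (pattern I) \<le> ?n" using wf size(2) by (force simp: wf_rcs_def)
  have "length ds \<le> (\<Sum>d \<leftarrow> ds. length d + 1)" for ds :: "word list" by (induction ds) auto
  then have dict: "length (dict I) \<le> ?n" using size(3) order_trans by blast
  have "d \<in> set ds \<Longrightarrow> length d \<le> (\<Sum>d \<leftarrow> ds. length d + 1)" for d and ds :: "word list" by (induction ds) auto
  then have word: "length d \<le> ?n" if "d \<in> set (dict I)" for d using that size(3) order_trans by blast
  have "length ps \<le> (\<Sum>(X, \<alpha>) \<leftarrow> ps. length \<alpha> + 1)" for ps :: "(nat, word) production list" by (induction ps) auto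
  then have prods: "length (prods I) \<le> ?n" using size(5) order_trans by blast
  have "(X, \<alpha>) \<in> set ps \<Longrightarrow> length \<alpha> \<le> (\<Sum>(X, \<alpha>) \<leftarrow> ps. length \<alpha> + 1)" for X \<alpha> and ps :: "(nat, word) production list"
    by (induction ps) auto
  then have rhs: "length \<alpha> \<le> ?n" if "(X, \<alpha>) \<in> set (prods I)" for X \<alpha> using that size(5) order_trans by blast
  \<comment> \<open>A terminal counts once in \<open>rcs_size\<close> whatever its length, but as a
    dictionary word it is charged letter by letter in the dictionary.\<close>
  have tm: "length d \<le> ?n" if "(X, \<alpha>) \<in> set (prods I)" "Tm d \<in> set \<alpha>" for X \<alpha> d
    using that wf by (intro word) (fastforce simp: wf_rcs_def)
  have wf_prod: "X \<in> nonterms I \<and> set \<alpha> \<subseteq> NT ` nonterms I \<union> Tm ` set (dict I)" if "(X, \<alpha>) \<in> set (prods I)" for X \<alpha>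
    using that wf by (auto simp: wf_rcs_def simp del: Un_iff)
  have nt: "X < ?n" if "X \<in> nonterms I" for X using that size(4) by (simp add: nonterms_def)
  have "length (grammar_rules cl 0 (prods I)) \<le> (\<Sum>(X, \<alpha>) \<leftarrow> prods I. length \<alpha> + 1) * Suc ?n"
    by (rule length_grammar_rules) (rule tm)
  also have "\<dots> \<le> ?n * Suc ?n" by (rule mult_le_mono1[OF size(5)])
  finally have rules: "5 + 2 * (0 + length (grammar_rules cl 0 (prods I))) \<le> ?M"
    by (simp add: machine_bound_def)
  have "t \<le> ?M" if p: "(X, \<alpha>) \<in> set (prods I)" and t: "t \<in> set (ids cl \<alpha>)" for X \<alpha> t
  proof -
    from t obtain s where s: "s \<in> set \<alpha>" "t \<in> set (sym_ids cl s)" by auto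
    have "cl a \<le> 1" for a using code_less_2[of "classes I ! a"] by (simp add: cl_def)
    moreover have "Y < ?n" if "s = NT Y" for Y
    proof (rule nt)
      show "Y \<in> nonterms I" using wf_prod[OF p] s(1) that by auto
    qed
    ultimately show ?thesis
    proof (cases s)
      case (NT Y)
      then show ?thesis using s(2) \<open>\<And>Y. s = NT Y \<Longrightarrow> Y < ?n\<close>[OF NT] nM by simp
    next
      case (Tm d)
      then obtain a where "t = Suc (cl a)" using s(2) by auto
      then show ?thesis using \<open>\<And>a. cl a \<le> 1\<close>[of a] nM by simp
    qed
  qed
  moreover have "4 + 2 * X \<le> ?M" if "(X, \<alpha>) \<in> set (prods I)" for X \<alpha>
    using wf_prod[OF that] nt[of X] nM by simp
  ultimately have ids: "q \<le> ?M \<and> a \<le> ?M \<and> b \<le> ?M" if "(q, a, b) \<in> set (grammar_rules cl 0 (prods I))" for q a b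
    using grammar_rules_bound[OF that, of ?M] rules by blast
  show ?thesis
  proof (rule main_correct[OF wf s0 cl_def])
    show "4 + 2 * start I \<le> ?M" using wf nt[of "start I"] nM by (simp add: wf_rcs_def)
    show "length d \<le> ?M" if "d \<in> set (dict I)" for d using word[OF that] nM by simp
    show "length \<alpha> \<le> ?M" if "(X, \<alpha>) \<in> set (prods I)" for X \<alpha> using rhs[OF that] nM by simp
  qed (use size pat dict prods rules ids nM in auto)
qed

theorem theorem5p4:
  "poly_time_decidable {I. wf_rcs I} enc_rcs rcs_size rcs_solvable"
proof -
  obtain p :: "nat poly" where p: "\<And>n. run_time (machine_bound n) = poly p n"
    using is_poly_run_time[OF is_poly_machine_bound] by (auto simp: is_poly_def)
  have "ram_computes_within (compile main 0 0) (enc_rcs I) (poly p (rcs_size I)) (if rcs_solvable I then 1 else 0)"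
    if "wf_rcs I" for I
  proof -
    define s where "s = sem main \<lparr>vars = \<lambda>_. 0, heap = \<lambda>_ _. 0, inp = enc_rcs I, clock = 0\<rparr>"
    have "vars s 0 = (if rcs_solvable I then 1 else 0)" "clock s \<le> poly p (rcs_size I)"
      using main_decides[OF that refl] p by (simp_all add: s_def)
    with ram_computes_within_compile[OF tags_ok_main s_def] show ?thesis by metis
  qed
  then show ?thesis unfolding poly_time_decidable_def by blast
qed

end
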